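(* Let $M$ be a $3$-dimensional proper CR submanifold of the nearly Kähler manifold $(\mathbb{S}^3\times\mathbb{S}^3,g,J)$ such that $P\mathcal{D}_1=\mathcal{D}_3$. Then $M$ is locally congruent to one of the following immersions of $\mathbb{S}^3$ into $\mathbb{S}^3\times\mathbb{S}^3$: \begin{align*} f_1(u)&=\Big(u\,\tfrac{\sqrt3+i}{2}\,u^{-1},\ u^{-1}\Big),\\ f_2(u)&=\Big(u^{-1},\ u\,\tfrac{\sqrt3+i}{2}\,u^{-1}\Big),\\ f_3(u)&=\Big(u,\ u\,\tfrac{\sqrt3+i}{2}\Big), \end{align*} where $u\in\mathbb{S}^3$.
   Context: Identify $\mathbb{S}^3$ with the unit quaternions in $\mathbb{H}=\mathbb{R}^4$ with standard imaginary units $i,j,k$. A tangent vector of $\mathbb{S}^3\times\mathbb{S}^3$ at $(p,q)$ is written $Z=(p\alpha,q\beta)$ with $\alpha,\beta\in\mathrm{Im}\,\mathbb{H}$. The almost complex structure is $J(p\alpha,q\beta)=\frac{1}{\sqrt3}\big(p(2\beta-\alpha),q(-2\alpha+\beta)\big)$, and the nearly Kähler metric is $g(Z,Z')=\frac12(\langle Z,Z'\rangle+\langle JZ,JZ'\rangle)$, where $\langle\cdot,\cdot\rangle$ is the standard product metric induced from $\mathbb{R}^4\times\mathbb{R}^4$. Let $\widetilde\nabla$ be the Levi-Civita connection of $g$ and $G(X,Y)=(\widetilde\nabla_XJ)Y$, a skew-symmetric tensor. The almost product structure $P$ is $P(p\alpha,q\beta)=(p\beta,q\alpha)$. All objects are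 smooth. A submanifold $M$ is a CR submanifold if there is a smooth distribution $\mathcal{D}_1\subseteq TM$ with $J\mathcal{D}_1=\mathcal{D}_1$ whose $g$-orthogonal complement $\mathcal{D}_1^\perp$ in $TM$ is totally real, i.e. $J\mathcal{D}_1^\perp\subseteq T^\perp M$. It is proper if it is neither almost complex nor totally real. For a $3$-dimensional proper CR submanifold, $\mathcal{D}_1=JTM\cap TM$ has rank $2$ and $\mathcal{D}_1^\perp$ has rank $1$. Along such $M$ put $\mathcal{D}_2=\mathcal{D}_1^\perp\oplus J\mathcal{D}_1^\perp$ and $\mathcal{D}_3=G(\mathcal{D}_1,\mathcal{D}_2)$. These are $J$-invariant rank-$2$ bundles over $M$, and $T(\mathbb{S}^3\times\mathbb{S}^3)|_M=\mathcal{D}_1\oplus\mathcal{D}_2\oplus\mathcal{D}_3$ is a $g$-orthogonal decomposition. For unit quaternions $a,b,c$, the map $\mathcal{F}_{abc}(p,q)=(ap\bar c,bq\bar c)$ is an isometry of $(\mathbb{S}^3\times\mathbb{S}^3,g)$ preserving $J$ and $P$. "$M$ is locally congruent to one of the immersions" means: each point of $M$ has a neighbourhood which is the image, under some $\mathcal{F}_{abc}$, of the restriction of one of the listed immersions to an open subset of $\mathbb{S}^3$. *)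

theory Defs
  imports "HOL-Analysis.Analysis"
begin

section \<open>Quaternions and the nearly Kaehler structure\<close>

text \<open>
  A quaternion is a vector of \<open>real^4\<close> whose components 1, 2, 3, 4 are the coefficients of
  \<open>1\<close>, \<open>i\<close>, \<open>j\<close>, \<open>k\<close>. The library multiplication on \<open>real^4\<close> is componentwise, hence the separate
  symbol for the quaternion product.
\<close>

type_synonym quat = "real^4"

definition qmult :: "quat \<Rightarrow> quat \<Rightarrow> quat" (infixl \<open>\<odot>\<close> 70) where
  "x \<odot> y = vector
     [x$1 * y$1 - x$2 * y$2 - x$3 * y$3 - x$4 * y$4,
      x$1 * y$2 + x$2 * y$1 + x$3 * y$4 - x$4 * y$3,
      x$1 * y$3 - x$2 * y$4 + x$3 * y$1 + x$4 * y$2,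
      x$1 * y$4 + x$2 * y$3 - x$3 * y$2 + x$4 * y$1]"

definition qcnj :: "quat \<Rightarrow> quat" where
  "qcnj x = vector [x$1, - x$2, - x$3, - x$4]"

definition qinv :: "quat \<Rightarrow> quat" where
  "qinv x = (1 / (norm x)\<^sup>2) *\<^sub>R qcnj x"

definition ImH :: "quat set" where
  "ImH = {x. x$1 = 0}"

definition S3 :: "quat set" where
  "S3 = sphere 0 1"

definition S3S3 :: "(quat \<times> quat) set" where
  "S3S3 = S3 \<times> S3"

definition tangent_S3S3 :: "quat \<times> quat \<Rightarrow> (quat \<times> quat) set" where
  "tangent_S3S3 x = {(fst x \<odot> \<alpha>, snd x \<odot> \<beta>) | \<alpha> \<beta>. \<alpha> \<in> ImH \<and> \<beta> \<in> ImH}"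

text \<open>
  In the tensors below the first argument is the base point \<open>(p, q)\<close>. A tangent vector
  \<open>(v, w) = (p \<alpha>, q \<beta>)\<close> at \<open>(p, q)\<close> has \<open>\<alpha> = p\<inverse> v\<close> and \<open>\<beta> = q\<inverse> w\<close>.
\<close>

definition Jst :: "quat \<times> quat \<Rightarrow> quat \<times> quat \<Rightarrow> quat \<times> quat" where
  "Jst x Z = (let \<alpha> = qinv (fst x) \<odot> fst Z; \<beta> = qinv (snd x) \<odot> snd Z in
     (1 / sqrt 3) *\<^sub>R (fst x \<odot> (2 *\<^sub>R \<beta> - \<alpha>), snd x \<odot> (\<beta> - 2 *\<^sub>R \<alpha>)))"

definition Pst :: "quat \<times> quat \<Rightarrow> quat \<times> quat \<Rightarrow> quat \<times> quat" where
  "Pst x Z = (let \<alpha> = qinv (fst x) \<odot> fst Z; \<beta> = qinv (snd x) \<odot> snd Z in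
     (fst x \<odot> \<beta>, snd x \<odot> \<alpha>))"

definition gNK :: "quat \<times> quat \<Rightarrow> quat \<times> quat \<Rightarrow> quat \<times> quat \<Rightarrow> real" where
  "gNK x Z Z' = (1/2) * (Z \<bullet> Z' + Jst x Z \<bullet> Jst x Z')"

section \<open>Smooth maps\<close>

primrec Ck_on :: "nat \<Rightarrow> 'a::real_normed_vector set \<Rightarrow> ('a \<Rightarrow> 'b::real_normed_vector) \<Rightarrow> bool" where
  "Ck_on 0 U f \<longleftrightarrow> continuous_on U f"
| "Ck_on (Suc k) U f \<longleftrightarrow> (\<forall>x\<in>U. f differentiable (at x)) \<and>
     (\<forall>v. Ck_on k U (\<lambda>x. frechet_derivative f (at x) v))"

text \<open>Smoothness on an arbitrary subset means having smooth local extensions to open sets.\<close>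

definition smooth_on :: "'a::real_normed_vector set \<Rightarrow> ('a \<Rightarrow> 'b::real_normed_vector) \<Rightarrow> bool" where
  "smooth_on S f \<longleftrightarrow> (\<forall>x\<in>S. \<exists>U F. open U \<and> x \<in> U \<and> (\<forall>k. Ck_on k U F) \<and> (\<forall>y\<in>U \<inter> S. F y = f y))"

section \<open>The Levi-Civita connection\<close>

definition vector_field :: "(quat \<times> quat \<Rightarrow> quat \<times> quat) \<Rightarrow> bool" where
  "vector_field X \<longleftrightarrow> smooth_on S3S3 X \<and> (\<forall>x\<in>S3S3. X x \<in> tangent_S3S3 x)"

text \<open>
  The derivative within \<open>S3S3\<close> is unique only on tangent vectors, and is only ever applied to those.
  Consequently, for vector fields \<open>X\<close> and \<open>Y\<close> the Lie bracket at \<open>x\<close> is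
  \<open>dir_deriv Y x (X x) - dir_deriv X x (Y x)\<close>.
\<close>

definition dir_deriv :: "(quat \<times> quat \<Rightarrow> 'b::real_normed_vector) \<Rightarrow> quat \<times> quat \<Rightarrow> quat \<times> quat \<Rightarrow> 'b" where
  "dir_deriv f x v = frechet_derivative f (at x within S3S3) v"

type_synonym connection =
  "(quat \<times> quat \<Rightarrow> quat \<times> quat) \<Rightarrow> (quat \<times> quat \<Rightarrow> quat \<times> quat) \<Rightarrow> quat \<times> quat \<Rightarrow> quat \<times> quat"

definition affine_connection :: "connection \<Rightarrow> bool" where
  "affine_connection cov \<longleftrightarrow>
     (\<forall>X Y. vector_field X \<longrightarrow> vector_field Y \<longrightarrow> vector_field (cov X Y)) \<and>
     (\<forall>X X' Y. vector_field X \<longrightarrow> vector_field X' \<longrightarrow> vector_field Y \<longrightarrow>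
        (\<forall>x\<in>S3S3. cov (\<lambda>y. X y + X' y) Y x = cov X Y x + cov X' Y x)) \<and>
     (\<forall>X Y Y'. vector_field X \<longrightarrow> vector_field Y \<longrightarrow> vector_field Y' \<longrightarrow>
        (\<forall>x\<in>S3S3. cov X (\<lambda>y. Y y + Y' y) x = cov X Y x + cov X Y' x)) \<and>
     (\<forall>(f :: quat \<times> quat \<Rightarrow> real) X Y. smooth_on S3S3 f \<longrightarrow> vector_field X \<longrightarrow> vector_field Y \<longrightarrow>
        (\<forall>x\<in>S3S3. cov (\<lambda>y. f y *\<^sub>R X y) Y x = f x *\<^sub>R cov X Y x)) \<and>
     (\<forall>(f :: quat \<times> quat \<Rightarrow> real) X Y. smooth_on S3S3 f \<longrightarrow> vector_field X \<longrightarrow> vector_field Y \<longrightarrow>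
        (\<forall>x\<in>S3S3. cov X (\<lambda>y. f y *\<^sub>R Y y) x = dir_deriv f x (X x) *\<^sub>R Y x + f x *\<^sub>R cov X Y x))"

definition torsion_free :: "connection \<Rightarrow> bool" where
  "torsion_free cov \<longleftrightarrow> (\<forall>X Y. vector_field X \<longrightarrow> vector_field Y \<longrightarrow>
     (\<forall>x\<in>S3S3. cov X Y x - cov Y X x = dir_deriv Y x (X x) - dir_deriv X x (Y x)))"

definition metric_compatible :: "connection \<Rightarrow> bool" where
  "metric_compatible cov \<longleftrightarrow> (\<forall>X Y Z. vector_field X \<longrightarrow> vector_field Y \<longrightarrow> vector_field Z \<longrightarrow>
     (\<forall>x\<in>S3S3. dir_deriv (\<lambda>y. gNK y (Y y) (Z y)) x (X x) =
        gNK x (cov X Y x) (Z x) + gNK x (Y x) (cov X Z x)))"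

definition levi_civita :: "connection \<Rightarrow> bool" where
  "levi_civita cov \<longleftrightarrow> affine_connection cov \<and> torsion_free cov \<and> metric_compatible cov"

text \<open>\<open>G(X, Y) = (cov\<^sub>X J) Y = cov\<^sub>X (J Y) - J (cov\<^sub>X Y)\<close>\<close>

definition Gtensor :: "connection \<Rightarrow> connection" where
  "Gtensor cov X Y x = cov X (\<lambda>y. Jst y (Y y)) x - Jst x (cov X Y x)"

section \<open>Three-dimensional submanifolds\<close>

text \<open>
  A submanifold is given by a topological space \<open>M\<close> and a map \<open>\<iota>\<close> into \<open>S3S3\<close>; an embedded
  submanifold is the case where \<open>M\<close> is a subspace and \<open>\<iota>\<close> the inclusion. The smooth structure is the
  one for which \<open>\<iota>\<close> is an immersion. It need not be recorded: if \<open>\<iota> \<circ> \<phi>\<close> and \<open>\<iota> \<circ> \<psi>\<close> are smooth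
  immersions for two local parametrizations, then the transition map \<open>\<phi>\<inverse> \<circ> \<psi>\<close> is smooth.
\<close>

definition local_param :: "'m topology \<Rightarrow> ('m \<Rightarrow> quat \<times> quat) \<Rightarrow> (real^3) set \<Rightarrow> (real^3 \<Rightarrow> 'm) \<Rightarrow> bool" where
  "local_param M \<iota> U \<phi> \<longleftrightarrow>
     open U \<and> openin M (\<phi> ` U) \<and>
     homeomorphic_map (top_of_set U) (subtopology M (\<phi> ` U)) \<phi> \<and>
     smooth_on U (\<iota> \<circ> \<phi>) \<and>
     (\<forall>t\<in>U. inj (frechet_derivative (\<iota> \<circ> \<phi>) (at t)))"

definition submanifold3 :: "'m topology \<Rightarrow> ('m \<Rightarrow> quat \<times> quat) \<Rightarrow> bool" where
  "submanifold3 M \<iota> \<longleftrightarrow>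
     Hausdorff_space M \<and> second_countable M \<and> \<iota> ` topspace M \<subseteq> S3S3 \<and>
     (\<forall>x\<in>topspace M. \<exists>U \<phi>. local_param M \<iota> U \<phi> \<and> x \<in> \<phi> ` U)"

definition tangentM :: "'m topology \<Rightarrow> ('m \<Rightarrow> quat \<times> quat) \<Rightarrow> 'm \<Rightarrow> (quat \<times> quat) set" where
  "tangentM M \<iota> x = {v. \<exists>U \<phi> t. local_param M \<iota> U \<phi> \<and> t \<in> U \<and> \<phi> t = x \<and>
     v \<in> range (frechet_derivative (\<iota> \<circ> \<phi>) (at t))}"

definition normalM :: "'m topology \<Rightarrow> ('m \<Rightarrow> quat \<times> quat) \<Rightarrow> 'm \<Rightarrow> (quat \<times> quat) set" where
  "normalM M \<iota> x = {w \<in> tangent_S3S3 (\<iota> x). \<forall>v\<in>tangentM M \<iota> x. gNK (\<iota> x) w v = 0}"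

definition complM ::
  "'m topology \<Rightarrow> ('m \<Rightarrow> quat \<times> quat) \<Rightarrow> ('m \<Rightarrow> (quat \<times> quat) set) \<Rightarrow> 'm \<Rightarrow> (quat \<times> quat) set" where
  "complM M \<iota> D x = {w \<in> tangentM M \<iota> x. \<forall>v\<in>D x. gNK (\<iota> x) w v = 0}"

definition smooth_distribution ::
  "'m topology \<Rightarrow> ('m \<Rightarrow> quat \<times> quat) \<Rightarrow> nat \<Rightarrow> ('m \<Rightarrow> (quat \<times> quat) set) \<Rightarrow> bool" where
  "smooth_distribution M \<iota> k D \<longleftrightarrow> (\<forall>x\<in>topspace M.
     subspace (D x) \<and> dim (D x) = k \<and> D x \<subseteq> tangentM M \<iota> x \<and>
     (\<exists>U \<phi> E. local_param M \<iota> U \<phi> \<and> x \<in> \<phi> ` U \<and> (\<forall>i<k. smooth_on U (E i)) \<and>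
        (\<forall>t\<in>U. D (\<phi> t) = span {E i t | i. i < k})))"

definition CR_submanifold3 :: "'m topology \<Rightarrow> ('m \<Rightarrow> quat \<times> quat) \<Rightarrow> bool" where
  "CR_submanifold3 M \<iota> \<longleftrightarrow> submanifold3 M \<iota> \<and>
     (\<exists>k D. smooth_distribution M \<iota> k D \<and>
        (\<forall>x\<in>topspace M. Jst (\<iota> x) ` D x = D x \<and> Jst (\<iota> x) ` complM M \<iota> D x \<subseteq> normalM M \<iota> x))"

definition almost_complex :: "'m topology \<Rightarrow> ('m \<Rightarrow> quat \<times> quat) \<Rightarrow> bool" where
  "almost_complex M \<iota> \<longleftrightarrow> (\<forall>x\<in>topspace M. Jst (\<iota> x) ` tangentM M \<iota> x = tangentM M \<iota> x)"

definition totally_real :: "'m topology \<Rightarrow> ('m \<Rightarrow> quat \<times> quat) \<Rightarrow> bool" where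
  "totally_real M \<iota> \<longleftrightarrow> (\<forall>x\<in>topspace M. Jst (\<iota> x) ` tangentM M \<iota> x \<subseteq> normalM M \<iota> x)"

definition proper_CR_submanifold3 :: "'m topology \<Rightarrow> ('m \<Rightarrow> quat \<times> quat) \<Rightarrow> bool" where
  "proper_CR_submanifold3 M \<iota> \<longleftrightarrow>
     CR_submanifold3 M \<iota> \<and> \<not> almost_complex M \<iota> \<and> \<not> totally_real M \<iota>"

definition D1 :: "'m topology \<Rightarrow> ('m \<Rightarrow> quat \<times> quat) \<Rightarrow> 'm \<Rightarrow> (quat \<times> quat) set" where
  "D1 M \<iota> x = Jst (\<iota> x) ` tangentM M \<iota> x \<inter> tangentM M \<iota> x"

definition D2 :: "'m topology \<Rightarrow> ('m \<Rightarrow> quat \<times> quat) \<Rightarrow> 'm \<Rightarrow> (quat \<times> quat) set" where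
  "D2 M \<iota> x = {v + Jst (\<iota> x) w | v w. v \<in> complM M \<iota> (D1 M \<iota>) x \<and> w \<in> complM M \<iota> (D1 M \<iota>) x}"

text \<open>
  \<open>G\<close> is a tensor, so its value on two tangent vectors is computed from any vector fields on \<open>S3S3\<close>
  extending them.
\<close>

definition D3 :: "connection \<Rightarrow> 'm topology \<Rightarrow> ('m \<Rightarrow> quat \<times> quat) \<Rightarrow> 'm \<Rightarrow> (quat \<times> quat) set" where
  "D3 cov M \<iota> x = span {Gtensor cov X Y (\<iota> x) | X Y. vector_field X \<and> vector_field Y \<and>
     X (\<iota> x) \<in> D1 M \<iota> x \<and> Y (\<iota> x) \<in> D2 M \<iota> x}"

section \<open>Local congruence\<close>

definition Fiso :: "quat \<Rightarrow> quat \<Rightarrow> quat \<Rightarrow> quat \<times> quat \<Rightarrow> quat \<times> quat" where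
  "Fiso a b c x = (a \<odot> fst x \<odot> qcnj c, b \<odot> snd x \<odot> qcnj c)"

text \<open>Injectivity of \<open>\<iota>\<close> on \<open>N\<close> identifies the neighbourhood \<open>N\<close> with its image in \<open>S3S3\<close>.\<close>

definition locally_congruent_to_one_of ::
  "'m topology \<Rightarrow> ('m \<Rightarrow> quat \<times> quat) \<Rightarrow> (quat \<Rightarrow> quat \<times> quat) set \<Rightarrow> bool" where
  "locally_congruent_to_one_of M \<iota> \<F> \<longleftrightarrow> (\<forall>x\<in>topspace M. \<exists>N. openin M N \<and> x \<in> N \<and> inj_on \<iota> N \<and>
     (\<exists>f\<in>\<F>. \<exists>a\<in>S3. \<exists>b\<in>S3. \<exists>c\<in>S3. \<exists>W. openin (top_of_set S3) W \<and> \<iota> ` N = Fiso a b c ` f ` W))"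

definition q0 :: quat where
  "q0 = vector [sqrt 3 / 2, 1 / 2, 0, 0]"

definition f1 :: "quat \<Rightarrow> quat \<times> quat" where
  "f1 u = (u \<odot> q0 \<odot> qinv u, qinv u)"

definition f2 :: "quat \<Rightarrow> quat \<times> quat" where
  "f2 u = (qinv u, u \<odot> q0 \<odot> qinv u)"

definition f3 :: "quat \<Rightarrow> quat \<times> quat" where
  "f3 u = (u, u \<odot> q0)"

end

theory Submission
  imports Defs
begin

text \<open>
  Trivialize the tangent bundle by left translation, so that a tangent vector is a pair \<open>(\<alpha>, \<beta>)\<close> of vectors of
  \<open>real^3\<close>, and put \<open>\<zeta> = \<alpha> + \<omega> \<beta>\<close> with \<open>\<omega>\<close> a primitive cube root of unity. Then \<open>J\<close> is multiplication by \<open>i\<close>,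
  \<open>P\<close> is complex conjugation and \<open>G\<close> is the conjugate of the complex cross product, both up to constants. Hence
  \<open>P D\<^sub>1 = D\<^sub>3\<close> says that \<open>D\<^sub>1\<close> is spanned by an isotropic vector \<open>a + i b\<close>, and \<open>D\<^sub>2\<close> by the real unit vector \<open>n\<close>
  in the direction of \<open>a \<times> b\<close>. The tangent space is therefore determined by \<open>n\<close> and the line of pairs
  \<open>(x, y)\<close> with \<open>(x n, y n)\<close> tangent. Differentiating these conditions along \<open>M\<close> and comparing with the Maurer-Cartan
  equations forces \<open>x y (y - x) = 0\<close> and determines the derivative of \<open>n\<close>: in the three cases one of \<open>n\<close>,
  \<open>p n p\<^sup>-\<^sup>1\<close>, \<open>q n q\<^sup>-\<^sup>1\<close> is locally constant. This integrates to an explicit algebraic relation between \<open>p\<close> and \<open>q\<close>.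
\<close>

section \<open>Quaternions\<close>

text \<open>Isotropy of \<open>a + i b\<close> means that on \<open>D\<^sub>1\<close> the component
  \<alpha> is \<beta> rotated about \<open>n\<close> by 60 degrees. This rotation is conjugation by
  the unit quaternion \<open>(sqrt 3 + n) / 2\<close>, the exponential of
  \<open>(\<pi>/6) n\<close>; hence the constant \<open>(sqrt 3 + i) / 2\<close> in the three
  immersions.

  The frames of the tangent spaces are chosen point by point, with no regularity; only
  \<open>n\<close> is known to be differentiable, being computed from a smooth section of
  \<open>D\<^sub>1\<close>. So tangency is encoded by two identities that mention no other frame
  vector: the rotation relation up to its \<open>n\<close>-component, and the proportionality of the
  \<open>n\<close>-components of the two Maurer-Cartan forms. Antisymmetrizing their derivatives
  replaces second derivatives by cross products and leaves linear equations at a single point.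

  The derivative of \<open>n\<close> orthogonally to \<open>D\<^sub>1\<close> comes from elsewhere:
  the equation \<open>x y (y - x) = 0\<close> leaves three lines, so by continuity the line
  \<open>(x, y)\<close> is locally constant, and differentiating this constancy supplies the missing
  component.\<close>

lemma vector_4 [simp]:
  "(vector [x,y,z,w] :: 'a::zero^4)$1 = x"
  "(vector [x,y,z,w] :: 'a::zero^4)$2 = y"
  "(vector [x,y,z,w] :: 'a::zero^4)$3 = z"
  "(vector [x,y,z,w] :: 'a::zero^4)$4 = w"
  unfolding vector_def by simp_all

definition qone :: quat where "qone = vector [1, 0, 0, 0]"

definition qv :: "real^3 \<Rightarrow> quat" where "qv a = vector [0, a$1, a$2, a$3]"

definition qim :: "quat \<Rightarrow> real^3" where "qim x = vector [x$2, x$3, x$4]"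

lemmas quat_simps = qmult_def qcnj_def qone_def qv_def qim_def vec_eq_iff forall_4 forall_3

lemma qmult_assoc: "x \<odot> y \<odot> z = x \<odot> (y \<odot> z)"
  by (simp add: quat_simps algebra_simps)

lemma qmult_one [simp]: "qone \<odot> x = x" "x \<odot> qone = x"
  by (simp_all add: quat_simps)

lemma qcnj_qone [simp]: "qcnj qone = qone"
  by (simp add: quat_simps)

lemma qcnj_qmult: "qcnj (x \<odot> y) = qcnj y \<odot> qcnj x"
  by (simp add: quat_simps algebra_simps)

lemma qcnj_qcnj [simp]: "qcnj (qcnj x) = x"
  by (simp add: quat_simps)

lemma qmult_qcnj: "x \<odot> qcnj x = (norm x)\<^sup>2 *\<^sub>R qone" "qcnj x \<odot> x = (norm x)\<^sup>2 *\<^sub>R qone"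
  unfolding power2_norm_eq_inner by (simp_all add: quat_simps inner_vec_def sum_4)

lemma norm_qcnj [simp]: "norm (qcnj x) = norm x"
  by (simp add: norm_eq_sqrt_inner qcnj_def inner_vec_def sum_4)

lemma norm_qmult: "norm (x \<odot> y) = norm x * norm y"
proof -
  have "(norm (x \<odot> y))\<^sup>2 = (norm x * norm y)\<^sup>2"
    unfolding power_mult_distrib power2_norm_eq_inner
    by (simp add: quat_simps inner_vec_def sum_4 algebra_simps)
  then show ?thesis by simp
qed

lemma bounded_bilinear_qmult: "bounded_bilinear (\<odot>)"
proof
  show "\<exists>K. \<forall>a b. norm (a \<odot> b) \<le> norm a * norm b * K"
    by (rule exI[of _ 1]) (simp add: norm_qmult)
qed (simp_all add: quat_simps algebra_simps)

lemma bounded_linear_qcnj: "bounded_linear qcnj"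
proof (rule linear_conv_bounded_linear[THEN iffD1])
  show "linear qcnj" by (rule linearI) (simp_all add: quat_simps)
qed

lemma bounded_linear_qv: "bounded_linear qv"
proof (rule linear_conv_bounded_linear[THEN iffD1])
  show "linear qv" by (rule linearI) (simp_all add: quat_simps)
qed

lemma bounded_linear_qim: "bounded_linear qim"
proof (rule linear_conv_bounded_linear[THEN iffD1])
  show "linear qim" by (rule linearI) (simp_all add: quat_simps)
qed

interpretation qmult: bounded_bilinear "(\<odot>)" by (rule bounded_bilinear_qmult)
lemmas qcnj_linear = bounded_linear.linear[OF bounded_linear_qcnj]
lemmas qcnj_simps [simp] = linear_add[OF qcnj_linear] linear_diff[OF qcnj_linear] linear_scale[OF qcnj_linear]
  linear_0[OF qcnj_linear] linear_neg[OF qcnj_linear]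
lemmas qv_linear = bounded_linear.linear[OF bounded_linear_qv]
lemmas qv_simps [simp] = linear_add[OF qv_linear] linear_diff[OF qv_linear] linear_scale[OF qv_linear]
  linear_0[OF qv_linear] linear_neg[OF qv_linear]
lemmas qim_linear = bounded_linear.linear[OF bounded_linear_qim]
lemmas qim_simps [simp] = linear_add[OF qim_linear] linear_diff[OF qim_linear] linear_scale[OF qim_linear]
  linear_0[OF qim_linear] linear_neg[OF qim_linear]

lemma bounded_bilinear_cross3: "bounded_bilinear cross3"
  using bilinear_conv_bounded_bilinear bilinear_cross by blast

interpretation cross3: bounded_bilinear cross3 by (rule bounded_bilinear_cross3)

lemma qim_qv [simp]: "qim (qv a) = a"
  by (simp add: quat_simps)

lemma qv_in_ImH [simp]: "qv a \<in> ImH"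
  by (simp add: ImH_def qv_def)

lemma qv_qim: "x \<in> ImH \<Longrightarrow> qv (qim x) = x"
  by (simp add: ImH_def quat_simps)

lemma qv_inj [simp]: "qv a = qv b \<longleftrightarrow> a = b"
  by (metis qim_qv)

lemma qcnj_qv [simp]: "qcnj (qv a) = - qv a"
  by (simp add: quat_simps)

lemma qmult_qv: "qv a \<odot> qv b = qv (cross3 a b) - (a \<bullet> b) *\<^sub>R qone"
  by (simp add: quat_simps cross3_def inner_vec_def sum_3)

lemma qim_commutator: "qim (x \<odot> y - y \<odot> x) = 2 *\<^sub>R cross3 (qim x) (qim y)"
  by (simp add: quat_simps cross3_def algebra_simps)

lemma inner_qv [simp]: "qv a \<bullet> qv b = a \<bullet> b"
  by (simp add: qv_def inner_vec_def sum_3 sum_4)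

lemma norm_qv [simp]: "norm (qv a) = norm a"
  by (simp add: norm_eq_sqrt_inner)

lemma S3_iff: "x \<in> S3 \<longleftrightarrow> norm x = 1"
  by (simp add: S3_def)

lemma S3_cnj: "p \<in> S3 \<Longrightarrow> p \<odot> qcnj p = qone" "p \<in> S3 \<Longrightarrow> qcnj p \<odot> p = qone"
  by (simp_all add: qmult_qcnj S3_iff)

lemma S3_cnj_assoc: "p \<in> S3 \<Longrightarrow> p \<odot> (qcnj p \<odot> x) = x" "p \<in> S3 \<Longrightarrow> qcnj p \<odot> (p \<odot> x) = x"
  by (simp_all add: S3_cnj flip: qmult_assoc)

lemma S3_qmult [intro]: "p \<in> S3 \<Longrightarrow> q \<in> S3 \<Longrightarrow> p \<odot> q \<in> S3"
  by (simp add: S3_iff norm_qmult)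

lemma S3_qcnj [intro]: "p \<in> S3 \<Longrightarrow> qcnj p \<in> S3"
  by (simp add: S3_iff)

lemma qinv_S3: "p \<in> S3 \<Longrightarrow> qinv p = qcnj p"
  by (simp add: qinv_def S3_iff)

lemma inner_qmult_left: "(p \<odot> x) \<bullet> (p \<odot> y) = (norm p)\<^sup>2 * (x \<bullet> y)"
  unfolding power2_norm_eq_inner by (simp add: qmult_def inner_vec_def sum_4 algebra_simps)

lemma inner_qone: "qone \<bullet> x = x$1"
  by (simp add: qone_def inner_vec_def sum_4)

text \<open>Away from \<open>n = -i\<close>, the quaternion \<open>1 - n i\<close> intertwines
  \<open>i\<close> and \<open>n\<close>: \<open>(1 - n i) i = i + n = n (1 - n i)\<close>.\<close>

lemma unit_imag_conj:
  assumes "norm n = 1"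
  obtains c where "c \<in> S3" "qv n = c \<odot> qv (vector [1,0,0]) \<odot> qcnj c"
proof -
  have n: "n$1 * n$1 + n$2 * n$2 + n$3 * n$3 = 1"
    using assms by (simp add: norm_eq_1 inner_vec_def sum_3)
  show ?thesis
  proof (cases "n$1 = -1")
    case True
    then have z: "n$2 = 0" "n$3 = 0" using n by (simp_all add: sum_squares_eq_zero_iff)
    \<comment> \<open>At \<open>n = -i\<close> the quaternion \<open>1 - n i\<close> vanishes;
      \<open>j\<close> takes its place.\<close>
    show ?thesis
    proof (rule that[of "vector [0,0,1,0]"])
      show "(vector [0,0,1,0] :: quat) \<in> S3"
        by (simp add: S3_iff norm_eq_1 inner_vec_def sum_4)
    qed (use True z in \<open>simp add: quat_simps\<close>)
  next
    case False
    have "n$1 * n$1 \<le> 1" using n by (smt (verit) zero_le_square)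
    then have "n$1 \<ge> -1" by (smt (verit) mult_less_cancel_left2 mult_minus_left mult_minus_right)
    with False have pos: "1 + n$1 > 0" by simp
    define r where "r = sqrt (2 * (1 + n$1))"
    have r: "r * r = 2 * (1 + n$1)" "r > 0" using pos by (auto simp: r_def)
    \<comment> \<open>\<open>1 - n i\<close> in components, divided by its norm
      \<open>r\<close>.\<close>
    define c :: quat where "c = (1/r) *\<^sub>R vector [1 + n$1, 0, - n$3, n$2]"
    have cc: "(1/r) *\<^sub>R (x::quat) = y \<longleftrightarrow> x = r *\<^sub>R y" for x y
      using r(2) by auto
    have nsq: "n$2 * n$2 + n$3 * n$3 = (1 - n$1) * (1 + n$1)" using n by (simp add: algebra_simps)
    have "c \<bullet> c = (1/(r*r)) * ((1 + n$1)*(1 + n$1) + (n$2 * n$2 + n$3 * n$3))"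
      by (simp add: c_def inner_vec_def sum_4 algebra_simps add_divide_distrib)
    also have "\<dots> = (1/(r*r)) * (2 * (1 + n$1))"
      unfolding nsq by (simp add: algebra_simps)
    also have "\<dots> = 1" unfolding r(1) using pos by simp
    finally have cS: "c \<in> S3" by (simp add: S3_iff norm_eq_1)
    have "c \<odot> qv (vector [1,0,0]) \<odot> qcnj c = (1/(r*r)) *\<^sub>R vector [0, (1 + n$1)*(1 + n$1) - (n$2 * n$2 + n$3 * n$3),
        2 * (1 + n$1) * n$2, 2 * (1 + n$1) * n$3]"
      using r(2) by (simp add: c_def quat_simps algebra_simps add_divide_distrib diff_divide_distrib)
    also have "\<dots> = (1/(r*r)) *\<^sub>R ((2 * (1 + n$1)) *\<^sub>R qv n)"
      unfolding nsq by (simp add: quat_simps algebra_simps add_divide_distrib)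
    also have "\<dots> = qv n" unfolding r(1) using pos by simp
    finally show ?thesis using that cS by metis
  qed
qed

section \<open>Left-invariant frames and the tensor G\<close>

type_synonym tang = "(real^3) \<times> (real^3)"

text \<open>The left-invariant vector field with value \<open>u\<close> at the identity, extended
  linearly to all pairs of quaternions so that it is its own derivative.\<close>

definition linv :: "tang \<Rightarrow> quat \<times> quat \<Rightarrow> quat \<times> quat" where
  "linv u x = (fst x \<odot> qv (fst u), snd x \<odot> qv (snd u))"

definition linv_J :: "tang \<Rightarrow> tang" where
  "linv_J u = (1 / sqrt 3) *\<^sub>R (2 *\<^sub>R snd u - fst u, snd u - 2 *\<^sub>R fst u)"

definition linv_g :: "tang \<Rightarrow> tang \<Rightarrow> real" where
  "linv_g u v = (2/3) * (2 * (fst u \<bullet> fst v) + 2 * (snd u \<bullet> snd v) - fst u \<bullet> snd v - snd u \<bullet> fst v)"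

definition linv_bracket :: "tang \<Rightarrow> tang \<Rightarrow> tang" where
  "linv_bracket u v = 2 *\<^sub>R (cross3 (fst u) (fst v), cross3 (snd u) (snd v))"

text \<open>In the coordinate \<open>\<zeta> = \<alpha> + \<omega> \<beta>\<close> with
  \<open>\<omega> = -1/2 - (sqrt 3 / 2) i\<close>, this is \<open>-(2/3) i\<close> times the
  conjugate of the complex cross product.\<close>

definition linv_G :: "tang \<Rightarrow> tang \<Rightarrow> tang" where
  "linv_G u v = (2 / (3 * sqrt 3)) *\<^sub>R
     (cross3 (snd u) (fst v) + cross3 (fst u) (snd v) + cross3 (fst u) (fst v) - 2 *\<^sub>R cross3 (snd u) (snd v),
      2 *\<^sub>R cross3 (fst u) (fst v) - cross3 (fst u) (snd v) - cross3 (snd u) (fst v) - cross3 (snd u) (snd v))"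

lemma linear_linv_J: "linear linv_J"
  by (rule linearI) (simp_all add: linv_J_def algebra_simps)

lemma linv_J_J [simp]: "linv_J (linv_J u) = - u"
  by (simp add: linv_J_def prod_eq_iff vec_eq_iff algebra_simps)

lemma linv_linear: "linear (\<lambda>u. linv u x)"
  by (rule linearI) (simp_all add: linv_def qmult.add_right qmult.scaleR_right)

lemmas linv_simps = linear_add[OF linv_linear] linear_diff[OF linv_linear] linear_scale[OF linv_linear]
  linear_0[OF linv_linear] linear_neg[OF linv_linear]

lemmas linv_J_simps = linear_add[OF linear_linv_J] linear_diff[OF linear_linv_J] linear_scale[OF linear_linv_J]
  linear_0[OF linear_linv_J] linear_neg[OF linear_linv_J]

lemma bounded_linear_linv: "bounded_linear (linv u)"
  unfolding linv_def
  by (intro bounded_linear_Pair bounded_linear_compose[OF qmult.bounded_linear_left] bounded_linear_fst bounded_linear_snd)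

lemma S3S3_iff: "x \<in> S3S3 \<longleftrightarrow> fst x \<in> S3 \<and> snd x \<in> S3"
  by (cases x) (auto simp: S3S3_def)

lemma linv_eq_iff: "x \<in> S3S3 \<Longrightarrow> linv u x = linv v x \<longleftrightarrow> u = v"
  by (metis S3S3_iff S3_cnj_assoc(2) fst_conv linv_def prod_eqI qv_inj snd_conv)

lemma inner_linv: "x \<in> S3S3 \<Longrightarrow> linv u x \<bullet> linv v x = u \<bullet> v"
  by (simp add: S3S3_iff linv_def inner_prod_def inner_qmult_left S3_iff)

lemma tangent_S3S3_iff: "Z \<in> tangent_S3S3 x \<longleftrightarrow> (\<exists>u. Z = linv u x)"
proof
  assume "Z \<in> tangent_S3S3 x"
  then obtain a b where ab: "a \<in> ImH" "b \<in> ImH" "Z = (fst x \<odot> a, snd x \<odot> b)"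
    by (auto simp: tangent_S3S3_def)
  then have "Z = linv (qim a, qim b) x" by (simp add: linv_def qv_qim)
  then show "\<exists>u. Z = linv u x" by blast
qed (use qv_in_ImH in \<open>fastforce simp: tangent_S3S3_def linv_def\<close>)

lemma Jst_linv: "x \<in> S3S3 \<Longrightarrow> Jst x (linv u x) = linv (linv_J u) x"
  by (simp add: Jst_def linv_def linv_J_def S3S3_iff qinv_S3 S3_cnj_assoc qmult.scaleR_right Let_def)

lemma Pst_linv: "x \<in> S3S3 \<Longrightarrow> Pst x (linv u x) = linv (prod.swap u) x"
  by (simp add: Pst_def linv_def S3S3_iff qinv_S3 S3_cnj_assoc)

lemma linv_g_alt: "linv_g u v = (u \<bullet> v + linv_J u \<bullet> linv_J v) / 2"
  by (simp add: linv_g_def linv_J_def inner_prod_def algebra_simps inner_commute divide_simps)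

lemma gNK_linv: "x \<in> S3S3 \<Longrightarrow> gNK x (linv u x) (linv v x) = linv_g u v"
  by (simp add: gNK_def Jst_linv inner_linv linv_g_alt)

lemma linv_g_sym: "linv_g u v = linv_g v u"
  by (simp add: linv_g_def inner_commute)

lemma linv_g_simps:
  "linv_g (u + u') v = linv_g u v + linv_g u' v"
  "linv_g (u - u') v = linv_g u v - linv_g u' v"
  "linv_g (c *\<^sub>R u) v = c * linv_g u v"
  "linv_g v (u + u') = linv_g v u + linv_g v u'"
  "linv_g v (u - u') = linv_g v u - linv_g v u'"
  "linv_g v (c *\<^sub>R u) = c * linv_g v u"
  by (simp_all add: linv_g_def algebra_simps)

lemma linv_g_eq_0: "linv_g u u = 0 \<longleftrightarrow> u = 0"
  unfolding linv_g_alt by (auto simp add: linv_J_simps add_nonneg_eq_0_iff)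

lemma linv_g_J: "linv_g (linv_J u) v = - linv_g u (linv_J v)"
  unfolding linv_g_alt by (simp add: field_simps)

lemma linv_g_JJ: "linv_g (linv_J u) (linv_J v) = linv_g u v"
  unfolding linv_g_alt by simp

lemma linv_g_J_self: "linv_g u (linv_J u) = 0"
  using linv_g_J[of u u] linv_g_sym[of u "linv_J u"] by simp

lemma linv_g_nondeg: "(\<And>w. linv_g r w = linv_g s w) \<Longrightarrow> r = s"
  using linv_g_eq_0[of "r - s"] by (simp add: linv_g_simps)

section \<open>Smoothness, derivatives and brackets of left-invariant fields\<close>

lemma Ck_on_const: "Ck_on k U (\<lambda>x. c)"
proof (induction k arbitrary: c)
  case (Suc k)
  have "frechet_derivative (\<lambda>x. c) (at x) v = 0" for x v :: 'a
    by simp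
  then show ?case using Suc by simp
qed simp

lemma Ck_on_bounded_linear:
  assumes "bounded_linear f"
  shows "Ck_on k U f"
proof (cases k)
  case (Suc j)
  have *: "(f has_derivative f) (at x)" for x
    using assms by (rule bounded_linear_imp_has_derivative)
  have "frechet_derivative f (at x) = f" for x
    using frechet_derivative_at[OF *] by simp
  moreover have "f differentiable (at x)" for x
    using * by (rule differentiableI)
  ultimately show ?thesis using Suc by (simp add: Ck_on_const)
qed (simp add: linear_continuous_on assms)

lemma vector_field_linv:
  assumes "\<And>x. x \<in> S3S3 \<Longrightarrow> X x = linv u x"
  shows "vector_field X"
  unfolding vector_field_def
proof
  show "smooth_on S3S3 X"
    unfolding smooth_on_def
    using assms Ck_on_bounded_linear[OF bounded_linear_linv] by (metis IntD2 UNIV_I open_UNIV)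
  show "\<forall>x\<in>S3S3. X x \<in> tangent_S3S3 x"
    using assms tangent_S3S3_iff by blast
qed

text \<open>The normalized line \<open>1 + t a\<close>: an algebraic substitute for the exponential,
  with the same velocity at 0.\<close>

definition qcurve :: "real^3 \<Rightarrow> real \<Rightarrow> quat" where
  "qcurve a t = (1 / sqrt (1 + t\<^sup>2 * (a \<bullet> a))) *\<^sub>R (qone + t *\<^sub>R qv a)"

lemma qcurve_S3: "qcurve a t \<in> S3"
proof -
  have "(qone + t *\<^sub>R qv a) \<bullet> (qone + t *\<^sub>R qv a) = 1 + t\<^sup>2 * (a \<bullet> a)"
    by (simp add: qone_def qv_def inner_vec_def sum_4 sum_3 power2_eq_square algebra_simps)
  moreover have "1 + t\<^sup>2 * (a \<bullet> a) > 0"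
    by (smt (verit) inner_ge_zero zero_le_power2 mult_nonneg_nonneg)
  ultimately show ?thesis
    by (simp add: S3_iff qcurve_def norm_eq_sqrt_inner)
qed

lemma qcurve_deriv: "(qcurve a has_vector_derivative qv a) (at 0)"
proof -
  have 1: "((\<lambda>t. 1 / sqrt (1 + t\<^sup>2 * (a \<bullet> a))) has_real_derivative 0) (at 0)"
    by (auto intro!: derivative_eq_intros)
  have 2: "((\<lambda>t. qone + t *\<^sub>R qv a) has_vector_derivative qv a) (at 0)"
    by (auto intro!: derivative_eq_intros)
  show ?thesis
    using has_vector_derivative_scaleR[OF 1 2] by (simp add: qcurve_def[abs_def])
qed

text \<open>A derivative within \<open>S3S3\<close> need not be unique as a linear map. Composed
  with a curve that stays in \<open>S3S3\<close> it becomes a derivative on the real line, which is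
  unique, so all candidates agree on the velocity of the curve.\<close>

lemma dir_deriv_eq:
  assumes f: "(f has_derivative f') (at x within S3S3)" and x: "x \<in> S3S3"
  shows "dir_deriv f x (linv u x) = f' (linv u x)"
proof -
  define \<gamma> where "\<gamma> t = (fst x \<odot> qcurve (fst u) t, snd x \<odot> qcurve (snd u) t)" for t
  have \<gamma>0: "\<gamma> 0 = x" by (simp add: \<gamma>_def qcurve_def)
  have \<gamma>S: "range \<gamma> \<subseteq> S3S3" using x by (auto simp: \<gamma>_def S3S3_iff qcurve_S3 S3_qmult)
  have "(\<gamma> has_vector_derivative linv u x) (at 0)"
    unfolding \<gamma>_def linv_def
    by (intro has_vector_derivative_Pair bounded_linear.has_vector_derivative[OF qmult.bounded_linear_right] qcurve_deriv)
  then have \<gamma>d: "(\<gamma> has_derivative (\<lambda>t. t *\<^sub>R linv u x)) (at 0)"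
    by (simp add: has_vector_derivative_def)
  have *: "(f \<circ> \<gamma> has_derivative D \<circ> (\<lambda>t. t *\<^sub>R linv u x)) (at 0)"
    if "(f has_derivative D) (at x within S3S3)" for D
    by (rule diff_chain_within[of \<gamma> _ 0 UNIV, OF \<gamma>d]) (use that \<gamma>0 \<gamma>S has_derivative_subset in metis)
  have "(f has_derivative frechet_derivative f (at x within S3S3)) (at x within S3S3)"
    using f by (meson differentiableI frechet_derivative_works)
  from fun_cong[OF has_derivative_unique[OF *[OF this] *[OF f]], of 1]
  show ?thesis by (simp add: dir_deriv_def)
qed

lemma dir_deriv_linv:
  assumes Y: "\<And>x. x \<in> S3S3 \<Longrightarrow> Y x = linv v x" and x: "x \<in> S3S3"
  shows "dir_deriv Y x (linv u x) = linv v (linv u x)"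
proof (rule dir_deriv_eq[OF _ x])
  show "(Y has_derivative linv v) (at x within S3S3)"
    by (rule has_derivative_transform[OF x _ bounded_linear_imp_has_derivative[OF bounded_linear_linv]])
      (simp add: Y)
qed

lemma qv_commutator: "qv a \<odot> qv b - qv b \<odot> qv a = qv (2 *\<^sub>R cross3 a b)"
  by (simp add: quat_simps cross3_def algebra_simps)

lemma linv_commutator: "linv v (linv u x) - linv u (linv v x) = linv (linv_bracket u v) x"
  unfolding linv_def linv_bracket_def
  by (simp only: qmult_assoc fst_conv snd_conv diff_Pair scaleR_Pair qv_commutator flip: qmult.diff_right)

text \<open>All products \<open>gNK\<close> of left-invariant fields are constant, so the derivative
  terms of Koszul's formula drop out and the brackets remain. Left invariance is required on
  \<open>S3S3\<close> alone, so that the lemma applies to the field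
  \<open>Jst y (linv v y)\<close>.\<close>

lemma koszul:
  assumes lc: "levi_civita cov" and x: "x \<in> S3S3"
    and X: "\<And>x. x \<in> S3S3 \<Longrightarrow> X x = linv u x"
    and Y: "\<And>x. x \<in> S3S3 \<Longrightarrow> Y x = linv v x"
  shows "\<exists>r. cov X Y x = linv r x \<and>
    (\<forall>w. 2 * linv_g r w = linv_g (linv_bracket u v) w - linv_g (linv_bracket v w) u - linv_g (linv_bracket u w) v)"
proof -
  have tangent: "\<exists>r. cov X Y x = linv r x"
    if "\<And>x. x \<in> S3S3 \<Longrightarrow> X x = linv u x" "\<And>x. x \<in> S3S3 \<Longrightarrow> Y x = linv v x" for X Y u v
  proof -
    have "vector_field (cov X Y)"
      using lc vector_field_linv[of X u] vector_field_linv[of Y v] that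
      by (simp add: levi_civita_def affine_connection_def)
    then show ?thesis using x by (auto simp: vector_field_def tangent_S3S3_iff)
  qed
  have torsion: "r - s = linv_bracket u v"
    if "\<And>x. x \<in> S3S3 \<Longrightarrow> X x = linv u x" "\<And>x. x \<in> S3S3 \<Longrightarrow> Y x = linv v x"
      "cov X Y x = linv r x" "cov Y X x = linv s x" for X Y u v r s
  proof -
    have "cov X Y x - cov Y X x = dir_deriv Y x (X x) - dir_deriv X x (Y x)"
      using lc x vector_field_linv[of X u] vector_field_linv[of Y v] that(1,2)
      unfolding levi_civita_def torsion_free_def by blast
    also have "\<dots> = linv (linv_bracket u v) x"
      using dir_deriv_linv[OF that(1) x] dir_deriv_linv[OF that(2) x] that(1,2)[OF x] linv_commutator by simp
    finally show ?thesis using that(3,4) x by (metis linv_eq_iff linv_simps(2))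
  qed
  have metric: "linv_g r w + linv_g v s = 0"
    if "\<And>x. x \<in> S3S3 \<Longrightarrow> X x = linv u x" "\<And>x. x \<in> S3S3 \<Longrightarrow> Y x = linv v x" "\<And>x. x \<in> S3S3 \<Longrightarrow> W x = linv w x"
      "cov X Y x = linv r x" "cov X W x = linv s x" for X Y W u v w r s
  proof -
    have "dir_deriv (\<lambda>y. gNK y (Y y) (W y)) x (X x) = gNK x (cov X Y x) (W x) + gNK x (Y x) (cov X W x)"
      using lc x vector_field_linv[of X u] vector_field_linv[of Y v] vector_field_linv[of W w] that(1-3)
      unfolding levi_civita_def metric_compatible_def by blast
    also have "\<dots> = linv_g r w + linv_g v s"
      using that x by (simp add: gNK_linv)
    finally have 1: "dir_deriv (\<lambda>y. gNK y (Y y) (W y)) x (X x) = linv_g r w + linv_g v s" .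
    have "((\<lambda>y. gNK y (Y y) (W y)) has_derivative (\<lambda>_. 0)) (at x within S3S3)"
      by (rule has_derivative_transform[OF x _ has_derivative_const[of "linv_g v w"]])
        (simp add: that gNK_linv)
    from dir_deriv_eq[OF this x, of u] show ?thesis using 1 that(1)[OF x] by simp
  qed
  obtain r where r: "cov X Y x = linv r x" using tangent[OF X Y] by blast
  obtain r' where r': "cov Y X x = linv r' x" using tangent[OF Y X] by blast
  have "2 * linv_g r w = linv_g (linv_bracket u v) w - linv_g (linv_bracket v w) u - linv_g (linv_bracket u w) v" for w
  proof -
    obtain s where s: "cov X (linv w) x = linv s x" using tangent[OF X, of "linv w" w] by blast
    obtain s' where s': "cov (linv w) X x = linv s' x" using tangent[OF _ X, of "linv w" w] by blast
    obtain t where t: "cov Y (linv w) x = linv t x" using tangent[OF Y, of "linv w" w] by blast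
    obtain t' where t': "cov (linv w) Y x = linv t' x" using tangent[OF _ Y, of "linv w" w] by blast
    have "r - r' = linv_bracket u v" by (rule torsion[OF X Y r r'])
    moreover have "s - s' = linv_bracket u w" by (rule torsion[OF X _ s s']) simp_all
    moreover have "t - t' = linv_bracket v w" by (rule torsion[OF Y _ t t']) simp_all
    ultimately have "linv_g r w - linv_g r' w = linv_g (linv_bracket u v) w"
      "linv_g s v - linv_g s' v = linv_g (linv_bracket u w) v"
      "linv_g t u - linv_g t' u = linv_g (linv_bracket v w) u"
      by (simp_all flip: linv_g_simps)
    moreover have "linv_g r w + linv_g v s = 0" by (rule metric[OF X Y _ r s]) simp_all
    moreover have "linv_g r' w + linv_g u t = 0" by (rule metric[OF Y X _ r' t]) simp_all
    moreover have "linv_g s' v + linv_g u t' = 0" by (rule metric[OF _ X Y s' t']) simp_all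
    ultimately show ?thesis
      using linv_g_sym[of v s] linv_g_sym[of u t] linv_g_sym[of u t'] by linarith
  qed
  with r show ?thesis by blast
qed

text \<open>Both terms of \<open>G\<close> are given by Koszul's formula. Since \<open>J\<close> is
  skew for \<open>g\<close> and \<open>g\<close> is nondegenerate, the claim becomes an identity
  between scalar triple products.\<close>

lemma Gtensor_linv:
  assumes lc: "levi_civita cov" and x: "x \<in> S3S3"
  shows "Gtensor cov (linv u) (linv v) x = linv (linv_G u v) x"
proof -
  obtain r where r: "cov (linv u) (\<lambda>y. Jst y (linv v y)) x = linv r x"
    "\<And>w. 2 * linv_g r w = linv_g (linv_bracket u (linv_J v)) w - linv_g (linv_bracket (linv_J v) w) u - linv_g (linv_bracket u w) (linv_J v)"
    using koszul[OF lc x, of "linv u" u "\<lambda>y. Jst y (linv v y)" "linv_J v"] Jst_linv by auto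
  obtain s where s: "cov (linv u) (linv v) x = linv s x"
    "\<And>w. 2 * linv_g s w = linv_g (linv_bracket u v) w - linv_g (linv_bracket v w) u - linv_g (linv_bracket u w) v"
    using koszul[OF lc x, of "linv u" u "linv v" v] by auto
  have "r - linv_J s = linv_G u v"
  proof (rule linv_g_nondeg)
    fix w
    obtain a b c d e f :: "real^3" where uvw: "u = (a, b)" "v = (c, d)" "w = (e, f)" by (metis surj_pair)
    \<comment> \<open>Every triple product is brought to the form (entry of \<open>u\<close>)
      \<times> (entry of \<open>v\<close>) dotted with an entry of \<open>w\<close>, which makes the
      two sides comparable.\<close>
    have T: "cross3 y z \<bullet> x = cross3 x y \<bullet> z" "cross3 x z \<bullet> y = - (cross3 x y \<bullet> z)" for x y z :: "real^3"
      by (simp_all add: cross3_def inner_vec_def sum_3 algebra_simps)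
    note T' = T(1)[of c e a] T(2)[of a e c] T(1)[of c f a] T(2)[of a f c] T(1)[of d e a] T(2)[of a e d] T(1)[of d f a] T(2)[of a f d]
      T(1)[of c e b] T(2)[of b e c] T(1)[of c f b] T(2)[of b f c] T(1)[of d e b] T(2)[of b e d] T(1)[of d f b] T(2)[of b f d]
    \<comment> \<open>Each term contains \<open>J\<close> exactly once, so \<open>1 / sqrt 3\<close>
      occurs linearly and can be treated as an atom.\<close>
    define k where "k = 1 / sqrt 3"
    have k: "2 / (3 * sqrt 3) = 2 / 3 * k" by (simp add: k_def)
    have "2 * linv_g (r - linv_J s) w = 2 * linv_g r w + 2 * linv_g s (linv_J w)"
      by (simp add: linv_g_simps linv_g_J)
    also have "\<dots> = 2 * linv_g (linv_G u v) w"
      unfolding r s unfolding uvw linv_g_def linv_bracket_def linv_J_def linv_G_def k k_def[symmetric]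
      by (simp add: cross3.add_right cross3.diff_right cross3.scaleR_right cross3.add_left cross3.diff_left cross3.scaleR_left
        inner_add_left inner_diff_left inner_add_right inner_diff_right T') (simp add: field_simps)
    finally show "linv_g (r - linv_J s) w = linv_g (linv_G u v) w" by simp
  qed
  then show ?thesis
    unfolding Gtensor_def r s Jst_linv[OF x] by (metis linv_simps(2))
qed

section \<open>Pointwise consequences of PD1 = D3\<close>

lemma orth_basis_expand:
  fixes n a b :: "real^3"
  assumes "norm n = 1" "norm a = 1" "a \<bullet> n = 0" "b = cross3 n a"
  shows "x = (x \<bullet> a) *\<^sub>R a + (x \<bullet> b) *\<^sub>R b + (x \<bullet> n) *\<^sub>R n"
proof -
  have nn: "n \<bullet> n = 1" "a \<bullet> a = 1" using assms by (simp_all add: norm_eq_1)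
  have b1: "cross3 b n = a" "cross3 a b = n" "b \<bullet> n = 0" "b \<bullet> a = 0" "b \<bullet> b = 1"
    using nn assms(3) unfolding assms(4)
    by (simp_all add: Lagrange cross_skew[of "cross3 n a"] inner_commute dot_cross_self dot_cross)
  define y where "y = x - ((x \<bullet> a) *\<^sub>R a + (x \<bullet> b) *\<^sub>R b + (x \<bullet> n) *\<^sub>R n)"
  have y: "y \<bullet> a = 0" "y \<bullet> b = 0" "y \<bullet> n = 0"
    using nn assms(3) b1 by (simp_all add: y_def inner_diff_left inner_add_left inner_commute[of n a] inner_commute[of a b] inner_commute[of n b])
  have "cross3 y n = (y \<bullet> b) *\<^sub>R a - (y \<bullet> a) *\<^sub>R b"
    using Lagrange[of y a b] b1(2) by (simp add: inner_commute)
  then have "cross3 n y = 0" using y cross_skew[of n y] by simp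
  then have "y = 0" using cross_dot_cancel[of n y 0] y(3) nn(1) by (cases "n = 0") (auto simp: inner_commute)
  then show ?thesis unfolding y_def by simp
qed

text \<open>Put \<open>Z = a + i b\<close>, \<open>W = c + i d\<close>,
  \<open>\<lambda> = k + i l\<close>. The hypotheses say that \<open>Z\<close> and \<open>W\<close>
  are Hermitian orthogonal and that \<open>Z \<times> W = \<lambda> Z\<close>. Dotting the latter
  with \<open>Z\<close> and with \<open>W\<close> gives \<open>\<lambda> (Z \<bullet> Z) = 0\<close>
  and \<open>\<lambda> (W \<bullet> Z) = 0\<close> for the bilinear product. With
  \<open>\<lambda> \<noteq> 0\<close>, \<open>Z\<close> is isotropic, and \<open>W\<close> is
  orthogonal to \<open>Z\<close> and to its conjugate, hence to \<open>a\<close> and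
  \<open>b\<close>.\<close>

lemma isotropic_from_cross:
  fixes a b c d :: "real^3"
  assumes orth: "a \<bullet> c + b \<bullet> d = 0" "a \<bullet> d - b \<bullet> c = 0"
    and z: "a \<noteq> 0 \<or> b \<noteq> 0" and w: "c \<noteq> 0 \<or> d \<noteq> 0"
    and Re: "cross3 a c - cross3 b d = k *\<^sub>R a - l *\<^sub>R b"
    and Im: "cross3 a d + cross3 b c = k *\<^sub>R b + l *\<^sub>R a"
  shows "a \<bullet> a = b \<bullet> b" "a \<bullet> b = 0" "c \<bullet> a = 0" "c \<bullet> b = 0" "d \<bullet> a = 0" "d \<bullet> b = 0"
proof -
  have kl: "k * k + l * l > 0"
  proof (rule ccontr)
    assume "\<not> k * k + l * l > 0"
    then have "k = 0" "l = 0"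
      by (smt (verit) zero_le_square not_sum_squares_lt_zero sum_squares_gt_zero_iff)+
    then have 0: "cross3 a c - cross3 b d = 0" "cross3 a d + cross3 b c = 0" using Re Im by simp_all
    \<comment> \<open>The Lagrange identity for complex vectors: if \<lambda> were 0, then
      \<open>Z\<close> and \<open>W\<close> would be nonzero, orthogonal and parallel.\<close>
    have "(a \<bullet> a + b \<bullet> b) * (c \<bullet> c + d \<bullet> d) = (a \<bullet> c + b \<bullet> d)\<^sup>2 + (a \<bullet> d - b \<bullet> c)\<^sup>2 +
       (cross3 a c - cross3 b d) \<bullet> (cross3 a c - cross3 b d) + (cross3 a d + cross3 b c) \<bullet> (cross3 a d + cross3 b c)"
      by (simp add: inner_diff_left inner_diff_right inner_add_left inner_add_right dot_cross inner_commute
          power2_eq_square algebra_simps)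
    also have "\<dots> = 0" using 0 orth by simp
    finally show False using z w
      by (smt (verit) inner_ge_zero inner_gt_zero_iff mult_pos_pos)
  qed
  \<comment> \<open>Multiplication of \<open>x + i y\<close> by \<lambda> is injective.\<close>
  have rot: "x = 0 \<and> y = 0" if "k * x - l * y = 0" "k * y + l * x = 0" for x y
  proof -
    have "(k * k + l * l) * x = k * (k * x - l * y) + l * (k * y + l * x)"
      "(k * k + l * l) * y = k * (k * y + l * x) - l * (k * x - l * y)" by (simp_all add: algebra_simps)
    then show ?thesis using that kl by auto
  qed
  have T: "u \<bullet> cross3 x y = - (x \<bullet> cross3 u y)" for u x y :: "real^3"
    by (simp add: cross3_def inner_vec_def sum_3 algebra_simps)
  \<comment> \<open>Real and imaginary parts of \<open>Z \<bullet> (Z \<times> W) = 0\<close> and of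
    \<open>W \<bullet> (Z \<times> W) = 0\<close>.\<close>
  have e: "a \<bullet> (cross3 a c - cross3 b d) - b \<bullet> (cross3 a d + cross3 b c) = 0"
    "a \<bullet> (cross3 a d + cross3 b c) + b \<bullet> (cross3 a c - cross3 b d) = 0"
    "c \<bullet> (cross3 a c - cross3 b d) - d \<bullet> (cross3 a d + cross3 b c) = 0"
    "c \<bullet> (cross3 a d + cross3 b c) + d \<bullet> (cross3 a c - cross3 b d) = 0"
    by (simp_all add: inner_diff_right inner_add_right dot_cross_self T[of a b] cross3_def inner_vec_def sum_3 algebra_simps)
  have 1: "a \<bullet> a - b \<bullet> b = 0 \<and> 2 * (a \<bullet> b) = 0"
    using e(1,2) unfolding Re Im
    by (intro rot) (simp_all add: inner_diff_right inner_add_right inner_commute algebra_simps)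
  have 2: "c \<bullet> a - d \<bullet> b = 0 \<and> c \<bullet> b + d \<bullet> a = 0"
    using e(3,4) unfolding Re Im
    by (intro rot) (simp_all add: inner_diff_right inner_add_right inner_commute algebra_simps)
  show "a \<bullet> a = b \<bullet> b" "a \<bullet> b = 0" "c \<bullet> a = 0" "c \<bullet> b = 0" "d \<bullet> a = 0" "d \<bullet> b = 0"
    using 1 2 orth by (simp_all add: inner_commute)
qed

text \<open>\<open>P\<close> and \<open>G\<close> both conjugate \<zeta>, so the hypothesis on
  \<open>linv_G\<close> turns into the eigenvector equation
  \<open>Z \<times> W = \<lambda> Z\<close>. Isotropy of \<open>Z = a + i b\<close> gives
  \<open>cross3 n b = - a\<close>, which is the rotation by 60 degrees, and a \<open>W\<close>
  orthogonal to \<open>a\<close> and \<open>b\<close> has both components along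
  \<open>n\<close>.\<close>

lemma G_parallel_PD_structure:
  assumes v: "v \<noteq> 0" and w: "w \<noteq> 0"
    and orth: "linv_g v w = 0" "linv_g (linv_J v) w = 0"
    and G: "linv_G v w = r *\<^sub>R prod.swap v + s *\<^sub>R prod.swap (linv_J v)"
  defines "n \<equiv> cross3 (snd v) (fst v) /\<^sub>R norm (cross3 (snd v) (fst v))"
  shows "cross3 (snd v) (fst v) \<noteq> 0" "snd v \<noteq> 0" "norm n = 1" "snd v \<bullet> n = 0"
    "fst v = (1/2) *\<^sub>R (snd v + sqrt 3 *\<^sub>R cross3 n (snd v))"
    "\<exists>x y. w = (x *\<^sub>R n, y *\<^sub>R n)"
proof -
  obtain \<alpha> \<beta> where vv: "v = (\<alpha>, \<beta>)" by (cases v)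
  obtain \<gamma> \<delta> where ww: "w = (\<gamma>, \<delta>)" by (cases w)
  define m where "m = (sqrt 3 / 2)"
  have m: "m * m = 3/4" "m > 0" "sqrt 3 = 2 * m" by (simp_all add: m_def)
  have mm: "m * (m * x) = 3/4 * x" for x using m(1) by (simp flip: mult.assoc)
  \<comment> \<open>\<open>a + i b\<close> and \<open>c + i d\<close> are the coordinates \<zeta> of
    \<open>v\<close> and \<open>w\<close>, with \<open>\<omega> = -1/2 - m i\<close>.\<close>
  define a b c d where "a = \<alpha> - (1/2) *\<^sub>R \<beta>" and "b = - m *\<^sub>R \<beta>" and "c = \<gamma> - (1/2) *\<^sub>R \<delta>" and "d = - m *\<^sub>R \<delta>"
  note abcd = a_def b_def c_def d_def
  have o1: "a \<bullet> c + b \<bullet> d = (3/4) * linv_g v w"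
    by (simp add: abcd linv_g_def vv ww inner_diff_left inner_diff_right algebra_simps mm)
  have o2: "a \<bullet> d - b \<bullet> c = (3/4) * linv_g (linv_J v) w"
    using m(2) by (simp add: abcd linv_g_def linv_J_def vv ww m(3) inner_diff_left inner_diff_right field_simps mm)
  have nz: "a \<noteq> 0 \<or> b \<noteq> 0" using v m(2) by (auto simp: abcd vv zero_prod_def)
  have nz': "c \<noteq> 0 \<or> d \<noteq> 0" using w m(2) by (auto simp: abcd ww zero_prod_def)
  define E1 where "E1 = cross3 \<beta> \<gamma> + cross3 \<alpha> \<delta> + cross3 \<alpha> \<gamma> - 2 *\<^sub>R cross3 \<beta> \<delta>"
  define E2 where "E2 = 2 *\<^sub>R cross3 \<alpha> \<gamma> - cross3 \<alpha> \<delta> - cross3 \<beta> \<gamma> - cross3 \<beta> \<delta>"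
  have G1: "(2 / (3 * sqrt 3)) *\<^sub>R E1 = r *\<^sub>R \<beta> + (s / sqrt 3) *\<^sub>R (\<beta> - 2 *\<^sub>R \<alpha>)"
    and G2: "(2 / (3 * sqrt 3)) *\<^sub>R E2 = r *\<^sub>R \<alpha> + (s / sqrt 3) *\<^sub>R (2 *\<^sub>R \<beta> - \<alpha>)"
    using G by (simp_all add: linv_G_def linv_J_def vv ww E1_def E2_def)
  have E1: "E1 = (3 * m * r) *\<^sub>R \<beta> + (3 / 2 * s) *\<^sub>R (\<beta> - 2 *\<^sub>R \<alpha>)"
  proof -
    have "E1 = (3 * m) *\<^sub>R ((2 / (3 * sqrt 3)) *\<^sub>R E1)" using m by simp
    also have "\<dots> = (3 * m * r) *\<^sub>R \<beta> + (3 / 2 * s) *\<^sub>R (\<beta> - 2 *\<^sub>R \<alpha>)"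
      unfolding G1 using m by (simp add: scaleR_add_right)
    finally show ?thesis .
  qed
  have E2: "E2 = (3 * m * r) *\<^sub>R \<alpha> + (3 / 2 * s) *\<^sub>R (2 *\<^sub>R \<beta> - \<alpha>)"
  proof -
    have "E2 = (3 * m) *\<^sub>R ((2 / (3 * sqrt 3)) *\<^sub>R E2)" using m by simp
    also have "\<dots> = (3 * m * r) *\<^sub>R \<alpha> + (3 / 2 * s) *\<^sub>R (2 *\<^sub>R \<beta> - \<alpha>)"
      unfolding G2 using m by (simp add: scaleR_add_right)
    finally show ?thesis .
  qed
  have Re: "cross3 a c - cross3 b d = (1/2) *\<^sub>R E2"
    unfolding E2_def abcd
    by (simp add: cross3.add_right cross3.diff_right cross3.scaleR_right cross3.add_left cross3.diff_left cross3.scaleR_left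
        vec_eq_iff algebra_simps mm)
  have Im: "cross3 a d + cross3 b c = (m/3) *\<^sub>R E2 - (2 * m / 3) *\<^sub>R E1"
    unfolding E1_def E2_def abcd
    by (simp add: cross3.add_right cross3.diff_right cross3.scaleR_right cross3.add_left cross3.diff_left cross3.scaleR_left
        vec_eq_iff field_simps mm)
  \<comment> \<open>\<open>k + i l = (3/2) (m + i/2) (r + i s)\<close>; the unit factor
    \<open>m + i/2\<close>, which is \<open>-i\<close> times the conjugate of \<omega>, collects the
    phases of \<open>G\<close> and \<open>P\<close>.\<close>
  define k l where "k = 3/2 * m * r - 3/4 * s" and "l = 3/2 * m * s + 3/4 * r"
  have Re': "cross3 a c - cross3 b d = k *\<^sub>R a - l *\<^sub>R b"
    unfolding Re E2 unfolding k_def l_def abcd by (simp add: vec_eq_iff field_simps mm)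
  have Im': "cross3 a d + cross3 b c = k *\<^sub>R b + l *\<^sub>R a"
    unfolding Im E1 E2 unfolding k_def l_def abcd by (simp add: vec_eq_iff field_simps mm)
  have iso: "a \<bullet> a = b \<bullet> b" "a \<bullet> b = 0" "c \<bullet> a = 0" "c \<bullet> b = 0" "d \<bullet> a = 0" "d \<bullet> b = 0"
    using isotropic_from_cross[OF _ _ nz nz' Re' Im'] o1 o2 orth by simp_all
  define R where "R = b \<bullet> b"
  have R: "R > 0" using iso(1) nz unfolding R_def by (metis inner_gt_zero_iff)
  have ab: "cross3 \<beta> \<alpha> = (1/m) *\<^sub>R cross3 a b"
    using m by (simp add: abcd cross3.diff_left cross3.scaleR_left cross3.scaleR_right cross_skew[of \<beta> \<alpha>])
  have "(norm (cross3 a b))\<^sup>2 = R\<^sup>2"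
    using norm_cross[of a b] iso(1,2) by (simp add: power2_norm_eq_inner R_def power2_eq_square[of "b \<bullet> b"])
  then have nab: "norm (cross3 a b) = R"
    using R by (simp add: power2_eq_iff_nonneg)
  have n: "n = (1/R) *\<^sub>R cross3 a b"
    using m R by (simp add: n_def vv ab nab)
  have bne: "b \<noteq> 0" using R by (auto simp: R_def)
  have ane: "a \<noteq> 0" using R iso(1) by (auto simp: R_def)
  show "cross3 (snd v) (fst v) \<noteq> 0" using ab nab R m by (auto simp: vv)
  show bn: "snd v \<noteq> 0" using bne by (auto simp: vv abcd)
  show nn: "norm n = 1" using nab R by (simp add: n)
  have \<beta>: "\<beta> = - (1/m) *\<^sub>R b" using m by (simp add: abcd)
  show "snd v \<bullet> n = 0" by (simp add: vv \<beta> n dot_cross_self)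
  have nb: "cross3 n b = - a"
    unfolding n cross3.scaleR_left cross_skew[of "cross3 a b" b] Lagrange using R iso(2) by (simp add: R_def inner_commute)
  show "fst v = (1/2) *\<^sub>R (snd v + sqrt 3 *\<^sub>R cross3 n (snd v))"
    using m by (simp add: vv \<beta> cross3.scaleR_right cross3.minus_right nb) (simp add: abcd vec_eq_iff field_simps)
  define a' where "a' = a /\<^sub>R norm a"
  have an: "a \<bullet> n = 0" by (simp add: n dot_cross_self)
  have a': "norm a' = 1" "a' \<bullet> n = 0" using ane an by (simp_all add: a'_def)
  have nna: "cross3 n a' = (1 / norm a) *\<^sub>R b"
    using iso(1,2) R by (simp add: a'_def n cross3.scaleR_left cross3.scaleR_right cross_skew[of "cross3 a b" a] Lagrange R_def inner_commute divide_inverse)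
  have perp: "x = (x \<bullet> n) *\<^sub>R n" if "x \<bullet> a = 0" "x \<bullet> b = 0" for x
    using orth_basis_expand[OF nn a' refl, of x] that unfolding nna by (simp add: a'_def)
  have "\<gamma> = c - (1 / (2 * m)) *\<^sub>R d" "\<delta> = - (1/m) *\<^sub>R d" using m by (simp_all add: abcd)
  then have "\<gamma> = (\<gamma> \<bullet> n) *\<^sub>R n" "\<delta> = (\<delta> \<bullet> n) *\<^sub>R n"
    by (intro perp; simp add: inner_diff_left iso)+
  then show "\<exists>x y. w = (x *\<^sub>R n, y *\<^sub>R n)" unfolding ww by blast
qed

section \<open>Structure equations in an adapted frame\<close>

text \<open>
  \<open>al\<close> and \<open>be\<close> are the two components of the left-trivialized differential of a parametrization. The parameter
  directions \<open>u\<close>, \<open>v\<close> are sent to an orthogonal basis of \<open>D\<^sub>1\<close>, on which \<open>al\<close> is \<open>be\<close> rotated about \<open>n\<close> by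
  60 degrees, and \<open>w\<close> is sent to the orthogonal complement of \<open>D\<^sub>1\<close>.
\<close>

locale adapted_frame =
  fixes al be :: "real^3 \<Rightarrow> real^3" and n u v w a :: "real^3" and x y :: real
  assumes linear_al: "linear al" and linear_be: "linear be"
    and norm_n: "norm n = 1" and norm_a: "norm a = 1" and a_n: "a \<bullet> n = 0"
    and be_u: "be u = a" and al_u: "al u = (1/2) *\<^sub>R (a + sqrt 3 *\<^sub>R cross3 n a)"
    and be_v: "be v = cross3 n a" and al_v: "al v = (1/2) *\<^sub>R (cross3 n a - sqrt 3 *\<^sub>R a)"
    and al_w: "al w = x *\<^sub>R n" and be_w: "be w = y *\<^sub>R n"
    and xy: "x \<noteq> 0 \<or> y \<noteq> 0" and span_uvw: "span {u, v, w} = UNIV"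
begin

abbreviation b where "b \<equiv> cross3 n a"

lemma inner_frame:
  "n \<bullet> n = 1" "a \<bullet> a = 1" "b \<bullet> b = 1" "a \<bullet> n = 0" "n \<bullet> a = 0" "b \<bullet> n = 0" "n \<bullet> b = 0" "a \<bullet> b = 0" "b \<bullet> a = 0"
  using norm_n norm_a a_n by (simp_all add: norm_eq_1 dot_cross dot_cross_self inner_commute)

lemma cross_frame:
  "cross3 a b = n" "cross3 b a = - n" "cross3 b n = a" "cross3 n b = - a" "cross3 a n = - b"
  using inner_frame by (simp_all add: Lagrange cross_skew[of b] cross_skew[of a n])

lemma expand: "X = (X \<bullet> a) *\<^sub>R a + (X \<bullet> b) *\<^sub>R b + (X \<bullet> n) *\<^sub>R n"
  by (rule orth_basis_expand[OF norm_n norm_a a_n refl])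

lemma coords: "\<exists>p q r. X = p *\<^sub>R u + q *\<^sub>R v + r *\<^sub>R w"
proof -
  have "X \<in> span {u, v, w}" by (simp add: span_uvw)
  then show ?thesis by (auto simp: span_insert span_empty) (metis add.assoc diff_add_cancel diff_eq_eq add.commute)
qed

lemmas lin = linear_add[OF linear_al] linear_scale[OF linear_al] linear_add[OF linear_be] linear_scale[OF linear_be]

lemma forms_n: "\<exists>r. al X \<bullet> n = r * x \<and> be X \<bullet> n = r * y"
proof -
  obtain p q r where X: "X = p *\<^sub>R u + q *\<^sub>R v + r *\<^sub>R w" using coords by blast
  show ?thesis
    by (rule exI[of _ r]) (simp add: X lin be_u be_v be_w al_u al_v al_w inner_add_left inner_diff_left inner_frame)
qed

text \<open>Rotation by 60 degrees on \<open>u\<close> and \<open>v\<close>, while on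
  \<open>w\<close> both sides are multiples of \<open>n\<close>. The frame enters through
  \<open>n\<close> alone, which makes the identity fit for differentiation.\<close>

lemma rotation_eq:
  "2 *\<^sub>R al X - be X - sqrt 3 *\<^sub>R cross3 n (be X) = (2 * (al X \<bullet> n) - be X \<bullet> n) *\<^sub>R n"
proof -
  obtain p q r where X: "X = p *\<^sub>R u + q *\<^sub>R v + r *\<^sub>R w" using coords by blast
  show ?thesis
    by (simp add: X lin be_u be_v be_w al_u al_v al_w inner_add_left inner_diff_left inner_frame
      cross3.add_right cross3.scaleR_right cross_frame vec_eq_iff algebra_simps)
qed

lemma al_injective:
  assumes "x \<noteq> 0" "al X = 0" shows "X = 0"
proof -
  obtain p q r where X: "X = p *\<^sub>R u + q *\<^sub>R v + r *\<^sub>R w" using coords by blast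
  have "al X \<bullet> n = 0" "al X \<bullet> a = 0" "al X \<bullet> b = 0" using assms by simp_all
  then have e: "r * x = 0" "p - q * sqrt 3 = 0" "p * sqrt 3 + q = 0"
    by (simp_all add: X lin be_u be_v be_w al_u al_v al_w inner_add_left inner_diff_left inner_frame algebra_simps)
  then have "q * 3 + q = 0" by (metis eq_iff_diff_eq_0 mult.assoc real_sqrt_mult_self abs_numeral)
  then show ?thesis using e assms X by simp
qed

lemma be_injective:
  assumes "y \<noteq> 0" "be X = 0" shows "X = 0"
proof -
  obtain p q r where X: "X = p *\<^sub>R u + q *\<^sub>R v + r *\<^sub>R w" using coords by blast
  have "be X \<bullet> n = 0" "be X \<bullet> a = 0" "be X \<bullet> b = 0" using assms by simp_all
  then have e: "r * y = 0" "p = 0" "q = 0"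
    by (simp_all add: X lin be_u be_v be_w al_u al_v al_w inner_add_left inner_diff_left inner_frame algebra_simps)
  then show ?thesis using assms X by simp
qed

end

text \<open>\<open>Da X Y\<close>, \<open>Db X Y\<close> and \<open>dn Y\<close> model the
  derivatives of \<open>al X\<close>, \<open>be X\<close> and \<open>n\<close> in direction
  \<open>Y\<close>. The first two assumptions are the Maurer-Cartan equations, and the last two are
  the differentiated rotation relation and the differentiated proportionality of the
  \<open>n\<close>-components.\<close>

locale frame_structure = adapted_frame +
  fixes Da Db :: "real^3 \<Rightarrow> real^3 \<Rightarrow> real^3" and dn :: "real^3 \<Rightarrow> real^3"
  assumes da: "Da X Y - Da Y X = 2 *\<^sub>R cross3 (al X) (al Y)"
    and db: "Db X Y - Db Y X = 2 *\<^sub>R cross3 (be X) (be Y)"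
    and linear_dn: "linear dn" and dn_n: "dn X \<bullet> n = 0"
    and d_rotation: "2 *\<^sub>R Da X Y - Db X Y - sqrt 3 *\<^sub>R (cross3 (dn Y) (be X) + cross3 n (Db X Y)) =
      (2 * (Da X Y \<bullet> n + al X \<bullet> dn Y) - (Db X Y \<bullet> n + be X \<bullet> dn Y)) *\<^sub>R n + (2 * (al X \<bullet> n) - be X \<bullet> n) *\<^sub>R dn Y"
    and d_proportional: "(Da X Z \<bullet> n + al X \<bullet> dn Z) * (be Y \<bullet> n) + (al X \<bullet> n) * (Db Y Z \<bullet> n + be Y \<bullet> dn Z) =
      (Da Y Z \<bullet> n + al Y \<bullet> dn Z) * (be X \<bullet> n) + (al Y \<bullet> n) * (Db X Z \<bullet> n + be X \<bullet> dn Z)"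
begin

text \<open>Antisymmetrizing in \<open>X\<close> and \<open>Y\<close> leaves \<open>Da\<close> and
  \<open>Db\<close> only through differences that the Maurer-Cartan equations evaluate.\<close>

lemma d_rotation_alt:
  "4 *\<^sub>R cross3 (al X) (al Y) - 2 *\<^sub>R cross3 (be X) (be Y)
     - sqrt 3 *\<^sub>R (cross3 (dn Y) (be X) - cross3 (dn X) (be Y) + 2 *\<^sub>R cross3 n (cross3 (be X) (be Y))) =
   (2 * ((Da X Y - Da Y X) \<bullet> n + al X \<bullet> dn Y - al Y \<bullet> dn X) - ((Db X Y - Db Y X) \<bullet> n + be X \<bullet> dn Y - be Y \<bullet> dn X)) *\<^sub>R n
     + (2 * (al X \<bullet> n) - be X \<bullet> n) *\<^sub>R dn Y - (2 * (al Y \<bullet> n) - be Y \<bullet> n) *\<^sub>R dn X"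
proof -
  have "cross3 n (Db X Y) - cross3 n (Db Y X) = 2 *\<^sub>R cross3 n (cross3 (be X) (be Y))"
    by (simp add: db cross3.scaleR_right flip: cross3.diff_right)
  note c = this
  show ?thesis
    unfolding vec_eq_iff
  proof
    fix i
    note comp = arg_cong[of _ _ "\<lambda>z. z $ i"]
    show "(4 *\<^sub>R cross3 (al X) (al Y) - 2 *\<^sub>R cross3 (be X) (be Y)
     - sqrt 3 *\<^sub>R (cross3 (dn Y) (be X) - cross3 (dn X) (be Y) + 2 *\<^sub>R cross3 n (cross3 (be X) (be Y)))) $ i =
   ((2 * ((Da X Y - Da Y X) \<bullet> n + al X \<bullet> dn Y - al Y \<bullet> dn X) - ((Db X Y - Db Y X) \<bullet> n + be X \<bullet> dn Y - be Y \<bullet> dn X)) *\<^sub>R n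
     + (2 * (al X \<bullet> n) - be X \<bullet> n) *\<^sub>R dn Y - (2 * (al Y \<bullet> n) - be Y \<bullet> n) *\<^sub>R dn X) $ i"
      using comp[OF c] comp[OF d_rotation[of X Y]] comp[OF d_rotation[of Y X]] comp[OF da[of X Y]] comp[OF db[of X Y]]
        arg_cong[OF comp[OF c], of "\<lambda>z. sqrt 3 * z"]
      by (simp only: vector_add_component vector_minus_component vector_scaleR_component real_scaleR_def
          inner_diff_left algebra_simps)
  qed
qed

lemmas ev = be_u be_v be_w al_u al_v al_w inner_add_left inner_diff_left inner_add_right inner_diff_right inner_frame
      cross3.add_right cross3.diff_right cross3.scaleR_right cross3.add_left cross3.diff_left cross3.scaleR_left
      cross3.minus_left cross3.minus_right cross_frame

section \<open>The derivative of \<open>n\<close> in the frame\<close>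

definition P where "P = dn u \<bullet> a"
definition Q where "Q = dn u \<bullet> b"
definition P' where "P' = dn v \<bullet> a"
definition Q' where "Q' = dn v \<bullet> b"
definition p where "p = dn w \<bullet> a"
definition q where "q = dn w \<bullet> b"

lemma dn_expand: "dn u = P *\<^sub>R a + Q *\<^sub>R b" "dn v = P' *\<^sub>R a + Q' *\<^sub>R b" "dn w = p *\<^sub>R a + q *\<^sub>R b"
  using expand[of "dn u"] expand[of "dn v"] expand[of "dn w"]
  by (simp_all add: dn_n P_def Q_def P'_def Q'_def p_def q_def)

text \<open>In complex form \<open>(2x - y - i sqrt 3 y) (P + i Q) = 2 (sqrt 3 - i) (y - x)\<close>,
  from the pair \<open>w\<close>, \<open>u\<close>.\<close>

lemma PQ: "(2*x - y) * P + sqrt 3 * y * Q = 2 * sqrt 3 * (y - x)" "(2*x - y) * Q - sqrt 3 * y * P = 2 * (x - y)"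
  using arg_cong[OF d_rotation_alt[of w u], of "\<lambda>z. z \<bullet> a"] arg_cong[OF d_rotation_alt[of w u], of "\<lambda>z. z \<bullet> b"]
  unfolding dn_expand by (simp_all add: ev algebra_simps)

lemma PQ': "(2*x - y) * P' + sqrt 3 * y * Q' = 2 * (y - x)" "(2*x - y) * Q' - sqrt 3 * y * P' = 2 * sqrt 3 * (y - x)"
  using arg_cong[OF d_rotation_alt[of w v], of "\<lambda>z. z \<bullet> a"] arg_cong[OF d_rotation_alt[of w v], of "\<lambda>z. z \<bullet> b"]
  unfolding dn_expand by (simp_all add: ev algebra_simps)

text \<open>A quarter of the squared modulus of the coefficient \<open>2x - y - i sqrt 3 y\<close>,
  and three quarters of the squared \<open>linv_g\<close>-length of
  \<open>(x n, y n)\<close>.\<close>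

definition D where "D = x * x - x * y + y * y"

lemma D_pos: "D > 0"
proof -
  have "4 * D = (2*x - y)\<^sup>2 + 3 * y\<^sup>2" by (simp add: D_def power2_eq_square algebra_simps)
  moreover have "\<dots> > 0"
  proof (cases "y = 0")
    case True then show ?thesis using xy by simp
  next
    case False then show ?thesis by (simp add: add_nonneg_pos)
  qed
  ultimately show ?thesis by simp
qed

text \<open>Division by that complex coefficient: multiplication by its conjugate.\<close>

lemma solve2:
  assumes "(2*x - y) * f + sqrt 3 * y * g = k" "(2*x - y) * g - sqrt 3 * y * f = l"
  shows "4 * D * f = (2*x - y) * k - sqrt 3 * y * l" "4 * D * g = sqrt 3 * y * k + (2*x - y) * l"
  unfolding assms[symmetric] D_def by (simp_all add: algebra_simps)

lemma DP: "D * P = sqrt 3 * x * (y - x)" and DQ: "D * Q = (y - x) * (2*y - x)"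
  using solve2[OF PQ] by (simp_all add: algebra_simps)

text \<open>The right-hand sides of \<open>PQ'\<close> are \<open>i\<close> times those of
  \<open>PQ\<close>, with the same coefficient; so \<open>dn\<close> commutes with the quarter turn
  about \<open>n\<close>.\<close>

lemma P'Q': "P' = - Q" "Q' = P"
proof -
  have "D * P' = - (D * Q)" "D * Q' = D * P"
    using solve2[OF PQ'] unfolding DP DQ by (simp_all add: algebra_simps)
  then have "D * (P' + Q) = 0" "D * (Q' - P) = 0" by (simp_all add: algebra_simps)
  then show "P' = - Q" "Q' = P" using D_pos by simp_all
qed

text \<open>
  The proportionality \<open>A X * B Y = A Y * B X\<close> of the \<open>n\<close>-components \<open>A\<close>, \<open>B\<close> of \<open>al\<close>, \<open>be\<close>, differentiated along \<open>D\<^sub>1\<close>,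
  is the integrability condition that restricts the direction \<open>(x, y)\<close>.
\<close>

lemma phase: "x * y * (y - x) = 0"
proof -
  have da': "Da u v = Da v u + 2 *\<^sub>R cross3 (al u) (al v)" "Db u v = Db v u + 2 *\<^sub>R cross3 (be u) (be v)"
    using da[of u v] db[of u v] by (simp_all add: algebra_simps)
  \<comment> \<open>The arguments are taken in the order \<open>X\<close>, \<open>Z\<close>,
    \<open>Y\<close>: the relation for the pair \<open>u\<close>, \<open>w\<close> is differentiated
    along \<open>v\<close>, the one for \<open>v\<close>, \<open>w\<close> along \<open>u\<close>.
    In the difference the second derivatives combine to cross products.\<close>
  have e: "y * (2 - Q + sqrt 3 * P) = x * (2 - 2 * Q)"
    using d_proportional[of u v w] d_proportional[of v u w] unfolding dn_expand P'Q' da'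
    by (simp add: ev) (simp add: algebra_simps)
  have "y * (2 * D - D * Q + sqrt 3 * (D * P)) = x * (2 * D - 2 * (D * Q))"
    using arg_cong[OF e, of "\<lambda>z. D * z"] by (simp add: algebra_simps)
  then have "y * (2 * D - (y - x) * (2*y - x) + sqrt 3 * (sqrt 3 * x * (y - x))) = x * (2 * D - 2 * ((y - x) * (2*y - x)))"
    unfolding DP DQ .
  moreover have "sqrt 3 * (sqrt 3 * x * (y - x)) = 3 * x * (y - x)" by (simp flip: mult.assoc)
  ultimately show ?thesis unfolding D_def by (simp add: algebra_simps)
qed

text \<open>\<open>const\<close> is the derivative of a relation \<open>l * A = k * B\<close> with
  constant coefficients. Antisymmetrized on the pairs \<open>w\<close>, \<open>u\<close> and
  \<open>w\<close>, \<open>v\<close>, it reads \<open>(l - 2 k - i sqrt 3 l) (p + i q) = 0\<close>,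
  and this coefficient vanishes only for \<open>k = l = 0\<close>.\<close>

lemma dn_w:
  assumes const: "\<And>X Z. l * (Da X Z \<bullet> n + al X \<bullet> dn Z) = k * (Db X Z \<bullet> n + be X \<bullet> dn Z)"
    and kl: "k \<noteq> 0 \<or> l \<noteq> 0"
  shows "dn w = 0"
proof -
  have alt: "l * (2 * (cross3 (al X) (al Y) \<bullet> n) + al X \<bullet> dn Y - al Y \<bullet> dn X) =
      k * (2 * (cross3 (be X) (be Y) \<bullet> n) + be X \<bullet> dn Y - be Y \<bullet> dn X)" for X Y
  proof -
    have e: "2 * (cross3 (al X) (al Y) \<bullet> n) = Da X Y \<bullet> n - Da Y X \<bullet> n" "2 * (cross3 (be X) (be Y) \<bullet> n) = Db X Y \<bullet> n - Db Y X \<bullet> n"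
      by (simp_all add: da db flip: inner_diff_left)
    show ?thesis using const[of X Y] const[of Y X] unfolding e by (simp add: algebra_simps)
  qed
  have "l * (p + sqrt 3 * q) / 2 = k * p"
    using alt[of w u] unfolding dn_expand by (simp add: ev field_simps)
  moreover have "l * (q - sqrt 3 * p) / 2 = k * q"
    using alt[of w v] unfolding dn_expand by (simp add: ev field_simps)
  ultimately have e: "(l - 2 * k) * p + sqrt 3 * l * q = 0" "(l - 2 * k) * q - sqrt 3 * l * p = 0"
    by (simp_all add: field_simps)
  have "((l - 2 * k)\<^sup>2 + 3 * l\<^sup>2) * p = (l - 2 * k) * ((l - 2 * k) * p + sqrt 3 * l * q) - sqrt 3 * l * ((l - 2 * k) * q - sqrt 3 * l * p)"
    "((l - 2 * k)\<^sup>2 + 3 * l\<^sup>2) * q = (l - 2 * k) * ((l - 2 * k) * q - sqrt 3 * l * p) + sqrt 3 * l * ((l - 2 * k) * p + sqrt 3 * l * q)"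
    by (simp_all add: power2_eq_square algebra_simps)
  moreover have "(l - 2 * k)\<^sup>2 + 3 * l\<^sup>2 > 0"
    using kl by (cases "l = 0") (simp_all add: add_nonneg_pos)
  ultimately show ?thesis unfolding e dn_expand by simp
qed

lemma dn_eqI:
  assumes "linear L" "dn u = L u" "dn v = L v" "dn w = L w"
  shows "dn X = L X"
proof -
  obtain p q r where X: "X = p *\<^sub>R u + q *\<^sub>R v + r *\<^sub>R w" using coords by blast
  then show ?thesis using assms(2-) by (simp add: linear_add[OF assms(1)] linear_scale[OF assms(1)] linear_add[OF linear_dn] linear_scale[OF linear_dn])
qed

text \<open>These are the conditions for \<open>n\<close> itself, or its conjugate by the first or
  by the second map into the sphere, to have zero derivative: the conjugate by a map with
  Maurer-Cartan form \<alpha> has derivative conjugate to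
  \<open>dn - 2 n \<times> \<alpha>\<close>.\<close>

lemma dn_cases:
  assumes dw: "dn w = 0"
  shows "x = y \<Longrightarrow> dn X = 0" "y = 0 \<Longrightarrow> dn X = 2 *\<^sub>R cross3 n (al X)" "x = 0 \<Longrightarrow> dn X = 2 *\<^sub>R cross3 n (be X)"
proof -
  have *: "linear (\<lambda>X. 2 *\<^sub>R cross3 n (al X))" "linear (\<lambda>X. 2 *\<^sub>R cross3 n (be X))"
    by (rule linearI; simp add: lin cross3.add_right cross3.scaleR_right scaleR_add_right)+
  show "dn X = 0" if "x = y"
  proof (rule dn_eqI[of "\<lambda>_. 0"])
    have "P = 0" "Q = 0" using DP DQ D_pos that by simp_all
    then show "dn u = 0" "dn v = 0" by (simp_all add: dn_expand P'Q')
  qed (simp_all add: dw linear_zero)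
  show "dn X = 2 *\<^sub>R cross3 n (al X)" if "y = 0"
  proof (rule dn_eqI[OF *(1)])
    have "x * x * (P + sqrt 3) = 0" "x * x * (Q - 1) = 0" "x \<noteq> 0"
      using DP DQ xy that unfolding D_def by (simp_all add: algebra_simps)
    then have "P = - sqrt 3" "Q = 1" by simp_all
    then show "dn u = 2 *\<^sub>R cross3 n (al u)" "dn v = 2 *\<^sub>R cross3 n (al v)" by (simp_all add: dn_expand P'Q' ev)
  qed (simp add: dw ev)
  show "dn X = 2 *\<^sub>R cross3 n (be X)" if "x = 0"
  proof (rule dn_eqI[OF *(2)])
    have "P = 0" "Q = 2" using DP DQ xy that unfolding D_def by simp_all
    then show "dn u = 2 *\<^sub>R cross3 n (be u)" "dn v = 2 *\<^sub>R cross3 n (be v)" by (simp_all add: dn_expand P'Q' ev)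
  qed (simp add: dw ev)
qed

end

section \<open>Maurer-Cartan forms of maps into the 3-sphere\<close>

lemma second_difference_mvt:
  fixes f :: "'a::real_normed_vector \<Rightarrow> real"
  assumes h: "h > 0" and S: "\<And>a b. 0 \<le> a \<Longrightarrow> a \<le> h \<Longrightarrow> 0 \<le> b \<Longrightarrow> b \<le> h \<Longrightarrow> t + a *\<^sub>R X + b *\<^sub>R Y \<in> S"
    and f: "\<And>s. s \<in> S \<Longrightarrow> (f has_derivative f' s) (at s)"
    and f': "\<And>s. s \<in> S \<Longrightarrow> ((\<lambda>r. f' r X) has_derivative g s) (at s)"
  shows "\<exists>a b. 0 < a \<and> a < h \<and> 0 < b \<and> b < h \<and>
    f (t + h *\<^sub>R X + h *\<^sub>R Y) - f (t + h *\<^sub>R X) - f (t + h *\<^sub>R Y) + f t = h * h * g (t + a *\<^sub>R X + b *\<^sub>R Y) Y"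
proof -
  have line: "((\<lambda>s. F (c + s *\<^sub>R Z)) has_real_derivative F' (c + s *\<^sub>R Z) Z) (at s)"
    if "(F has_derivative F' (c + s *\<^sub>R Z)) (at (c + s *\<^sub>R Z))" for F :: "'a \<Rightarrow> real" and F' c s Z
  proof -
    have "((\<lambda>s. c + s *\<^sub>R Z) has_derivative (\<lambda>s. s *\<^sub>R Z)) (at s)"
      by (auto intro!: derivative_eq_intros)
    from has_derivative_compose[OF this that] have "((\<lambda>s. F (c + s *\<^sub>R Z)) has_derivative (\<lambda>x. F' (c + s *\<^sub>R Z) (x *\<^sub>R Z))) (at s)" .
    moreover have "(\<lambda>x. F' (c + s *\<^sub>R Z) (x *\<^sub>R Z)) = (*) (F' (c + s *\<^sub>R Z) Z)"
      using linear_scale[OF has_derivative_linear[OF that]] by (auto simp: mult.commute)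
    ultimately show ?thesis by (simp add: has_field_derivative_def)
  qed
  define \<phi> where "\<phi> s = f ((t + h *\<^sub>R Y) + s *\<^sub>R X) - f (t + s *\<^sub>R X)" for s
  have "\<exists>a>0. a < h \<and> \<phi> h - \<phi> 0 = (h - 0) * (f' ((t + h *\<^sub>R Y) + a *\<^sub>R X) X - f' (t + a *\<^sub>R X) X)"
  proof (rule MVT2[OF h])
    fix s assume s: "0 \<le> s" "s \<le> h"
    have "(t + h *\<^sub>R Y) + s *\<^sub>R X \<in> S" "t + s *\<^sub>R X \<in> S"
      using S[of s h] S[of s 0] s h by (simp_all add: algebra_simps)
    then show "(\<phi> has_real_derivative f' ((t + h *\<^sub>R Y) + s *\<^sub>R X) X - f' (t + s *\<^sub>R X) X) (at s)"
      unfolding \<phi>_def by (intro DERIV_diff line f)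
  qed
  then obtain a where a: "0 < a" "a < h" "\<phi> h - \<phi> 0 = h * (f' ((t + h *\<^sub>R Y) + a *\<^sub>R X) X - f' (t + a *\<^sub>R X) X)"
    by auto
  define \<psi> where "\<psi> r = f' ((t + a *\<^sub>R X) + r *\<^sub>R Y) X" for r
  have "\<exists>b>0. b < h \<and> \<psi> h - \<psi> 0 = (h - 0) * g ((t + a *\<^sub>R X) + b *\<^sub>R Y) Y"
  proof (rule MVT2[OF h])
    fix r assume r: "0 \<le> r" "r \<le> h"
    have "(t + a *\<^sub>R X) + r *\<^sub>R Y \<in> S" using S[of a r] r a by simp
    then show "(\<psi> has_real_derivative g ((t + a *\<^sub>R X) + r *\<^sub>R Y) Y) (at r)"
      unfolding \<psi>_def by (intro line[of "\<lambda>s. f' s X"] f')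
  qed
  then obtain b where b: "0 < b" "b < h" "\<psi> h - \<psi> 0 = h * g ((t + a *\<^sub>R X) + b *\<^sub>R Y) Y"
    by auto
  have "\<phi> h - \<phi> 0 = h * (\<psi> h - \<psi> 0)" unfolding a(3) \<psi>_def by (simp add: algebra_simps)
  then have "\<phi> h - \<phi> 0 = h * h * g (t + a *\<^sub>R X + b *\<^sub>R Y) Y" using b(3) by simp
  moreover have "\<phi> h - \<phi> 0 = f (t + h *\<^sub>R X + h *\<^sub>R Y) - f (t + h *\<^sub>R X) - f (t + h *\<^sub>R Y) + f t"
    by (simp add: \<phi>_def algebra_simps)
  ultimately show ?thesis using a b by auto
qed

text \<open>The second difference is symmetric in \<open>X\<close> and \<open>Y\<close>, and equals
  \<open>h * h\<close> times either mixed derivative at some point near \<open>t\<close>. A gap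
  between the two derivatives at \<open>t\<close> would survive nearby by continuity.\<close>

lemma mixed_partials_symmetric_real:
  fixes f :: "'a::real_normed_vector \<Rightarrow> real"
  assumes S: "open S" "t \<in> S"
    and f: "\<And>s. s \<in> S \<Longrightarrow> (f has_derivative f' s) (at s)"
    and f': "\<And>s X. s \<in> S \<Longrightarrow> ((\<lambda>r. f' r X) has_derivative f'' s X) (at s)"
    and cont: "\<And>X Y. continuous_on S (\<lambda>s. f'' s X Y)"
  shows "f'' t X Y = f'' t Y X"
proof (rule ccontr)
  assume ne: "f'' t X Y \<noteq> f'' t Y X"
  define e where "e = \<bar>f'' t X Y - f'' t Y X\<bar> / 2"
  have e: "e > 0" using ne by (simp add: e_def)
  have "isCont (\<lambda>s. f'' s X Y) t" "isCont (\<lambda>s. f'' s Y X) t"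
    using cont S by (auto simp: continuous_on_eq_continuous_at)
  then have lim: "((\<lambda>s. f'' s X Y) \<longlongrightarrow> f'' t X Y) (nhds t)" "((\<lambda>s. f'' s Y X) \<longlongrightarrow> f'' t Y X) (nhds t)"
    using tendsto_at_iff_tendsto_nhds[of "\<lambda>s. f'' s X Y" t] tendsto_at_iff_tendsto_nhds[of "\<lambda>s. f'' s Y X" t]
    by (simp_all add: isCont_def)
  have "\<forall>\<^sub>F s in nhds t. s \<in> S \<and> dist (f'' s X Y) (f'' t X Y) < e \<and> dist (f'' s Y X) (f'' t Y X) < e"
    by (intro eventually_conj eventually_nhds_in_open S tendstoD[OF lim(1) e] tendstoD[OF lim(2) e])
  then obtain d where d: "d > 0" "\<And>s. dist s t < d \<Longrightarrow> s \<in> S \<and> dist (f'' s X Y) (f'' t X Y) < e \<and> dist (f'' s Y X) (f'' t Y X) < e"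
    by (auto simp: eventually_nhds_metric)
  define K where "K = norm X + norm Y + 1"
  have K: "K > 0" by (simp add: K_def add_nonneg_pos)
  define h where "h = d / (2 * K)"
  have h: "h > 0" using d K by (simp add: h_def)
  have near: "dist (t + a *\<^sub>R X + b *\<^sub>R Y) t < d" if "0 \<le> a" "a \<le> h" "0 \<le> b" "b \<le> h" for a b
  proof -
    have "dist (t + a *\<^sub>R X + b *\<^sub>R Y) t = norm (a *\<^sub>R X + b *\<^sub>R Y)" by (simp add: dist_norm)
    also have "\<dots> \<le> a * norm X + b * norm Y" using that norm_triangle_ineq[of "a *\<^sub>R X" "b *\<^sub>R Y"] by simp
    also have "\<dots> \<le> h * norm X + h * norm Y" using that by (intro add_mono mult_right_mono) auto
    also have "\<dots> \<le> h * K" using h by (simp add: K_def algebra_simps)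
    also have "\<dots> = d / 2" using K by (simp add: h_def)
    finally show ?thesis using d by simp
  qed
  have near': "dist (t + a *\<^sub>R Y + b *\<^sub>R X) t < d" if "0 \<le> a" "a \<le> h" "0 \<le> b" "b \<le> h" for a b
    using near[of b a] that by (simp add: algebra_simps)
  obtain a b where ab: "0 < a" "a < h" "0 < b" "b < h"
    "f (t + h *\<^sub>R X + h *\<^sub>R Y) - f (t + h *\<^sub>R X) - f (t + h *\<^sub>R Y) + f t = h * h * f'' (t + a *\<^sub>R X + b *\<^sub>R Y) X Y"
    using second_difference_mvt[OF h, of t X Y S f f' "\<lambda>s. f'' s X"] near d(2) f f' by blast
  obtain a' b' where ab': "0 < a'" "a' < h" "0 < b'" "b' < h"
    "f (t + h *\<^sub>R Y + h *\<^sub>R X) - f (t + h *\<^sub>R Y) - f (t + h *\<^sub>R X) + f t = h * h * f'' (t + a' *\<^sub>R Y + b' *\<^sub>R X) Y X"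
    using second_difference_mvt[OF h, of t Y X S f f' "\<lambda>s. f'' s Y"] near' d(2) f f' by blast
  have "h * h * f'' (t + a *\<^sub>R X + b *\<^sub>R Y) X Y = h * h * f'' (t + a' *\<^sub>R Y + b' *\<^sub>R X) Y X"
    using ab(5) ab'(5) by (simp add: algebra_simps)
  then have eq: "f'' (t + a *\<^sub>R X + b *\<^sub>R Y) X Y = f'' (t + a' *\<^sub>R Y + b' *\<^sub>R X) Y X" using h by simp
  have "dist (f'' (t + a *\<^sub>R X + b *\<^sub>R Y) X Y) (f'' t X Y) < e"
    using d(2)[OF near[of a b]] ab by simp
  moreover have "dist (f'' (t + a' *\<^sub>R Y + b' *\<^sub>R X) Y X) (f'' t Y X) < e"
    using d(2)[OF near'[of a' b']] ab' by simp
  ultimately show False unfolding eq e_def dist_real_def by (simp add: abs_if split: if_splits)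
qed

lemma mixed_partials_symmetric:
  fixes f :: "'a::real_normed_vector \<Rightarrow> 'b::euclidean_space"
  assumes S: "open S" "t \<in> S"
    and f: "\<And>s. s \<in> S \<Longrightarrow> (f has_derivative f' s) (at s)"
    and f': "\<And>s X. s \<in> S \<Longrightarrow> ((\<lambda>r. f' r X) has_derivative f'' s X) (at s)"
    and cont: "\<And>X Y. continuous_on S (\<lambda>s. f'' s X Y)"
  shows "f'' t X Y = f'' t Y X"
proof (rule euclidean_eqI)
  fix i :: 'b assume "i \<in> Basis"
  show "f'' t X Y \<bullet> i = f'' t Y X \<bullet> i"
    by (rule mixed_partials_symmetric_real[OF S, where f = "\<lambda>s. f s \<bullet> i" and f' = "\<lambda>s X. f' s X \<bullet> i" and f'' = "\<lambda>s X Y. f'' s X Y \<bullet> i"])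
      (auto intro!: has_derivative_inner_left f f' continuous_intros cont)
qed

text \<open>\<open>smooth_on\<close> supplies a local extension \<open>F\<close> whose derivatives
  are controlled. On the open set where \<open>F\<close> and \<open>f\<close> agree, so do their
  derivatives.\<close>

lemma smooth_on_open_twice_differentiable:
  fixes f :: "'a::real_normed_vector \<Rightarrow> 'b::euclidean_space"
  assumes U: "open U" and sm: "smooth_on U f" and t: "t \<in> U"
  defines "f' \<equiv> \<lambda>s. frechet_derivative f (at s)"
  defines "f'' \<equiv> \<lambda>s X. frechet_derivative (\<lambda>r. f' r X) (at s)"
  shows "(f has_derivative f' t) (at t)" "((\<lambda>r. f' r X) has_derivative f'' t X) (at t)" "f'' t X Y = f'' t Y X"
proof -
  obtain W F where WF: "open W \<and> t \<in> W \<and> (\<forall>k. Ck_on k W F) \<and> (\<forall>y\<in>W \<inter> U. F y = f y)"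
    using sm[unfolded smooth_on_def, rule_format, OF t] by (elim exE) (rule that)
  then have W: "open W" "t \<in> W" and C: "\<And>k. Ck_on k W F" and eq: "\<And>y. y \<in> W \<inter> U \<Longrightarrow> F y = f y"
    by simp_all
  define V where "V = W \<inter> U"
  have V: "open V" "t \<in> V" using W U t by (auto simp: V_def)
  define F' where "F' = (\<lambda>s. frechet_derivative F (at s))"
  define F'' where "F'' = (\<lambda>s X. frechet_derivative (\<lambda>r. F' r X) (at s))"
  have C2: "Ck_on (Suc (Suc 0)) W F" by (rule C)
  have C1: "Ck_on (Suc 0) W (\<lambda>r. F' r X)" for X
    using C2[unfolded Ck_on.simps(2)[of "Suc 0"]] unfolding F'_def by blast
  have F: "(F has_derivative F' s) (at s)" if "s \<in> W" for s
    unfolding F'_def by (rule frechet_derivative_works[THEN iffD1]) (use C2 that in simp)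
  have F': "((\<lambda>r. F' r X) has_derivative F'' s X) (at s)" if "s \<in> W" for s X
    unfolding F''_def by (rule frechet_derivative_works[THEN iffD1]) (use C1[of X] that in simp)
  have cont: "continuous_on W (\<lambda>s. F'' s X Y)" for X Y
    unfolding F''_def using C1[of X] by simp
  have f: "(f has_derivative F' s) (at s)" if "s \<in> V" for s
    by (rule has_derivative_transform_within_open[OF F V(1) that]) (use that eq in \<open>auto simp: V_def\<close>)
  then have f'F': "f' s = F' s" if "s \<in> V" for s
    using that frechet_derivative_at f'_def by metis
  have f': "((\<lambda>r. f' r X) has_derivative F'' s X) (at s)" if "s \<in> V" for s X
    by (rule has_derivative_transform_within_open[OF F' V(1) that]) (use that f'F' in \<open>auto simp: V_def\<close>)
  then have f''F'': "f'' t X = F'' t X" for X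
    using V(2) frechet_derivative_at f''_def by metis
  show "(f has_derivative f' t) (at t)" using f[OF V(2)] f'F'[OF V(2)] by simp
  show "((\<lambda>r. f' r X) has_derivative f'' t X) (at t)" unfolding f''F'' by (rule f'[OF V(2)])
  show "f'' t X Y = f'' t Y X"
    unfolding f''F'' by (rule mixed_partials_symmetric[OF W F F' cont])
qed

lemma derivative_of_vanishing:
  assumes "open U" "t \<in> U" "(f has_derivative D) (at t)" "\<And>s. s \<in> U \<Longrightarrow> f s = 0"
  shows "D Y = 0"
proof -
  have "(f has_derivative (\<lambda>_. 0)) (at t)"
    by (rule has_derivative_transform_within_open[OF has_derivative_const assms(1,2)]) (simp add: assms(4))
  then show ?thesis using has_derivative_unique[OF assms(3)] by metis
qed

text \<open>Exactly the regularity behind the Maurer-Cartan equation: two derivatives and the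
  symmetry of the second. They are explicit parameters, so that both projections of one map into
  \<open>S3S3\<close> are instances.\<close>

locale S3_map =
  fixes U :: "'a::real_normed_vector set" and p :: "'a \<Rightarrow> quat" and p' :: "'a \<Rightarrow> 'a \<Rightarrow> quat" and p'' :: "'a \<Rightarrow> 'a \<Rightarrow> 'a \<Rightarrow> quat"
  assumes open_U: "open U" and S3: "t \<in> U \<Longrightarrow> p t \<in> S3"
    and deriv: "t \<in> U \<Longrightarrow> (p has_derivative p' t) (at t)"
    and deriv2: "t \<in> U \<Longrightarrow> ((\<lambda>s. p' s X) has_derivative p'' t X) (at t)"
    and symmetric: "t \<in> U \<Longrightarrow> p'' t X Y = p'' t Y X"
begin

definition mc :: "'a \<Rightarrow> 'a \<Rightarrow> real^3" where
  "mc t X = qim (qcnj (p t) \<odot> p' t X)"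

definition dmc :: "'a \<Rightarrow> 'a \<Rightarrow> 'a \<Rightarrow> real^3" where
  "dmc t X Y = qim (qcnj (p' t Y) \<odot> p' t X + qcnj (p t) \<odot> p'' t X Y)"

text \<open>Differentiating \<open>p \<bullet> p = 1\<close> shows that
  \<open>qcnj (p t) \<odot> p' t X\<close> is purely imaginary, so passing to \<open>qim\<close> in
  \<open>mc\<close> loses nothing.\<close>

lemma p'_eq: assumes t: "t \<in> U" shows "p' t X = p t \<odot> qv (mc t X)"
proof -
  have "((\<lambda>s. p s \<bullet> p s - 1) has_derivative (\<lambda>X. p t \<bullet> p' t X + p' t X \<bullet> p t)) (at t)"
    by (auto intro!: derivative_eq_intros deriv t)
  from derivative_of_vanishing[OF open_U t this]
  have "p t \<bullet> p' t X + p' t X \<bullet> p t = 0" using S3 by (simp add: S3_iff norm_eq_1)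
  then have "(qcnj (p t) \<odot> p' t X)$1 = 0"
    by (simp add: quat_simps inner_vec_def sum_4 algebra_simps)
  then have "qv (mc t X) = qcnj (p t) \<odot> p' t X"
    unfolding mc_def by (intro qv_qim) (simp add: ImH_def)
  then show ?thesis using S3_cnj_assoc S3 t by simp
qed

lemma linear_mc: "t \<in> U \<Longrightarrow> linear (mc t)"
  using has_derivative_linear[OF deriv, of t]
  by (intro linearI) (simp_all add: mc_def linear_add linear_scale qmult.add_right qmult.scaleR_right)

lemma mc_deriv: assumes t: "t \<in> U" shows "((\<lambda>s. mc s X) has_derivative dmc t X) (at t)"
proof -
  have "((\<lambda>s. qcnj (p s) \<odot> p' s X) has_derivative (\<lambda>Y. qcnj (p t) \<odot> p'' t X Y + qcnj (p' t Y) \<odot> p' t X)) (at t)"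
    by (intro qmult.FDERIV bounded_linear.has_derivative[OF bounded_linear_qcnj] deriv deriv2 t)
  from bounded_linear.has_derivative[OF bounded_linear_qim this]
  show ?thesis by (simp add: mc_def dmc_def[abs_def] add.commute)
qed

text \<open>The Maurer-Cartan equation: the second derivatives cancel by symmetry and a commutator
  of imaginary quaternions remains.\<close>

lemma dmc_antisym: assumes t: "t \<in> U" shows "dmc t X Y - dmc t Y X = 2 *\<^sub>R cross3 (mc t X) (mc t Y)"
proof -
  have e: "qcnj (p' t Y) \<odot> p' t X = - (qv (mc t Y) \<odot> qv (mc t X))" for X Y
    unfolding p'_eq[OF t] qcnj_qmult qmult_assoc S3_cnj_assoc(2)[OF S3[OF t]] by (simp add: qmult.minus_left)
  have "dmc t X Y - dmc t Y X = qim (qv (mc t X) \<odot> qv (mc t Y) - qv (mc t Y) \<odot> qv (mc t X))"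
    unfolding dmc_def symmetric[OF t, of X Y] e by simp
  then show ?thesis by (simp add: qim_commutator del: qim_simps)
qed

end

section \<open>Local rigidity\<close>

text \<open>For a unit vector \<open>n\<close>, the twelfth root of unity
  \<open>exp ((\<pi>/6) n)\<close>; conjugation by it rotates about \<open>n\<close> by 60
  degrees.\<close>

definition qroot :: "real^3 \<Rightarrow> quat" where
  "qroot n = (sqrt 3 / 2) *\<^sub>R qone + (1/2) *\<^sub>R qv n"

lemma qcnj_qroot: "qcnj (qroot n) = qroot (- n)"
  by (simp add: qroot_def)

lemma qroot_S3: "norm n = 1 \<Longrightarrow> qroot n \<in> S3"
  by (simp add: S3_iff norm_eq_1 qroot_def qone_def qv_def inner_vec_def sum_3 sum_4)

lemma q0_eq: "q0 = qroot (vector [1,0,0])"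
  by (simp add: q0_def qroot_def quat_simps)

lemma qroot_conj: "p \<in> S3 \<Longrightarrow> p \<odot> qroot n \<odot> qcnj p = (sqrt 3 / 2) *\<^sub>R qone + (1/2) *\<^sub>R (p \<odot> qv n \<odot> qcnj p)"
  by (simp add: qroot_def qmult.add_left qmult.add_right qmult.scaleR_left qmult.scaleR_right S3_cnj)

lemma conj_imag: "p \<odot> qv n \<odot> qcnj p = qv (qim (p \<odot> qv n \<odot> qcnj p))"
  by (simp add: quat_simps algebra_simps)

text \<open>For \<open>h = qroot n\<close>, the hypothesis says that \<open>a\<close> and the
  rotated vector \<open>h b h\<^sup>-\<^sup>1\<close> differ only along \<open>n\<close>, where the
  rotation acts trivially. Multiplying the difference by \<open>h\<close> on the right gives the
  claim.\<close>

lemma qroot_rotation: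
  assumes n: "norm n = 1"
    and rot: "2 *\<^sub>R a - b - sqrt 3 *\<^sub>R cross3 n b = (2 * (a \<bullet> n) - b \<bullet> n) *\<^sub>R n"
  shows "qroot n \<odot> qv b - qv a \<odot> qroot n = (b \<bullet> n - a \<bullet> n) *\<^sub>R (qroot n \<odot> qv n)"
proof -
  define k where "k = 2 * (a \<bullet> n) - b \<bullet> n"
  have nn: "n \<bullet> n = 1" using n by (simp add: norm_eq_1)
  have a: "a = (1/2) *\<^sub>R (b + sqrt 3 *\<^sub>R cross3 n b + k *\<^sub>R n)"
  proof -
    have "2 *\<^sub>R a = b + sqrt 3 *\<^sub>R cross3 n b + k *\<^sub>R n" using rot unfolding k_def by (simp add: algebra_simps)
    then have "(1/2) *\<^sub>R (2 *\<^sub>R a) = (1/2) *\<^sub>R (b + sqrt 3 *\<^sub>R cross3 n b + k *\<^sub>R n)" by simp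
    then show ?thesis by simp
  qed
  have an: "a \<bullet> n = (b \<bullet> n + k) / 2" by (simp add: k_def)
  have can: "cross3 a n = (1/2) *\<^sub>R (sqrt 3 *\<^sub>R (b - (b \<bullet> n) *\<^sub>R n) - cross3 n b)"
    unfolding a using nn by (simp add: cross3.add_left cross3.scaleR_left cross_skew[of "cross3 n b" n] cross_skew[of b n] Lagrange
        inner_commute algebra_simps)
  have "qroot n \<odot> qv b - qv a \<odot> qroot n =
    (sqrt 3 / 2) *\<^sub>R (qv b - qv a) + (1/2) *\<^sub>R (qv (cross3 n b) - (n \<bullet> b) *\<^sub>R qone) - (1/2) *\<^sub>R (qv (cross3 a n) - (a \<bullet> n) *\<^sub>R qone)"
    by (simp add: qroot_def qmult.add_left qmult.add_right qmult.scaleR_left qmult.scaleR_right qmult_qv algebra_simps)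
  also have "\<dots> = ((b \<bullet> n - k) / 2) *\<^sub>R ((sqrt 3 / 2) *\<^sub>R qv n - (1/2) *\<^sub>R qone)"
    unfolding can an by (subst (1) a) (simp add: vec_eq_iff inner_commute[of n b] field_simps)
  also have "\<dots> = (b \<bullet> n - a \<bullet> n) *\<^sub>R (qroot n \<odot> qv n)"
    using nn by (simp add: an qroot_def qmult.add_left qmult.scaleR_left qmult_qv) (simp add: vec_eq_iff field_simps)
  finally show ?thesis .
qed

text \<open>The sum of the rotations by 60 and -60 degrees multiplies vectors orthogonal to
  \<open>n\<close> by \<open>2 cos 60 = 1\<close> and vectors along \<open>n\<close> by 2.\<close>

lemma qroot_conj_sum:
  assumes n: "norm n = 1"
  shows "qroot (- n) \<odot> qv a \<odot> qroot n + qroot n \<odot> qv a \<odot> qroot (- n) = qv a + (a \<bullet> n) *\<^sub>R qv n"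
proof -
  have nn: "n \<bullet> n = 1" using n by (simp add: norm_eq_1)
  have nan: "qv n \<odot> qv a \<odot> qv n = qv a - (2 * (a \<bullet> n)) *\<^sub>R qv n"
    by (simp add: qmult_qv qmult.diff_left qmult.scaleR_left cross_skew[of "cross3 n a" n] Lagrange nn inner_commute dot_cross_self
       algebra_simps) (simp add: inner_commute dot_cross_self vec_eq_iff)
  have "qroot (- n) \<odot> qv a \<odot> qroot n + qroot n \<odot> qv a \<odot> qroot (- n) = (3/2) *\<^sub>R qv a - (1/2) *\<^sub>R (qv n \<odot> qv a \<odot> qv n)"
    by (simp add: qroot_def qmult.add_left qmult.add_right qmult.diff_left qmult.diff_right qmult.minus_left qmult.minus_right
       qmult.scaleR_left qmult.scaleR_right algebra_simps) (simp add: vec_eq_iff)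
  then show ?thesis unfolding nan by (simp add: vec_eq_iff algebra_simps)
qed

lemma constant_on_ball:
  fixes f :: "'a::real_normed_vector \<Rightarrow> 'b::real_normed_vector"
  assumes "t \<in> ball t0 r"
    and "\<And>s. s \<in> ball t0 r \<Longrightarrow> (f has_derivative D s) (at s)" "\<And>s X. s \<in> ball t0 r \<Longrightarrow> D s X = 0"
  shows "f t = f t0"
proof (rule has_derivative_zero_unique[OF convex_ball _ assms(1)])
  fix s assume s: "s \<in> ball t0 r"
  have "D s = (\<lambda>_. 0)" using assms(3)[OF s] by auto
  then show "(f has_derivative (\<lambda>h. 0)) (at s within ball t0 r)"
    using assms(2)[OF s] has_derivative_at_withinI by metis
next
  show "t0 \<in> ball t0 r" using assms(1) by (auto intro: le_less_trans[OF zero_le_dist])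
qed

text \<open>\<open>2 cross3 (n t) (mc t X)\<close> is the commutator of \<open>n\<close> and the
  Maurer-Cartan form, which is what the outer factors \<open>p\<close> and \<open>qcnj p\<close>
  contribute with the opposite sign.\<close>

lemma (in S3_map) conj_constant:
  fixes n :: "'a \<Rightarrow> real^3"
  assumes V: "ball t0 r \<subseteq> U" "r > 0"
    and n: "\<And>t. t \<in> ball t0 r \<Longrightarrow> (n has_derivative n' t) (at t)" "norm (n t0) = 1"
    and n': "\<And>t X. t \<in> ball t0 r \<Longrightarrow> n' t X = 2 *\<^sub>R cross3 (n t) (mc t X)"
  obtains m where "norm m = 1" "\<And>t. t \<in> ball t0 r \<Longrightarrow> p t \<odot> qv (n t) \<odot> qcnj (p t) = qv m"
proof -
  let ?N = "\<lambda>t. p t \<odot> qv (n t) \<odot> qcnj (p t)"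
  have N: "?N t = ?N t0" if "t \<in> ball t0 r" for t
  proof (rule constant_on_ball[OF that])
    fix s assume s: "s \<in> ball t0 r"
    then have sU: "s \<in> U" using V by blast
    show "(?N has_derivative (\<lambda>X. p s \<odot> qv (n s) \<odot> qcnj (p' s X) + (p s \<odot> qv (n' s X) + p' s X \<odot> qv (n s)) \<odot> qcnj (p s))) (at s)"
      by (intro qmult.FDERIV bounded_linear.has_derivative[OF bounded_linear_qcnj]
          bounded_linear.has_derivative[OF bounded_linear_qv] deriv n(1) sU s)
    fix X
    have "qv (n' s X) = qv (n s) \<odot> qv (mc s X) - qv (mc s X) \<odot> qv (n s)"
      unfolding qv_commutator n'[OF s] ..
    then show "p s \<odot> qv (n s) \<odot> qcnj (p' s X) + (p s \<odot> qv (n' s X) + p' s X \<odot> qv (n s)) \<odot> qcnj (p s) = 0"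
      by (simp add: p'_eq[OF sU] qcnj_qmult qmult_assoc qmult.minus_left qmult.minus_right qmult.add_left qmult.diff_left qmult.diff_right)
  qed
  have t0: "p t0 \<in> S3" using V S3 centre_in_ball by blast
  show ?thesis
  proof (rule that[of "qim (?N t0)"])
    have "norm (qim (?N t0)) = norm (?N t0)"
      by (subst (2) conj_imag) simp
    then show "norm (qim (?N t0)) = 1" using t0 n(2) by (simp add: norm_qmult S3_iff)
    show "p t \<odot> qv (n t) \<odot> qcnj (p t) = qv (qim (?N t0))" if "t \<in> ball t0 r" for t
      using N[OF that] conj_imag by metis
  qed
qed

locale S3_pair = P: S3_map U p p' p'' + Q: S3_map U q q' q''
  for U :: "(real^3) set" and p p' p'' q q' q'' +
  fixes n :: "real^3 \<Rightarrow> real^3" and n' :: "real^3 \<Rightarrow> real^3 \<Rightarrow> real^3"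
  assumes n_deriv: "t \<in> U \<Longrightarrow> (n has_derivative n' t) (at t)"
    and frame: "t \<in> U \<Longrightarrow> \<exists>u v w a x y. adapted_frame (P.mc t) (Q.mc t) (n t) u v w a x y"
begin

abbreviation A where "A t X \<equiv> P.mc t X \<bullet> n t"
abbreviation B where "B t X \<equiv> Q.mc t X \<bullet> n t"

lemma norm_n: "t \<in> U \<Longrightarrow> norm (n t) = 1"
  using frame adapted_frame.norm_n by metis

lemma dA: "t \<in> U \<Longrightarrow> ((\<lambda>s. A s X) has_derivative (\<lambda>Y. P.dmc t X Y \<bullet> n t + P.mc t X \<bullet> n' t Y)) (at t)"
  by (rule has_derivative_eq_rhs, rule has_derivative_inner[OF P.mc_deriv n_deriv]) (auto simp: add.commute)

lemma dB: "t \<in> U \<Longrightarrow> ((\<lambda>s. B s X) has_derivative (\<lambda>Y. Q.dmc t X Y \<bullet> n t + Q.mc t X \<bullet> n' t Y)) (at t)"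
  by (rule has_derivative_eq_rhs, rule has_derivative_inner[OF Q.mc_deriv n_deriv]) (auto simp: add.commute)

text \<open>Both identities hold throughout the open set \<open>U\<close>, with the frame of each
  point eliminated. Hence their derivatives vanish, and these may be read in the given frame at
  \<open>t\<close>.\<close>

lemma frame_structure_at:
  assumes t: "t \<in> U" and fr: "adapted_frame (P.mc t) (Q.mc t) (n t) u v w a x y"
  shows "frame_structure (P.mc t) (Q.mc t) (n t) u v w a x y (P.dmc t) (Q.dmc t) (n' t)"
proof -
  have rot: "2 *\<^sub>R P.mc s X - Q.mc s X - sqrt 3 *\<^sub>R cross3 (n s) (Q.mc s X) - (2 * A s X - B s X) *\<^sub>R n s = 0"
    if "s \<in> U" for s X
    using frame[OF that] adapted_frame.rotation_eq by (metis eq_iff_diff_eq_0)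
  have propor: "A s X * B s Y - A s Y * B s X = 0" if s: "s \<in> U" for s X Y
  proof -
    obtain u v w a x y where "adapted_frame (P.mc s) (Q.mc s) (n s) u v w a x y" using frame[OF s] by blast
    note fn = adapted_frame.forms_n[OF this]
    obtain k l where "A s X = k * x \<and> B s X = k * y" "A s Y = l * x \<and> B s Y = l * y"
      using fn[of X] fn[of Y] by blast
    then show ?thesis by simp
  qed
  show ?thesis
  proof (intro frame_structure.intro frame_structure_axioms.intro fr)
    fix X Y Z
    show "P.dmc t X Y - P.dmc t Y X = 2 *\<^sub>R cross3 (P.mc t X) (P.mc t Y)" by (rule P.dmc_antisym[OF t])
    show "Q.dmc t X Y - Q.dmc t Y X = 2 *\<^sub>R cross3 (Q.mc t X) (Q.mc t Y)" by (rule Q.dmc_antisym[OF t])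
    show "linear (n' t)" by (rule has_derivative_linear[OF n_deriv[OF t]])
    have "((\<lambda>s. n s \<bullet> n s - 1) has_derivative (\<lambda>X. n t \<bullet> n' t X + n' t X \<bullet> n t)) (at t)"
      by (auto intro!: derivative_eq_intros n_deriv t)
    from derivative_of_vanishing[OF P.open_U t this]
    show "n' t X \<bullet> n t = 0" using norm_n by (simp add: norm_eq_1 inner_commute)
    let ?f = "\<lambda>s. 2 *\<^sub>R P.mc s X - Q.mc s X - sqrt 3 *\<^sub>R cross3 (n s) (Q.mc s X) - (2 * A s X - B s X) *\<^sub>R n s"
    have "(?f has_derivative (\<lambda>Y. 2 *\<^sub>R P.dmc t X Y - Q.dmc t X Y
        - sqrt 3 *\<^sub>R (cross3 (n t) (Q.dmc t X Y) + cross3 (n' t Y) (Q.mc t X))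
        - ((2 * A t X - B t X) *\<^sub>R n' t Y + (2 * (P.dmc t X Y \<bullet> n t + P.mc t X \<bullet> n' t Y) - (Q.dmc t X Y \<bullet> n t + Q.mc t X \<bullet> n' t Y)) *\<^sub>R n t))) (at t)"
      by (intro has_derivative_diff has_derivative_scaleR_right has_derivative_scaleR has_derivative_mult_right
        cross3.FDERIV P.mc_deriv Q.mc_deriv n_deriv dA dB t)
    from derivative_of_vanishing[OF P.open_U t this rot, of Y]
    show "2 *\<^sub>R P.dmc t X Y - Q.dmc t X Y - sqrt 3 *\<^sub>R (cross3 (n' t Y) (Q.mc t X) + cross3 (n t) (Q.dmc t X Y)) =
      (2 * (P.dmc t X Y \<bullet> n t + P.mc t X \<bullet> n' t Y) - (Q.dmc t X Y \<bullet> n t + Q.mc t X \<bullet> n' t Y)) *\<^sub>R n t + (2 * A t X - B t X) *\<^sub>R n' t Y"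
      by (simp only: add.commute right_minus_eq)
    have "((\<lambda>s. A s X * B s Y - A s Y * B s X) has_derivative
        (\<lambda>Z. A t X * (Q.dmc t Y Z \<bullet> n t + Q.mc t Y \<bullet> n' t Z) + (P.dmc t X Z \<bullet> n t + P.mc t X \<bullet> n' t Z) * B t Y
          - (A t Y * (Q.dmc t X Z \<bullet> n t + Q.mc t X \<bullet> n' t Z) + (P.dmc t Y Z \<bullet> n t + P.mc t Y \<bullet> n' t Z) * B t X))) (at t)"
      by (intro has_derivative_diff has_derivative_mult dA dB t)
    from derivative_of_vanishing[OF P.open_U t this propor, of Z]
    show "(P.dmc t X Z \<bullet> n t + P.mc t X \<bullet> n' t Z) * B t Y + A t X * (Q.dmc t Y Z \<bullet> n t + Q.mc t Y \<bullet> n' t Z) =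
      (P.dmc t Y Z \<bullet> n t + P.mc t Y \<bullet> n' t Z) * B t X + A t Y * (Q.dmc t X Z \<bullet> n t + Q.mc t X \<bullet> n' t Z)"
      by linarith
  qed
qed

lemma AB_relations:
  assumes t: "t \<in> U"
  shows "A t X * B t X * (B t X - A t X) = 0" "A t X * B t Y = A t Y * B t X"
proof -
  obtain u v w a x y where fr: "adapted_frame (P.mc t) (Q.mc t) (n t) u v w a x y" using frame[OF t] by blast
  obtain k l where kl: "A t X = k * x" "B t X = k * y" "A t Y = l * x" "B t Y = l * y"
    using adapted_frame.forms_n[OF fr] by metis
  have "A t X * B t X * (B t X - A t X) = k * k * k * (x * y * (y - x))"
    unfolding kl by (simp add: algebra_simps)
  then show "A t X * B t X * (B t X - A t X) = 0"
    using frame_structure.phase[OF frame_structure_at[OF t fr]] by simp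
  show "A t X * B t Y = A t Y * B t X" unfolding kl by simp
qed

lemma continuous_AB: "continuous_on U (\<lambda>s. A s X)" "continuous_on U (\<lambda>s. B s X)"
  using dA dB P.open_U by (meson has_derivative_continuous continuous_at_imp_continuous_on)+

text \<open>The direction \<open>w\<close> is that of the frame at \<open>t0\<close> and stays
  fixed. Two of the factors \<open>A\<close>, \<open>B\<close>, \<open>B - A\<close> are nonzero on
  it at \<open>t0\<close>, hence nearby, so the third one vanishes nearby; proportionality carries
  this relation to every direction \<open>X\<close>. The pair \<open>(k, l)\<close> represents the
  line of \<open>(x, y)\<close>.\<close>

lemma phase_locally_constant:
  assumes t0: "t0 \<in> U"
  obtains r k l where "r > 0" "ball t0 r \<subseteq> U" "(k, l) \<in> {(1,1), (1,0), (0,1)}"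
    "\<And>t X. t \<in> ball t0 r \<Longrightarrow> l * A t X = k * B t X"
proof -
  obtain u v w a x y where fr: "adapted_frame (P.mc t0) (Q.mc t0) (n t0) u v w a x y" using frame[OF t0] by blast
  have "n t0 \<bullet> n t0 = 1" using norm_n[OF t0] by (simp add: norm_eq_1)
  then have xy: "A t0 w = x" "B t0 w = y" using adapted_frame.al_w[OF fr] adapted_frame.be_w[OF fr] by simp_all
  have nbhd: "\<exists>r>0. ball t0 r \<subseteq> U \<and> (\<forall>t\<in>ball t0 r. f t \<noteq> 0 \<and> g t \<noteq> 0)"
    if fg: "continuous_on U f" "continuous_on U g" "f t0 \<noteq> 0" "g t0 \<noteq> 0" for f g :: "real^3 \<Rightarrow> real"
  proof -
    have "open (U \<inter> (\<lambda>t. f t * g t) -` (- {0}))"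
      by (intro continuous_open_preimage continuous_intros fg P.open_U)
    moreover have "t0 \<in> U \<inter> (\<lambda>t. f t * g t) -` (- {0})" using t0 fg(3,4) by simp
    ultimately obtain r where "r > 0" "ball t0 r \<subseteq> U \<inter> (\<lambda>t. f t * g t) -` (- {0})"
      using openE by blast
    then show ?thesis by (intro exI[of _ r]) auto
  qed
  note cA = continuous_AB(1)[of w] and cB = continuous_AB(2)[of w]
  note cBA = continuous_on_diff[OF cB cA]
  have rel: "A t w * B t w * (B t w - A t w) = 0" "A t w * B t X = A t X * B t w" if "t \<in> U" for t X
    using AB_relations[OF that] by blast+
  have "x = 0 \<and> y \<noteq> 0 \<or> x \<noteq> 0 \<and> y = 0 \<or> x = y \<and> x \<noteq> 0"
    using frame_structure.phase[OF frame_structure_at[OF t0 fr]] adapted_frame.xy[OF fr] by auto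
  then consider "x = 0 \<and> y \<noteq> 0" | "x \<noteq> 0 \<and> y = 0" | "x = y \<and> x \<noteq> 0" by blast
  then show ?thesis
  proof cases
    case 1
    then obtain r where r: "r > 0" "ball t0 r \<subseteq> U" "\<And>t. t \<in> ball t0 r \<Longrightarrow> B t w \<noteq> 0 \<and> B t w - A t w \<noteq> 0"
      using nbhd[OF cB cBA] xy by auto
    show ?thesis
    proof (rule that[of r 0 1])
      fix t X assume t: "t \<in> ball t0 r"
      then have "A t w = 0" using rel(1)[of t] r by auto
      then show "1 * A t X = 0 * B t X" using rel(2)[of t X] r t by auto
    qed (use r in auto)
  next
    case 2
    then obtain r where r: "r > 0" "ball t0 r \<subseteq> U" "\<And>t. t \<in> ball t0 r \<Longrightarrow> A t w \<noteq> 0 \<and> B t w - A t w \<noteq> 0"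
      using nbhd[OF cA cBA] xy by auto
    show ?thesis
    proof (rule that[of r 1 0])
      fix t X assume t: "t \<in> ball t0 r"
      then have "B t w = 0" using rel(1)[of t] r by auto
      then show "0 * A t X = 1 * B t X" using rel(2)[of t X] r t by auto
    qed (use r in auto)
  next
    case 3
    then obtain r where r: "r > 0" "ball t0 r \<subseteq> U" "\<And>t. t \<in> ball t0 r \<Longrightarrow> A t w \<noteq> 0 \<and> B t w \<noteq> 0"
      using nbhd[OF cA cB] xy by auto
    show ?thesis
    proof (rule that[of r 1 1])
      fix t X assume t: "t \<in> ball t0 r"
      then have "B t w = A t w" using rel(1)[of t] r by auto
      then show "1 * A t X = 1 * B t X" using rel(2)[of t X] r t by auto
    qed (use r in auto)
  qed
qed

text \<open>The injectivity claims prepare the use of \<open>p\<close> or \<open>q\<close> as a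
  local coordinate with values in the 3-sphere.\<close>

lemma n'_cases:
  assumes V: "open V" "V \<subseteq> U" "t \<in> V" and kl: "(k, l) \<in> {(1,1), (1,0), (0,1)}"
    and const: "\<And>s X. s \<in> V \<Longrightarrow> l * A s X = k * B s X"
  shows "k = 1 \<Longrightarrow> l = 1 \<Longrightarrow> n' t X = 0" "k = 1 \<Longrightarrow> l = 0 \<Longrightarrow> n' t X = 2 *\<^sub>R cross3 (n t) (P.mc t X)"
    "k = 0 \<Longrightarrow> l = 1 \<Longrightarrow> n' t X = 2 *\<^sub>R cross3 (n t) (Q.mc t X)"
    "k = 1 \<Longrightarrow> inj (P.mc t)" "k = 0 \<Longrightarrow> inj (Q.mc t)"
proof -
  have t: "t \<in> U" using V by blast
  obtain u v w a x y where fr: "adapted_frame (P.mc t) (Q.mc t) (n t) u v w a x y" using frame[OF t] by blast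
  interpret frame_structure "P.mc t" "Q.mc t" "n t" u v w a x y "P.dmc t" "Q.dmc t" "n' t"
    by (rule frame_structure_at[OF t fr])
  have dw: "n' t w = 0"
  proof (rule dn_w)
    fix X Z
    have "((\<lambda>s. l * A s X - k * B s X) has_derivative
       (\<lambda>Y. l * (P.dmc t X Y \<bullet> n t + P.mc t X \<bullet> n' t Y) - k * (Q.dmc t X Y \<bullet> n t + Q.mc t X \<bullet> n' t Y))) (at t)"
      by (intro has_derivative_diff has_derivative_mult_right dA dB t)
    from derivative_of_vanishing[OF V(1,3) this, of Z] const
    show "l * (P.dmc t X Z \<bullet> n t + P.mc t X \<bullet> n' t Z) = k * (Q.dmc t X Z \<bullet> n t + Q.mc t X \<bullet> n' t Z)"
      by simp
  qed (use kl in auto)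
  have lk: "l * x = k * y" using const[OF V(3), of w] by (simp add: al_w be_w inner_frame)
  show "n' t X = 0" if "k = 1" "l = 1" using dn_cases(1)[OF dw] lk that by simp
  show "n' t X = 2 *\<^sub>R cross3 (n t) (P.mc t X)" if "k = 1" "l = 0" using dn_cases(2)[OF dw] lk that by simp
  show "n' t X = 2 *\<^sub>R cross3 (n t) (Q.mc t X)" if "k = 0" "l = 1" using dn_cases(3)[OF dw] lk that by simp
  show "inj (P.mc t)" if "k = 1"
    using al_injective lk xy that kl by (auto simp: linear_injective_0[OF linear_al])
  show "inj (Q.mc t)" if "k = 0"
    using be_injective lk xy that kl by (auto simp: linear_injective_0[OF linear_be])
qed

lemma rotation_relation:
  assumes t: "t \<in> U"
  shows "qroot (n t) \<odot> qv (Q.mc t X) - qv (P.mc t X) \<odot> qroot (n t) = (B t X - A t X) *\<^sub>R (qroot (n t) \<odot> qv (n t))"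
  using qroot_rotation[OF norm_n[OF t]] frame[OF t] adapted_frame.rotation_eq by blast

lemma qroot_inverse:
  assumes t: "t \<in> U"
  shows "qroot (n t) \<odot> qroot (- n t) = qone" "qroot (- n t) \<odot> qroot (n t) = qone"
  using S3_cnj[OF qroot_S3[OF norm_n[OF t]]] by (simp_all add: qcnj_qroot)

lemma qroot_inverse_assoc:
  assumes t: "t \<in> U"
  shows "qroot (n t) \<odot> (qroot (- n t) \<odot> z) = z" "qroot (- n t) \<odot> (qroot (n t) \<odot> z) = z"
  using qroot_inverse[OF t] by (simp_all flip: qmult_assoc)

lemma qroot_commute: "qroot (n t) \<odot> qv (n t) = qv (n t) \<odot> qroot (n t)"
  by (simp add: qroot_def qmult.add_left qmult.add_right qmult.scaleR_left qmult.scaleR_right)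

lemma qroot_commutator: "qroot m \<odot> qv a - qv a \<odot> qroot m = qv (cross3 m a)"
  using qv_commutator[of m a]
  by (simp add: qroot_def qmult.add_left qmult.add_right qmult.scaleR_left qmult.scaleR_right flip: scaleR_diff_right)

text \<open>For \<open>h = qroot (n t)\<close>, the rotation relation with \<open>B = 0\<close>
  gives \<open>\<beta> = h\<^sup>-\<^sup>1 \<alpha> h - A n\<close>, which
  \<open>qroot_conj_sum\<close> rewrites as \<open>\<alpha> - h \<alpha> h\<^sup>-\<^sup>1\<close>.
  In this form \<open>\<beta> h\<close> cancels the derivative of \<open>h\<close> in that of
  \<open>q h\<close>.\<close>

lemma be_of_al:
  assumes t: "t \<in> U" and B: "B t X = 0"
  shows "qv (Q.mc t X) \<odot> qroot (n t) = qv (P.mc t X) \<odot> qroot (n t) - qroot (n t) \<odot> qv (P.mc t X)"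
proof -
  let ?h = "qroot (n t)" and ?h' = "qroot (- n t)" and ?a = "qv (P.mc t X)" and ?b = "qv (Q.mc t X)"
  have "?b - ?h' \<odot> ?a \<odot> ?h = ?h' \<odot> (?h \<odot> ?b - ?a \<odot> ?h)"
    by (simp add: qmult.diff_right qroot_inverse_assoc[OF t] qmult_assoc)
  also have "\<dots> = - A t X *\<^sub>R qv (n t)"
    unfolding rotation_relation[OF t] B by (simp add: qmult.scaleR_right qmult.minus_right qroot_inverse_assoc[OF t])
  finally have "?b = ?h' \<odot> ?a \<odot> ?h - A t X *\<^sub>R qv (n t)" by (simp add: algebra_simps)
  also have "\<dots> = (?h' \<odot> ?a \<odot> ?h + ?h \<odot> ?a \<odot> ?h') - A t X *\<^sub>R qv (n t) - ?h \<odot> ?a \<odot> ?h'" by simp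
  also have "\<dots> = ?a - ?h \<odot> ?a \<odot> ?h'" unfolding qroot_conj_sum[OF norm_n[OF t]] by simp
  finally have "?b = ?a - ?h \<odot> ?a \<odot> ?h'" .
  then have "?b \<odot> ?h = ?a \<odot> ?h - ?h \<odot> ?a \<odot> ?h' \<odot> ?h" by (simp add: qmult.diff_left)
  then show ?thesis by (simp add: qmult_assoc qroot_inverse[OF t])
qed

text \<open>The mirror image of \<open>be_of_al\<close>, with \<open>p\<close> and \<open>q\<close>
  exchanged and \<open>n\<close> replaced by \<open>-n\<close>.\<close>

lemma al_of_be:
  assumes t: "t \<in> U" and A: "A t X = 0"
  shows "qv (P.mc t X) \<odot> qroot (- n t) = qv (Q.mc t X) \<odot> qroot (- n t) - qroot (- n t) \<odot> qv (Q.mc t X)"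
proof -
  let ?h = "qroot (n t)" and ?h' = "qroot (- n t)" and ?a = "qv (P.mc t X)" and ?b = "qv (Q.mc t X)"
  have "?h \<odot> ?b \<odot> ?h' - ?a = (?h \<odot> ?b - ?a \<odot> ?h) \<odot> ?h'"
    by (simp add: qmult.diff_left qroot_inverse[OF t] qmult_assoc)
  also have "\<dots> = B t X *\<^sub>R qv (n t)"
    unfolding rotation_relation[OF t] A unfolding qroot_commute
    by (simp add: qmult.scaleR_left qmult_assoc qroot_inverse[OF t])
  finally have "?a = ?h \<odot> ?b \<odot> ?h' - B t X *\<^sub>R qv (n t)" by (simp add: algebra_simps)
  also have "\<dots> = (?h' \<odot> ?b \<odot> ?h + ?h \<odot> ?b \<odot> ?h') - B t X *\<^sub>R qv (n t) - ?h' \<odot> ?b \<odot> ?h" by simp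
  also have "\<dots> = ?b - ?h' \<odot> ?b \<odot> ?h" unfolding qroot_conj_sum[OF norm_n[OF t]] by simp
  finally have "?a = ?b - ?h' \<odot> ?b \<odot> ?h" .
  then have "?a \<odot> ?h' = ?b \<odot> ?h' - ?h' \<odot> ?b \<odot> ?h \<odot> ?h'" by (simp add: qmult.diff_left)
  then show ?thesis by (simp add: qmult_assoc qroot_inverse[OF t])
qed

lemma qroot_deriv: "t \<in> U \<Longrightarrow> ((\<lambda>s. qroot (n s)) has_derivative (\<lambda>X. (1/2) *\<^sub>R qv (n' t X))) (at t)"
  "t \<in> U \<Longrightarrow> ((\<lambda>s. qroot (- n s)) has_derivative (\<lambda>X. - ((1/2) *\<^sub>R qv (n' t X)))) (at t)"
  unfolding qroot_def
  by (auto intro!: derivative_eq_intros bounded_linear.has_derivative[OF bounded_linear_qv] n_deriv)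

text \<open>With \<open>h = qroot n\<close>, the constants of integration are
  \<open>p h q\<^sup>-\<^sup>1\<close>, \<open>q h\<close> and \<open>p h\<^sup>-\<^sup>1\<close> in
  the three cases. The constancy of \<open>n\<close>, or of its conjugate by \<open>p\<close> or
  \<open>q\<close>, then eliminates \<open>n\<close>.\<close>

lemma local_rigidity:
  assumes t0: "t0 \<in> U"
  obtains r m e where "r > 0" "ball t0 r \<subseteq> U" "norm m = 1" "e \<in> S3"
    "(\<forall>t\<in>ball t0 r. inj (P.mc t) \<and> q t = e \<odot> p t \<odot> qroot m) \<or>
     (\<forall>t\<in>ball t0 r. inj (P.mc t) \<and> q t = e \<odot> qcnj (p t) \<odot> qroot m \<odot> p t) \<or>
     (\<forall>t\<in>ball t0 r. inj (Q.mc t) \<and> p t = e \<odot> qcnj (q t) \<odot> qroot m \<odot> q t)"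
proof -
  obtain r k l where r: "r > 0" "ball t0 r \<subseteq> U" and kl: "(k, l) \<in> {(1,1), (1,0), (0,1)}"
    and const: "\<And>t X. t \<in> ball t0 r \<Longrightarrow> l * A t X = k * B t X"
    using phase_locally_constant[OF t0] by metis
  have cases: "k = 1 \<Longrightarrow> l = 1 \<Longrightarrow> n' t X = 0" "k = 1 \<Longrightarrow> l = 0 \<Longrightarrow> n' t X = 2 *\<^sub>R cross3 (n t) (P.mc t X)"
    "k = 0 \<Longrightarrow> l = 1 \<Longrightarrow> n' t X = 2 *\<^sub>R cross3 (n t) (Q.mc t X)"
    "k = 1 \<Longrightarrow> inj (P.mc t)" "k = 0 \<Longrightarrow> inj (Q.mc t)" if "t \<in> ball t0 r" for t X
    by (rule n'_cases[OF open_ball r(2) that kl const]; assumption)+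
  have U: "t \<in> U" if "t \<in> ball t0 r" for t using that r by blast
  have "k = 1 \<and> l = 1 \<or> k = 1 \<and> l = 0 \<or> k = 0 \<and> l = 1" using kl by auto
  then consider "k = 1" "l = 1" | "k = 1" "l = 0" | "k = 0" "l = 1" by blast
  then show ?thesis
  proof cases
    case 1
    have nt: "n t = n t0" if "t \<in> ball t0 r" for t
      by (rule constant_on_ball[OF that n_deriv[OF U]]) (assumption, rule cases(1)[OF _ 1])
    define h where "h = qroot (n t0)"
    have hS: "h \<in> S3" using norm_n[OF t0] by (simp add: h_def qroot_S3)
    define e where "e = p t0 \<odot> h \<odot> qcnj (q t0)"
    have e: "p t \<odot> h \<odot> qcnj (q t) = e" if "t \<in> ball t0 r" for t
      unfolding e_def
    proof (rule constant_on_ball[OF that])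
      fix s assume s: "s \<in> ball t0 r"
      show "((\<lambda>s. p s \<odot> h \<odot> qcnj (q s)) has_derivative (\<lambda>X. p s \<odot> h \<odot> qcnj (q' s X) + p' s X \<odot> h \<odot> qcnj (q s))) (at s)"
        by (intro qmult.FDERIV bounded_linear.has_derivative[OF bounded_linear_qcnj]
          bounded_linear.has_derivative[OF qmult.bounded_linear_left] P.deriv Q.deriv U s)
      fix X
      have "B s X = A s X" using const[OF s] 1 by simp
      then have "qv (P.mc s X) \<odot> h = h \<odot> qv (Q.mc s X)"
        using rotation_relation[OF U[OF s], of X] nt[OF s] by (simp add: h_def)
      then have "qv (P.mc s X) \<odot> (h \<odot> qcnj (q s)) = h \<odot> (qv (Q.mc s X) \<odot> qcnj (q s))"
        by (simp flip: qmult_assoc)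
      then show "p s \<odot> h \<odot> qcnj (q' s X) + p' s X \<odot> h \<odot> qcnj (q s) = 0"
        by (simp add: P.p'_eq[OF U[OF s]] Q.p'_eq[OF U[OF s]] qcnj_qmult qmult_assoc qmult.minus_left qmult.minus_right)
    qed
    show ?thesis
    proof (rule that[OF r norm_n[OF t0], of "qcnj e"])
      show "qcnj e \<in> S3" using hS P.S3[OF t0] Q.S3[OF t0] by (auto simp: e_def)
      have "q t = qcnj e \<odot> p t \<odot> h" if "t \<in> ball t0 r" for t
        unfolding e[OF that, symmetric] using hS P.S3[OF U[OF that]] Q.S3[OF U[OF that]]
        by (simp add: qcnj_qmult qmult_assoc S3_cnj_assoc S3_cnj)
      then show "(\<forall>t\<in>ball t0 r. inj (P.mc t) \<and> q t = qcnj e \<odot> p t \<odot> qroot (n t0)) \<or>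
     (\<forall>t\<in>ball t0 r. inj (P.mc t) \<and> q t = qcnj e \<odot> qcnj (p t) \<odot> qroot (n t0) \<odot> p t) \<or>
     (\<forall>t\<in>ball t0 r. inj (Q.mc t) \<and> p t = qcnj e \<odot> qcnj (q t) \<odot> qroot (n t0) \<odot> q t)"
        using cases(4) 1 by (simp add: h_def)
    qed
  next
    case 2
    obtain m where m: "norm m = 1" "\<And>t. t \<in> ball t0 r \<Longrightarrow> p t \<odot> qv (n t) \<odot> qcnj (p t) = qv m"
      by (rule P.conj_constant[OF r(2,1) n_deriv[OF U] norm_n[OF t0] cases(2)[OF _ 2]]) (assumption+, blast)
    define e where "e = q t0 \<odot> qroot (n t0)"
    have e: "q t \<odot> qroot (n t) = e" if "t \<in> ball t0 r" for t
      unfolding e_def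
    proof (rule constant_on_ball[OF that])
      fix s assume s: "s \<in> ball t0 r"
      show "((\<lambda>s. q s \<odot> qroot (n s)) has_derivative (\<lambda>X. q s \<odot> ((1/2) *\<^sub>R qv (n' s X)) + q' s X \<odot> qroot (n s))) (at s)"
        by (intro qmult.FDERIV Q.deriv U s qroot_deriv)
      fix X
      have "B s X = 0" using const[OF s, of X] 2 by simp
      then have "qv (Q.mc s X) \<odot> qroot (n s) = - qv (cross3 (n s) (P.mc s X))"
        unfolding qroot_commutator[of "n s" "P.mc s X", symmetric] using be_of_al[OF U[OF s], of X] by simp
      then show "q s \<odot> ((1/2) *\<^sub>R qv (n' s X)) + q' s X \<odot> qroot (n s) = 0"
        by (simp add: cases(2)[OF s 2] Q.p'_eq[OF U[OF s]] qmult_assoc qmult.minus_right)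
    qed
    show ?thesis
    \<comment> \<open>Here \<open>q = e h\<^sup>-\<^sup>1\<close>, and inverting
      \<open>qroot m\<close> changes the sign of \<open>m\<close>.\<close>
    proof (rule that[OF r, of "- m" e])
      show "e \<in> S3" using qroot_S3[OF norm_n[OF t0]] Q.S3[OF t0] by (auto simp: e_def)
      have "q t = e \<odot> qcnj (p t) \<odot> qroot (- m) \<odot> p t" if "t \<in> ball t0 r" for t
      proof -
        have conj: "p t \<odot> qroot (- n t) \<odot> qcnj (p t) = qroot (- m)"
          using m(2)[OF that] P.S3[OF U[OF that]] by (simp add: qroot_conj qmult.minus_left qmult.minus_right) (simp add: qroot_def)
        then have "qcnj (p t) \<odot> qroot (- m) \<odot> p t = qroot (- n t)"
          unfolding conj[symmetric] using P.S3[OF U[OF that]] by (simp add: qmult_assoc S3_cnj_assoc S3_cnj)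
        then show ?thesis
          unfolding e[OF that, symmetric] by (simp add: qmult_assoc qroot_inverse[OF U[OF that]])
      qed
      then show "(\<forall>t\<in>ball t0 r. inj (P.mc t) \<and> q t = e \<odot> p t \<odot> qroot (- m)) \<or>
     (\<forall>t\<in>ball t0 r. inj (P.mc t) \<and> q t = e \<odot> qcnj (p t) \<odot> qroot (- m) \<odot> p t) \<or>
     (\<forall>t\<in>ball t0 r. inj (Q.mc t) \<and> p t = e \<odot> qcnj (q t) \<odot> qroot (- m) \<odot> q t)"
        using cases(4) 2 by simp
    qed (simp add: m)
  next
    case 3
    obtain m where m: "norm m = 1" "\<And>t. t \<in> ball t0 r \<Longrightarrow> q t \<odot> qv (n t) \<odot> qcnj (q t) = qv m"
      by (rule Q.conj_constant[OF r(2,1) n_deriv[OF U] norm_n[OF t0] cases(3)[OF _ 3]]) (assumption+, blast)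
    define e where "e = p t0 \<odot> qroot (- n t0)"
    have e: "p t \<odot> qroot (- n t) = e" if "t \<in> ball t0 r" for t
      unfolding e_def
    proof (rule constant_on_ball[OF that])
      fix s assume s: "s \<in> ball t0 r"
      show "((\<lambda>s. p s \<odot> qroot (- n s)) has_derivative (\<lambda>X. p s \<odot> (- ((1/2) *\<^sub>R qv (n' s X))) + p' s X \<odot> qroot (- n s))) (at s)"
        by (intro qmult.FDERIV P.deriv U s qroot_deriv)
      fix X
      have "A s X = 0" using const[OF s, of X] 3 by simp
      then have "qv (P.mc s X) \<odot> qroot (- n s) = qv (cross3 (n s) (Q.mc s X))"
        using al_of_be[OF U[OF s], of X] qroot_commutator[of "- n s" "Q.mc s X"] by (metis cross3.minus_left minus_diff_eq minus_minus qv_simps(5))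
      then show "p s \<odot> (- ((1/2) *\<^sub>R qv (n' s X))) + p' s X \<odot> qroot (- n s) = 0"
        by (simp add: cases(3)[OF s 3] P.p'_eq[OF U[OF s]] qmult_assoc qmult.minus_right)
    qed
    show ?thesis
    proof (rule that[OF r, of m e])
      show "e \<in> S3" using qroot_S3[of "- n t0"] norm_n[OF t0] P.S3[OF t0] by (auto simp: e_def)
      have "p t = e \<odot> qcnj (q t) \<odot> qroot m \<odot> q t" if "t \<in> ball t0 r" for t
      proof -
        have conj: "q t \<odot> qroot (n t) \<odot> qcnj (q t) = qroot m"
          using m(2)[OF that] Q.S3[OF U[OF that]] by (simp add: qroot_conj) (simp add: qroot_def)
        then have "qcnj (q t) \<odot> qroot m \<odot> q t = qroot (n t)"
          unfolding conj[symmetric] using Q.S3[OF U[OF that]] by (simp add: qmult_assoc S3_cnj_assoc S3_cnj)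
        then show ?thesis
          unfolding e[OF that, symmetric] by (simp add: qmult_assoc qroot_inverse[OF U[OF that]])
      qed
      then show "(\<forall>t\<in>ball t0 r. inj (P.mc t) \<and> q t = e \<odot> p t \<odot> qroot m) \<or>
     (\<forall>t\<in>ball t0 r. inj (P.mc t) \<and> q t = e \<odot> qcnj (p t) \<odot> qroot m \<odot> p t) \<or>
     (\<forall>t\<in>ball t0 r. inj (Q.mc t) \<and> p t = e \<odot> qcnj (q t) \<odot> qroot m \<odot> q t)"
        using cases(5) 3 by simp
    qed (simp add: m)
  qed
qed

end

section \<open>Tangent spaces of submanifolds\<close>

text \<open>The parameter change \<tau> is merely continuous. A left inverse of \<open>G'\<close>
  bounds increments of \<tau> by those of \<open>G \<circ> \<tau> = F\<close>, so \<tau> is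
  Lipschitz at \<open>t\<close>, and then the remainder of \<open>G\<close> is negligible along
  \<tau>.\<close>

lemma range_derivative_through_immersion:
  fixes F :: "'a::real_normed_vector \<Rightarrow> 'b::euclidean_space" and G :: "'c::euclidean_space \<Rightarrow> 'b"
  assumes F: "(F has_derivative F') (at t)" and G: "(G has_derivative G') (at (\<tau> t))" and inj: "inj G'"
    and cont: "isCont \<tau> t" and W: "open W" "t \<in> W" and eq: "\<And>r. r \<in> W \<Longrightarrow> G (\<tau> r) = F r"
  shows "range F' \<subseteq> range G'"
proof -
  have linG: "linear G'" by (rule has_derivative_linear[OF G])
  obtain L where L: "linear L" "L \<circ> G' = id"
    using linear_injective_left_inverse[OF linG inj] by blast
  have blL: "bounded_linear L" using L(1) by (simp add: linear_conv_bounded_linear)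
  have blG: "bounded_linear G'" using G has_derivative_bounded_linear by blast
  \<comment> \<open>\<open>Q\<close> has kernel \<open>range G'\<close>, and \<open>Q \<circ> F\<close> turns out to have derivative 0 at \<open>t\<close>.\<close>
  define Q where "Q y = y - G' (L y)" for y
  have blQ: "bounded_linear Q"
    unfolding Q_def by (intro bounded_linear_sub bounded_linear_ident bounded_linear_compose[OF blG blL])
  have LG: "L (G' y) = y" for y using L(2) by (metis comp_apply id_apply)
  have QG: "Q (G' y) = 0" for y by (simp add: Q_def LG)
  obtain KL where KL: "KL > 0" "\<And>y. norm (L y) \<le> norm y * KL" using bounded_linear.pos_bounded[OF blL] by blast
  obtain KQ where KQ: "KQ > 0" "\<And>y. norm (Q y) \<le> norm y * KQ" using bounded_linear.pos_bounded[OF blQ] by blast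
  have blF: "bounded_linear F'" using F has_derivative_bounded_linear by blast
  obtain KF where KF: "KF > 0" "\<And>y. norm (F' y) \<le> norm y * KF" using bounded_linear.pos_bounded[OF blF] by blast
  have "((\<lambda>r. Q (F r)) has_derivative (\<lambda>_. 0)) (at t)"
    unfolding has_derivative_at_alt
  proof (intro conjI allI impI)
    fix e :: real assume e: "e > 0"
    \<comment> \<open>The first bound lets half of \<open>norm v\<close> be absorbed in the estimate
      of \<open>v\<close>; the second keeps the final product of constants below
      \<open>e\<close>.\<close>
    define e' where "e' = min (1 / (2 * KL)) (e / (2 * KQ * KL * (KF + 1)))"
    have e': "e' > 0" "e' * KL \<le> 1/2" "KQ * e' * (2 * KL) * (KF + 1) \<le> e"
    proof -
      show "e' > 0" using e KL KQ KF by (simp add: e'_def)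
      have "e' \<le> 1 / (2 * KL)" by (simp add: e'_def)
      then show "e' * KL \<le> 1/2" using KL(1) by (simp add: field_simps)
      have "e' \<le> e / (2 * KQ * KL * (KF + 1))" by (simp add: e'_def)
      then show "KQ * e' * (2 * KL) * (KF + 1) \<le> e" using KL(1) KQ(1) KF(1) by (simp add: pos_le_divide_eq mult_ac)
    qed
    obtain d1 where d1: "d1 > 0" "\<And>y. norm (y - \<tau> t) < d1 \<Longrightarrow> norm (G y - G (\<tau> t) - G' (y - \<tau> t)) \<le> e' * norm (y - \<tau> t)"
      using G e'(1) unfolding has_derivative_at_alt by blast
    obtain d2 where d2: "d2 > 0" "\<And>y. norm (y - t) < d2 \<Longrightarrow> norm (F y - F t - F' (y - t)) \<le> 1 * norm (y - t)"
      using F unfolding has_derivative_at_alt by (meson zero_less_one)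
    obtain d3 where d3: "d3 > 0" "\<And>r. dist r t < d3 \<Longrightarrow> dist (\<tau> r) (\<tau> t) < d1"
      using cont d1(1) unfolding continuous_at_eps_delta by blast
    obtain d4 where d4: "d4 > 0" "ball t d4 \<subseteq> W" using W openE by blast
    show "\<exists>d>0. \<forall>y. norm (y - t) < d \<longrightarrow> norm (Q (F y) - Q (F t) - 0) \<le> e * norm (y - t)"
    proof (intro exI[of _ "min d2 (min d3 d4)"] conjI allI impI)
      fix r assume r: "norm (r - t) < min d2 (min d3 d4)"
      define v where "v = \<tau> r - \<tau> t"
      define R where "R = G (\<tau> r) - G (\<tau> t) - G' v"
      have "r \<in> W" using r d4(2) by (auto simp: dist_norm norm_minus_commute subset_iff)
      then have GF: "G (\<tau> r) = F r" "G (\<tau> t) = F t" using eq W(2) by auto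
      have "norm v < d1" using d3(2)[of r] r by (simp add: v_def dist_norm)
      then have R: "norm R \<le> e' * norm v" using d1(2)[of "\<tau> r"] by (simp add: v_def R_def)
      have "v = L (F r - F t) - L R"
        unfolding R_def GF using linear_diff[OF L(1)] LG by simp
      then have "norm v \<le> norm (L (F r - F t)) + norm (L R)" by (metis norm_triangle_ineq4)
      also have "\<dots> \<le> norm (F r - F t) * KL + norm R * KL" by (intro add_mono KL(2))
      also have "\<dots> \<le> norm (F r - F t) * KL + (e' * norm v) * KL"
        using R KL(1) by (intro add_left_mono mult_right_mono) auto
      also have "\<dots> \<le> norm (F r - F t) * KL + 1/2 * norm v"
        using mult_right_mono[OF e'(2) norm_ge_zero[of v]] by (simp add: mult_ac)
      finally have v: "norm v \<le> 2 * KL * norm (F r - F t)" by (simp add: mult_ac)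
      have "norm (F r - F t) \<le> norm (F r - F t - F' (r - t)) + norm (F' (r - t))"
        by (metis diff_add_cancel norm_triangle_ineq)
      also have "\<dots> \<le> norm (r - t) + norm (r - t) * KF" using d2(2)[of r] r KF(2)[of "r - t"] by simp
      finally have Fr: "norm (F r - F t) \<le> (KF + 1) * norm (r - t)" by (simp add: algebra_simps)
      have "Q (F r) - Q (F t) = Q (G' v + R)"
        using linear_diff[OF bounded_linear.linear[OF blQ], of "F r" "F t"] by (simp add: R_def GF)
      also have "\<dots> = Q R" using linear_add[OF bounded_linear.linear[OF blQ]] QG by simp
      finally have "norm (Q (F r) - Q (F t) - 0) \<le> norm R * KQ" using KQ(2) by simp
      also have "\<dots> \<le> (e' * norm v) * KQ" using R KQ(1) by (intro mult_right_mono) auto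
      also have "\<dots> \<le> (e' * (2 * KL * norm (F r - F t))) * KQ"
        using v KQ(1) e'(1) by (intro mult_right_mono mult_left_mono) auto
      also have "\<dots> = (KQ * e' * (2 * KL)) * norm (F r - F t)" by (simp add: mult_ac)
      also have "\<dots> \<le> (KQ * e' * (2 * KL)) * ((KF + 1) * norm (r - t))"
        using Fr KL(1) KQ(1) e'(1) by (intro mult_left_mono) auto
      also have "\<dots> = (KQ * e' * (2 * KL) * (KF + 1)) * norm (r - t)" by (simp add: mult_ac)
      also have "\<dots> \<le> e * norm (r - t)" using e'(3) by (intro mult_right_mono) auto
      finally show "norm (Q (F r) - Q (F t) - 0) \<le> e * norm (r - t)" .
    qed (use d2(1) d3(1) d4(1) in auto)
  qed simp
  moreover have "((\<lambda>r. Q (F r)) has_derivative (\<lambda>X. Q (F' X))) (at t)"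
    by (rule bounded_linear.has_derivative[OF blQ F])
  ultimately have "(\<lambda>X. Q (F' X)) = (\<lambda>_. 0)" by (metis has_derivative_unique)
  then have "F' X = G' (L (F' X))" for X unfolding Q_def by (metis eq_iff_diff_eq_0)
  then show ?thesis by blast
qed

text \<open>\<open>tangentM\<close> is a union over all parametrizations through the point, so even
  its linearity depends on comparing two of them. Their transition map
  \<open>g \<circ> \<psi>\<close> is continuous because both are homeomorphisms onto open
  sets.\<close>

lemma tangentM_param:
  assumes \<phi>: "local_param M \<iota> U \<phi>" and t: "t \<in> U"
  shows "tangentM M \<iota> (\<phi> t) = range (frechet_derivative (\<iota> \<circ> \<phi>) (at t))"
proof
  show "range (frechet_derivative (\<iota> \<circ> \<phi>) (at t)) \<subseteq> tangentM M \<iota> (\<phi> t)"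
    using assms unfolding tangentM_def by blast
  show "tangentM M \<iota> (\<phi> t) \<subseteq> range (frechet_derivative (\<iota> \<circ> \<phi>) (at t))"
  proof
    fix z assume "z \<in> tangentM M \<iota> (\<phi> t)"
    then obtain V \<psi> s where \<psi>: "local_param M \<iota> V \<psi>" and s: "s \<in> V" "\<psi> s = \<phi> t"
      and z: "z \<in> range (frechet_derivative (\<iota> \<circ> \<psi>) (at s))"
      unfolding tangentM_def by blast
    have U: "open U" "openin M (\<phi> ` U)" "smooth_on U (\<iota> \<circ> \<phi>)" "inj (frechet_derivative (\<iota> \<circ> \<phi>) (at t))"
      and hom: "homeomorphic_map (top_of_set U) (subtopology M (\<phi> ` U)) \<phi>"
      using \<phi> t by (auto simp: local_param_def)
    have V: "open V" "smooth_on V (\<iota> \<circ> \<psi>)" and hom': "homeomorphic_map (top_of_set V) (subtopology M (\<psi> ` V)) \<psi>"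
      using \<psi> by (auto simp: local_param_def)
    obtain g where g: "homeomorphic_maps (top_of_set U) (subtopology M (\<phi> ` U)) \<phi> g"
      using hom by (auto simp: homeomorphic_map_maps)
    have g\<phi>: "g (\<phi> r) = r" if "r \<in> U" for r
      using g that by (simp add: homeomorphic_maps_def)
    have gc: "continuous_map (subtopology M (\<phi> ` U)) (top_of_set U) g"
      using g by (simp add: homeomorphic_maps_def)
    have \<psi>c: "continuous_map (top_of_set V) M \<psi>"
      using hom' by (meson continuous_map_into_fulltopology homeomorphic_imp_continuous_map)
    define W where "W = {r \<in> V. \<psi> r \<in> \<phi> ` U}"
    have "openin (top_of_set V) W"
      using openin_continuous_map_preimage[OF \<psi>c U(2)] by (simp add: W_def)
    then have W: "open W" using V(1) by (simp add: openin_open_eq)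
    have sW: "s \<in> W" using s t by (auto simp: W_def)
    have "continuous_map (top_of_set W) (subtopology M (\<phi> ` U)) \<psi>"
      using \<psi>c by (auto simp: continuous_map_in_subtopology W_def intro: continuous_map_from_subtopology_mono)
    then have "continuous_map (top_of_set W) (top_of_set U) (g \<circ> \<psi>)"
      using gc continuous_map_compose by blast
    then have "continuous_on W (g \<circ> \<psi>)" by (simp add: continuous_map_in_subtopology)
    then have c: "isCont (g \<circ> \<psi>) s" using W sW by (simp add: continuous_on_eq_continuous_at o_def)
    have gs: "(g \<circ> \<psi>) s = t" using s t g\<phi> by simp
    have "range (frechet_derivative (\<iota> \<circ> \<psi>) (at s)) \<subseteq> range (frechet_derivative (\<iota> \<circ> \<phi>) (at t))"
    proof (rule range_derivative_through_immersion[OF _ _ U(4) c W sW])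
      show "(\<iota> \<circ> \<psi> has_derivative frechet_derivative (\<iota> \<circ> \<psi>) (at s)) (at s)"
        using smooth_on_open_twice_differentiable(1)[OF V s(1)] .
      show "(\<iota> \<circ> \<phi> has_derivative frechet_derivative (\<iota> \<circ> \<phi>) (at t)) (at ((g \<circ> \<psi>) s))"
        unfolding gs using smooth_on_open_twice_differentiable(1)[OF U(1,3) t] .
      show "(\<iota> \<circ> \<phi>) ((g \<circ> \<psi>) r) = (\<iota> \<circ> \<psi>) r" if "r \<in> W" for r
        using that g\<phi> by (auto simp: W_def)
    qed
    then show "z \<in> range (frechet_derivative (\<iota> \<circ> \<phi>) (at t))" using z by blast
  qed
qed

section \<open>One parametrization, read in the left trivialization\<close>

locale param =
  fixes M :: "'m topology" and \<iota> :: "'m \<Rightarrow> quat \<times> quat" and U :: "(real^3) set" and \<phi> :: "real^3 \<Rightarrow> 'm"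
  assumes param: "local_param M \<iota> U \<phi>" and image: "\<iota> ` topspace M \<subseteq> S3S3"
begin

abbreviation F where "F \<equiv> \<iota> \<circ> \<phi>"
abbreviation F' where "F' t \<equiv> frechet_derivative F (at t)"
abbreviation F'' where "F'' t X \<equiv> frechet_derivative (\<lambda>r. F' r X) (at t)"

lemma U: "open U" "openin M (\<phi> ` U)" "smooth_on U F" "t \<in> U \<Longrightarrow> inj (F' t)"
  using param by (auto simp: local_param_def)

lemma \<phi>_top: "t \<in> U \<Longrightarrow> \<phi> t \<in> topspace M"
  using openin_subset[OF U(2)] by blast

lemma F_S3S3: "t \<in> U \<Longrightarrow> F t \<in> S3S3"
  using \<phi>_top image by auto

lemma F_deriv: "t \<in> U \<Longrightarrow> (F has_derivative F' t) (at t)"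
  "t \<in> U \<Longrightarrow> ((\<lambda>r. F' r X) has_derivative F'' t X) (at t)" "t \<in> U \<Longrightarrow> F'' t X Y = F'' t Y X"
  by (rule smooth_on_open_twice_differentiable[OF U(1,3)], assumption)+

lemma S3_map_fst: "S3_map U (\<lambda>t. fst (F t)) (\<lambda>t X. fst (F' t X)) (\<lambda>t X Y. fst (F'' t X Y))"
proof
  fix t X Y assume t: "t \<in> U"
  show "fst (F t) \<in> S3" using F_S3S3[OF t] by (simp add: S3S3_iff)
  show "((\<lambda>t. fst (F t)) has_derivative (\<lambda>X. fst (F' t X))) (at t)"
    by (rule has_derivative_fst[OF F_deriv(1)[OF t]])
  show "((\<lambda>s. fst (F' s X)) has_derivative (\<lambda>Y. fst (F'' t X Y))) (at t)"
    by (rule has_derivative_fst[OF F_deriv(2)[OF t]])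
  show "fst (F'' t X Y) = fst (F'' t Y X)" using F_deriv(3)[OF t, of X Y] by simp
qed (rule U)

lemma S3_map_snd: "S3_map U (\<lambda>t. snd (F t)) (\<lambda>t X. snd (F' t X)) (\<lambda>t X Y. snd (F'' t X Y))"
proof
  fix t X Y assume t: "t \<in> U"
  show "snd (F t) \<in> S3" using F_S3S3[OF t] by (simp add: S3S3_iff)
  show "((\<lambda>t. snd (F t)) has_derivative (\<lambda>X. snd (F' t X))) (at t)"
    by (rule has_derivative_snd[OF F_deriv(1)[OF t]])
  show "((\<lambda>s. snd (F' s X)) has_derivative (\<lambda>Y. snd (F'' t X Y))) (at t)"
    by (rule has_derivative_snd[OF F_deriv(2)[OF t]])
  show "snd (F'' t X Y) = snd (F'' t Y X)" using F_deriv(3)[OF t, of X Y] by simp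
qed (rule U)

sublocale P: S3_map U "\<lambda>t. fst (F t)" "\<lambda>t X. fst (F' t X)" "\<lambda>t X Y. fst (F'' t X Y)"
  by (rule S3_map_fst)
sublocale Q: S3_map U "\<lambda>t. snd (F t)" "\<lambda>t X. snd (F' t X)" "\<lambda>t X Y. snd (F'' t X Y)"
  by (rule S3_map_snd)

text \<open>The tangent space in the left trivialization.\<close>

definition T0 where "T0 t = range (\<lambda>X. (P.mc t X, Q.mc t X))"

lemma F'_linv: "t \<in> U \<Longrightarrow> F' t X = linv (P.mc t X, Q.mc t X) (F t)"
  using P.p'_eq[of t X] Q.p'_eq[of t X] by (simp add: linv_def prod_eq_iff)

lemma tangentM_eq: "t \<in> U \<Longrightarrow> tangentM M \<iota> (\<phi> t) = (\<lambda>u. linv u (F t)) ` T0 t"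
  by (simp add: tangentM_param[OF param] T0_def image_image F'_linv)

lemma linear_mc_pair: "t \<in> U \<Longrightarrow> linear (\<lambda>X. (P.mc t X, Q.mc t X))"
  using P.linear_mc Q.linear_mc by (intro linearI) (simp_all add: linear_add linear_scale)

lemma subspace_T0: "t \<in> U \<Longrightarrow> subspace (T0 t)"
  unfolding T0_def by (rule linear_subspace_image[OF linear_mc_pair subspace_UNIV])

lemma dim_T0: assumes t: "t \<in> U" shows "dim (T0 t) = 3"
proof -
  have "inj (\<lambda>X. (P.mc t X, Q.mc t X))"
    using U(4)[OF t] F'_linv[OF t] by (simp add: inj_def) 
  then show ?thesis
    unfolding T0_def using dim_image_eq[OF linear_mc_pair[OF t], of UNIV] by simp
qed

end

section \<open>Adapted frames of CR submanifolds\<close>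

text \<open>A real eigenvalue \<open>c\<close> of \<open>J\<close> would satisfy
  \<open>c * c = -1\<close>.\<close>

lemma independent_J:
  assumes "v \<noteq> 0" shows "independent {v, linv_J v}" "linv_J v \<noteq> v" "linv_J v \<notin> span {v}"
proof -
  show s: "linv_J v \<notin> span {v}"
  proof
    assume "linv_J v \<in> span {v}"
    then obtain c where c: "linv_J v = c *\<^sub>R v" by (auto simp: span_singleton)
    have "- v = linv_J (linv_J v)" by simp
    also have "\<dots> = (c * c) *\<^sub>R v" by (simp add: c linv_J_simps)
    finally have e: "- v = (c * c) *\<^sub>R v" .
    have "(c * c + 1) *\<^sub>R v = 0" by (simp add: scaleR_add_left flip: e)
    then show False using assms by (smt (verit) scaleR_eq_0_iff zero_le_square)
  qed
  then show "linv_J v \<noteq> v" by (metis insertI1 span_base)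
  show "independent {v, linv_J v}"
    using s assms independent_insert[of "linv_J v" "{v}"] by (simp add: insert_commute)
qed

lemma J_plane_eq_span:
  assumes D: "subspace D" "dim D = 2" "linv_J ` D \<subseteq> D" and v: "v \<in> D" "v \<noteq> 0"
  shows "D = span {v, linv_J v}"
proof -
  have "{v, linv_J v} \<subseteq> D" using D v by auto
  then have sub: "span {v, linv_J v} \<subseteq> D" using D(1) span_minimal by blast
  have "dim (span {v, linv_J v}) = 2"
    using independent_J[OF v(2)] by (simp add: dim_eq_card_independent)
  then show ?thesis using subspace_dim_equal[OF subspace_span D(1) sub] D(2) by simp
qed

text \<open>The orthogonal projection to the plane of \<open>v\<close> and \<open>linv_J v\<close>;
  these are orthogonal and of equal length, hence the common denominator.\<close>

definition J_proj :: "tang \<Rightarrow> tang \<Rightarrow> tang" where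
  "J_proj v u = (linv_g u v / linv_g v v) *\<^sub>R v + (linv_g u (linv_J v) / linv_g v v) *\<^sub>R linv_J v"

lemma J_proj_span: "J_proj v u \<in> span {v, linv_J v}"
  unfolding J_proj_def by (intro span_add span_scale span_base) auto

lemma J_proj_orth:
  assumes "v \<noteq> 0"
  shows "linv_g (u - J_proj v u) v = 0" "linv_g (u - J_proj v u) (linv_J v) = 0"
proof -
  have "linv_g v v \<noteq> 0" using assms linv_g_eq_0 by blast
  then show "linv_g (u - J_proj v u) v = 0" "linv_g (u - J_proj v u) (linv_J v) = 0"
    using linv_g_J_self[of v] linv_g_sym[of v "linv_J v"]
    by (simp_all add: J_proj_def linv_g_simps linv_g_JJ)
qed

lemma linv_g_span_pair:
  assumes "x \<in> span {v, linv_J v}" "linv_g w v = 0" "linv_g w (linv_J v) = 0"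
  shows "linv_g w x = 0"
proof -
  obtain a b where "x = a *\<^sub>R v + b *\<^sub>R linv_J v"
    using assms(1) by (auto simp: span_insert span_singleton) (metis add.commute diff_add_cancel)
  then show ?thesis using assms by (simp add: linv_g_simps)
qed

context param
begin

definition coords0 :: "real^3 \<Rightarrow> (quat \<times> quat) set \<Rightarrow> tang set" where
  "coords0 t D = {u. linv u (F t) \<in> D}"

lemma linv_inj: "t \<in> U \<Longrightarrow> inj (\<lambda>u. linv u (F t))"
  using linv_eq_iff[OF F_S3S3] by (auto simp: inj_def)

lemma coords0_image:
  assumes t: "t \<in> U" and D: "D \<subseteq> tangentM M \<iota> (\<phi> t)"
  shows "D = (\<lambda>u. linv u (F t)) ` coords0 t D" "coords0 t D \<subseteq> T0 t"
  using D linv_eq_iff[OF F_S3S3[OF t]] unfolding coords0_def tangentM_eq[OF t] by auto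

lemma coords0_subspace:
  assumes t: "t \<in> U" and D: "subspace D" "D \<subseteq> tangentM M \<iota> (\<phi> t)"
  shows "subspace (coords0 t D)" "dim (coords0 t D) = dim D"
proof -
  show "subspace (coords0 t D)"
    using linear_subspace_vimage[OF linv_linear D(1)] by (simp add: coords0_def vimage_def)
  have "dim ((\<lambda>u. linv u (F t)) ` coords0 t D) = dim (coords0 t D)"
    by (rule dim_image_eq[OF linv_linear inj_on_subset[OF linv_inj[OF t] subset_UNIV]])
  then show "dim (coords0 t D) = dim D" using coords0_image(1)[OF t D(2)] by simp
qed

lemma coords0_J:
  assumes t: "t \<in> U" and J: "Jst (F t) ` D = D"
  shows "linv_J ` coords0 t D \<subseteq> coords0 t D"
  using J Jst_linv[OF F_S3S3[OF t]] unfolding coords0_def by (auto simp del: comp_apply) (metis imageI)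

lemma complM_linv:
  assumes t: "t \<in> U" and D: "D (\<phi> t) \<subseteq> tangentM M \<iota> (\<phi> t)"
    and w: "w \<in> T0 t" "\<And>x. x \<in> coords0 t (D (\<phi> t)) \<Longrightarrow> linv_g w x = 0"
  shows "linv w (F t) \<in> complM M \<iota> D (\<phi> t)"
proof -
  have "gNK (F t) (linv w (F t)) y = 0" if "y \<in> D (\<phi> t)" for y
  proof -
    have "y \<in> (\<lambda>u. linv u (F t)) ` coords0 t (D (\<phi> t))" using that coords0_image(1)[OF t D] by metis
    then obtain x where "x \<in> coords0 t (D (\<phi> t))" "y = linv x (F t)" by blast
    then show ?thesis using w(2) by (simp only: gNK_linv[OF F_S3S3[OF t]])
  qed
  moreover have "linv w (F t) \<in> tangentM M \<iota> (\<phi> t)"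
    unfolding tangentM_eq[OF t] using w(1) by (rule imageI)
  ultimately show ?thesis by (simp add: complM_def)
qed

text \<open>If \<open>u\<close> and \<open>J u\<close> are tangent and \<open>w\<close> is the part
  of \<open>u\<close> orthogonal to \<open>D\<close>, then \<open>J w\<close> is tangent, and normal
  because the complement is totally real. So \<open>w = 0\<close> and \<open>u\<close> lies in
  \<open>D\<close>.\<close>

lemma D_eq_D1:
  assumes t: "t \<in> U"
    and D: "subspace (D (\<phi> t))" "dim (D (\<phi> t)) = 2" "D (\<phi> t) \<subseteq> tangentM M \<iota> (\<phi> t)"
      "Jst (F t) ` D (\<phi> t) = D (\<phi> t)"
    and perp: "Jst (F t) ` complM M \<iota> D (\<phi> t) \<subseteq> normalM M \<iota> (\<phi> t)"
  shows "D (\<phi> t) = D1 M \<iota> (\<phi> t)"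
proof
  note z = F_S3S3[OF t]
  have Ft: "\<iota> (\<phi> t) = F t" by simp
  show "D (\<phi> t) \<subseteq> D1 M \<iota> (\<phi> t)"
    unfolding D1_def Ft using D(3,4) by blast
  let ?D = "coords0 t (D (\<phi> t))"
  have sub: "subspace ?D" "dim ?D = 2" "linv_J ` ?D \<subseteq> ?D" "?D \<subseteq> T0 t"
    using coords0_subspace[OF t D(1,3)] coords0_J[OF t D(4)] coords0_image(2)[OF t D(3)] D(2) by auto
  obtain v where v: "v \<in> ?D" "v \<noteq> 0"
    using sub(2) by (metis dim_eq_0 subsetI singletonI zero_neq_numeral insertCI)
  note Dspan = J_plane_eq_span[OF sub(1-3) v]
  show "D1 M \<iota> (\<phi> t) \<subseteq> D (\<phi> t)"
  proof
    fix y assume "y \<in> D1 M \<iota> (\<phi> t)"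
    then obtain u where u: "u \<in> T0 t" "y = Jst (F t) (linv u (F t))" "y \<in> tangentM M \<iota> (\<phi> t)"
      unfolding D1_def Ft tangentM_eq[OF t] by blast
    then have y: "y = linv (linv_J u) (F t)" using Jst_linv[OF z] by simp
    obtain u' where "u' \<in> T0 t" "y = linv u' (F t)" using u(3) unfolding tangentM_eq[OF t] by blast
    then have Ju: "linv_J u \<in> T0 t" using y linv_eq_iff[OF z] by metis
    define d where "d = J_proj v u"
    have d: "d \<in> ?D" using J_proj_span Dspan by (simp add: d_def)
    define w where "w = u - d"
    have wT: "w \<in> T0 t" using subspace_diff[OF subspace_T0[OF t] u(1) subsetD[OF sub(4) d]] by (simp add: w_def)
    have w: "linv_g w x = 0" if "x \<in> ?D" for x
      using linv_g_span_pair[OF _ J_proj_orth[OF v(2)]] that Dspan by (simp add: w_def d_def)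
    have "linv w (F t) \<in> complM M \<iota> D (\<phi> t)"
      by (rule complM_linv[where D = D, OF t D(3) wT w])
    then have "linv (linv_J w) (F t) \<in> normalM M \<iota> (\<phi> t)"
      using perp Jst_linv[OF z] by (metis image_subset_iff)
    moreover have "linv (linv_J w) (F t) \<in> tangentM M \<iota> (\<phi> t)"
    proof -
      have "linv_J d \<in> T0 t" using sub d by blast
      then have "linv_J w \<in> T0 t" using Ju subspace_diff[OF subspace_T0[OF t]] by (simp add: w_def linv_J_simps)
      then show ?thesis by (auto simp: tangentM_eq[OF t] simp del: comp_apply)
    qed
    ultimately have "gNK (F t) (linv (linv_J w) (F t)) (linv (linv_J w) (F t)) = 0"
      unfolding normalM_def by simp
    then have "w = 0" by (simp add: gNK_linv[OF z] linv_g_JJ linv_g_eq_0 del: comp_apply)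
    then have "u \<in> ?D" using d by (simp add: w_def)
    then have "linv_J u \<in> ?D" using sub(3) by blast
    then show "y \<in> D (\<phi> t)" unfolding y coords0_def by simp
  qed
qed

text \<open>For a tangent vector \<open>w\<close> orthogonal to \<open>D1\<close>,
  \<open>G(v, w)\<close> lies in \<open>D3\<close> and hence in \<open>P D1\<close>, which is the
  hypothesis of \<open>G_parallel_PD_structure\<close>. Since \<open>n\<close> is a formula in a
  given \<open>v\<close>, a differentiable \<open>v\<close> yields a differentiable
  \<open>n\<close>.\<close>

lemma adapted_frame_exists:
  assumes t: "t \<in> U" and lc: "levi_civita cov"
    and D: "subspace (D1 M \<iota> (\<phi> t))" "dim (D1 M \<iota> (\<phi> t)) = 2" "Jst (F t) ` D1 M \<iota> (\<phi> t) = D1 M \<iota> (\<phi> t)"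
    and PD: "Pst (F t) ` D1 M \<iota> (\<phi> t) = D3 cov M \<iota> (\<phi> t)"
    and v: "linv v (F t) \<in> D1 M \<iota> (\<phi> t)" "v \<noteq> 0"
  defines "n \<equiv> cross3 (snd v) (fst v) /\<^sub>R norm (cross3 (snd v) (fst v))"
  shows "cross3 (snd v) (fst v) \<noteq> 0" "\<exists>u1 u2 w a x y. adapted_frame (P.mc t) (Q.mc t) n u1 u2 w a x y"
proof -
  note z = F_S3S3[OF t]
  have Ft: "\<iota> (\<phi> t) = F t" by simp
  have DT: "D1 M \<iota> (\<phi> t) \<subseteq> tangentM M \<iota> (\<phi> t)" by (simp add: D1_def)
  let ?D = "coords0 t (D1 M \<iota> (\<phi> t))"
  have sub: "subspace ?D" "dim ?D = 2" "linv_J ` ?D \<subseteq> ?D" "?D \<subseteq> T0 t"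
    using coords0_subspace[OF t D(1) DT] coords0_J[OF t D(3)] coords0_image(2)[OF t DT] D(2) by auto
  have vD: "v \<in> ?D" using v(1) by (simp add: coords0_def)
  note Dspan = J_plane_eq_span[OF sub(1-3) vD v(2)]
  have "?D \<noteq> T0 t" using sub(2) dim_T0[OF t] by auto
  then obtain u0 where u0: "u0 \<in> T0 t" "u0 \<notin> ?D" using sub(4) by blast
  define w where "w = u0 - J_proj v u0"
  have pD: "J_proj v u0 \<in> ?D" using J_proj_span Dspan by simp
  have wT: "w \<in> T0 t" using subspace_diff[OF subspace_T0[OF t] u0(1) subsetD[OF sub(4) pD]] by (simp add: w_def)
  have w0: "w \<noteq> 0" using u0 pD by (auto simp: w_def)
  have wv: "linv_g w v = 0" "linv_g w (linv_J v) = 0" using J_proj_orth[OF v(2)] by (simp_all add: w_def)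
  have wD: "linv_g w x = 0" if "x \<in> ?D" for x
    using linv_g_span_pair[OF _ wv] that Dspan by simp
  have wc: "linv w (F t) \<in> complM M \<iota> (D1 M \<iota>) (\<phi> t)"
    by (rule complM_linv[where D = "D1 M \<iota>", OF t DT wT wD])
  have zc: "linv 0 (F t) \<in> complM M \<iota> (D1 M \<iota>) (\<phi> t)"
    by (rule complM_linv[where D = "D1 M \<iota>", OF t DT subspace_0[OF subspace_T0[OF t]]]) (simp add: linv_g_def)
  have wD2: "linv w (F t) \<in> D2 M \<iota> (\<phi> t)"
  proof -
    have "linv w (F t) = linv w (F t) + Jst (\<iota> (\<phi> t)) (linv 0 (F t))"
      unfolding Ft Jst_linv[OF z] by (simp add: linv_J_simps linv_simps)
    then show ?thesis unfolding D2_def using wc zc by blast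
  qed
  have "Gtensor cov (linv v) (linv w) (F t) \<in> D3 cov M \<iota> (\<phi> t)"
    unfolding D3_def Ft using v(1) wD2 vector_field_linv[of "linv v" v] vector_field_linv[of "linv w" w]
    by (intro span_base) auto
  then have "linv (linv_G v w) (F t) \<in> Pst (F t) ` D1 M \<iota> (\<phi> t)"
    unfolding PD Gtensor_linv[OF lc z] .
  then obtain y where y: "y \<in> D1 M \<iota> (\<phi> t)" "linv (linv_G v w) (F t) = Pst (F t) y"
    by blast
  then obtain d where d: "d \<in> ?D" "y = linv d (F t)"
    using coords0_image(1)[OF t DT] by blast
  have Gd: "linv_G v w = prod.swap d" using y(2) unfolding d(2) Pst_linv[OF z] linv_eq_iff[OF z] .
  obtain r s where "d = r *\<^sub>R v + s *\<^sub>R linv_J v"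
    using d(1) unfolding Dspan by (auto simp: span_insert span_singleton) (metis add.commute diff_add_cancel)
  then have G: "linv_G v w = r *\<^sub>R prod.swap v + s *\<^sub>R prod.swap (linv_J v)"
    by (simp add: Gd prod_eq_iff)
  have o: "linv_g v w = 0" "linv_g (linv_J v) w = 0" using wv linv_g_sym by metis+
  note st = G_parallel_PD_structure[OF v(2) w0 o G, folded n_def]
  show "cross3 (snd v) (fst v) \<noteq> 0" by (rule st(1))
  obtain x y where xy: "w = (x *\<^sub>R n, y *\<^sub>R n)" using st(6) by blast
  \<comment> \<open>The scaling makes the second component of \<open>v1\<close> a unit vector, the
    \<open>a\<close> of the frame.\<close>
  define k where "k = 1 / norm (snd v)"
  have k: "k > 0" "norm (k *\<^sub>R snd v) = 1" using st(2) by (simp_all add: k_def)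
  define v1 where "v1 = k *\<^sub>R v"
  \<comment> \<open>With this sign the second component is \<open>cross3 n a\<close>, because
    \<open>2 \<alpha> - \<beta> = sqrt 3 (n \<times> \<beta>)\<close> on \<open>D1\<close>.\<close>
  define v2 where "v2 = - linv_J v1"
  have v1D: "v1 \<in> ?D" using subspace_scale[OF sub(1) vD] by (simp add: v1_def)
  have v2D: "v2 \<in> ?D" unfolding v2_def by (rule subspace_neg[OF sub(1) subsetD[OF sub(3) imageI[OF v1D]]])
  have v10: "v1 \<noteq> 0" using k(1) v(2) by (simp add: v1_def)
  define a where "a = snd v1"
  have a: "norm a = 1" "a \<bullet> n = 0" "fst v1 = (1/2) *\<^sub>R (a + sqrt 3 *\<^sub>R cross3 n a)"
  proof -
    show "norm a = 1" using k(2) by (simp add: a_def v1_def)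
    show "a \<bullet> n = 0" using st(4) by (simp add: a_def v1_def)
    show "fst v1 = (1/2) *\<^sub>R (a + sqrt 3 *\<^sub>R cross3 n a)"
      by (simp add: a_def v1_def st(5) cross3.scaleR_right) (simp add: algebra_simps)
  qed
  have v2: "v2 = ((1/2) *\<^sub>R (cross3 n a - sqrt 3 *\<^sub>R a), cross3 n a)"
    unfolding v2_def linv_J_def a(3) a_def[symmetric]
    by (simp add: prod_eq_iff vec_eq_iff field_simps)
  let ?f = "\<lambda>X. (P.mc t X, Q.mc t X)"
  have injf: "inj ?f" using U(4)[OF t] F'_linv[OF t] by (simp add: inj_def del: comp_apply)
  obtain X1 X2 X3 where X: "?f X1 = v1" "?f X2 = v2" "?f X3 = w"
    using v1D v2D sub(4) wT unfolding T0_def by (metis (no_types, lifting) imageE subsetD)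
  have ind: "independent {w, v1, v2}" "card {w, v1, v2} = 3"
  proof -
    have "v2 \<notin> span {v1}" using independent_J(3)[OF v10] span_neg[of v2 "{v1}"] by (auto simp: v2_def)
    then have 1: "independent {v1, v2}" "v1 \<noteq> v2"
      using v10 independent_insert[of v2 "{v1}"] by (auto simp: insert_commute intro: span_base)
    have "w \<notin> ?D" using wD[of w] linv_g_eq_0[of w] w0 by metis
    moreover have "span {v1, v2} \<subseteq> ?D" by (rule span_minimal[OF _ sub(1)]) (simp add: v1D v2D)
    ultimately have 2: "w \<notin> span {v1, v2}" by (meson subsetD)
    then have "w \<notin> {v1, v2}" by (meson span_base)
    then show "independent {w, v1, v2}" "card {w, v1, v2} = 3"
      using 1 2 by (simp_all add: independent_insert)
  qed
  have "{w, v1, v2} \<subseteq> T0 t" using wT v1D v2D sub(4) by blast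
  then have "span {w, v1, v2} \<subseteq> T0 t" using span_minimal subspace_T0[OF t] by blast
  moreover have "dim (span {w, v1, v2}) = 3" using dim_eq_card_independent[OF ind(1)] ind(2) by (simp only: dim_span)
  ultimately have T: "span {w, v1, v2} = T0 t"
    using subspace_dim_equal[OF subspace_span subspace_T0[OF t]] dim_T0[OF t] by simp
  have span: "span {X1, X2, X3} = UNIV"
  proof -
    have "?f ` span {X1, X2, X3} = span (?f ` {X1, X2, X3})"
      using linear_span_image[OF linear_mc_pair[OF t]] by metis
    also have "?f ` {X1, X2, X3} = {w, v1, v2}" using X by auto
    also have "span {w, v1, v2} = ?f ` UNIV" unfolding T T0_def ..
    finally show ?thesis using inj_image_eq_iff[OF injf] by blast
  qed
  have "adapted_frame (P.mc t) (Q.mc t) n X1 X2 X3 a x y"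
  proof (rule adapted_frame.intro)
    show "linear (P.mc t)" "linear (Q.mc t)" using P.linear_mc[OF t] Q.linear_mc[OF t] .
    show "x \<noteq> 0 \<or> y \<noteq> 0" using w0 xy by (auto simp: zero_prod_def)
    show "P.mc t X1 = (1/2) *\<^sub>R (a + sqrt 3 *\<^sub>R cross3 n a)" "Q.mc t X1 = a"
      using X(1) a(3) a_def by (metis fst_conv, metis snd_conv)
    show "P.mc t X2 = (1/2) *\<^sub>R (cross3 n a - sqrt 3 *\<^sub>R a)" "Q.mc t X2 = cross3 n a"
      using X(2) v2 by simp_all
    show "P.mc t X3 = x *\<^sub>R n" "Q.mc t X3 = y *\<^sub>R n"
      using X(3) xy by simp_all
  qed (use st a span in simp_all)
  then show "\<exists>u1 u2 w a x y. adapted_frame (P.mc t) (Q.mc t) n u1 u2 w a x y" by blast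
qed

end

section \<open>Immersions into the 3-sphere\<close>

lemma quat_decomp: "x$1 *\<^sub>R qone + qv (qim x) = x"
  by (simp add: quat_simps)

lemma qone_qv_simps [simp]: "qone$1 = 1" "qv t$1 = 0" "qim qone = 0"
  by (simp_all add: quat_simps)

lemma (in S3_map) continuous_p: "continuous_on U p" "continuous_on U (\<lambda>s. p' s X)"
  using deriv deriv2 open_U by (meson has_derivative_continuous continuous_at_imp_continuous_on)+

lemma S3_immersion_open_image:
  fixes p :: "real^3 \<Rightarrow> quat"
  assumes "S3_map U p p' p''" and W: "open W" "W \<subseteq> U" "t0 \<in> W" and inj: "inj (S3_map.mc p p' t0)"
  obtains N where "open N" "t0 \<in> N" "N \<subseteq> W" "inj_on p N" "openin (top_of_set S3) (p ` N)"
proof -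
  interpret S3_map U p p' p'' by fact
  \<comment> \<open>The inverse function theorem needs equal dimensions, so it is applied to the cone over \<open>p\<close>.\<close>
  define \<Psi> where "\<Psi> y = y$1 *\<^sub>R p (qim y)" for y :: quat
  define \<Omega> where "\<Omega> = qim -` W"
  define f where "f y h = h$1 *\<^sub>R p (qim y) + y$1 *\<^sub>R p' (qim y) (qim h)" for y h :: quat
  have cont_qim: "continuous_on A qim" for A by (rule linear_continuous_on[OF bounded_linear_qim])
  have open\<Omega>: "open \<Omega>" unfolding \<Omega>_def by (rule open_vimage[OF W(1) cont_qim])
  have \<Omega>U: "qim y \<in> U" if "y \<in> \<Omega>" for y using that W by (auto simp: \<Omega>_def)
  have d\<Psi>: "(\<Psi> has_derivative f y) (at y)" if "y \<in> \<Omega>" for y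
  proof -
    have "((\<lambda>y. p (qim y)) has_derivative (\<lambda>h. p' (qim y) (qim h))) (at y)"
      by (rule has_derivative_compose[OF bounded_linear_imp_has_derivative[OF bounded_linear_qim] deriv[OF \<Omega>U[OF that]]])
    moreover have "((\<lambda>y. y$1) has_derivative (\<lambda>h. h$1)) (at y)"
      by (rule bounded_linear_imp_has_derivative) (rule bounded_linear_vec_nth)
    ultimately have "((\<lambda>y. y$1 *\<^sub>R p (qim y)) has_derivative (\<lambda>h. y$1 *\<^sub>R p' (qim y) (qim h) + h$1 *\<^sub>R p (qim y))) (at y)"
      by (intro has_derivative_scaleR)
    then show ?thesis by (simp add: \<Psi>_def[abs_def] f_def[abs_def] add.commute)
  qed
  \<comment> \<open>The value 0 is a dummy: \<open>f y\<close> is known to be bounded linear for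
    \<open>y\<close> in \<Omega>.\<close>
  define f' where "f' y = (if y \<in> \<Omega> then Blinfun (f y) else 0)" for y
  have f': "blinfun_apply (f' y) = f y" if "y \<in> \<Omega>" for y
    using that has_derivative_bounded_linear[OF d\<Psi>] by (simp add: f'_def bounded_linear_Blinfun_apply)
  have cont: "continuous_on \<Omega> f'"
  proof (rule continuous_on_blinfun_componentwise)
    fix i :: quat
    have "continuous_on \<Omega> (\<lambda>y. f y i)"
      unfolding f_def
      by (intro continuous_intros continuous_on_compose2[OF continuous_p(1) cont_qim]
          continuous_on_compose2[OF continuous_p(2) cont_qim]) (auto simp: \<Omega>U)
    then show "continuous_on \<Omega> (\<lambda>y. blinfun_apply (f' y) i)"
      by (rule continuous_on_eq) (simp add: f')
  qed
  define y0 where "y0 = qone + qv t0"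
  have y0: "y0 \<in> \<Omega>" "qim y0 = t0" "y0$1 = 1" using W by (simp_all add: y0_def \<Omega>_def)
  have t0: "t0 \<in> U" using W by blast
  have lin: "linear (f y0)" using has_derivative_linear[OF d\<Psi>[OF y0(1)]] .
  have "inj (f y0)"
    unfolding linear_injective_0[OF lin]
  proof (intro allI impI)
    fix h assume "f y0 h = 0"
    then have "p t0 \<odot> (h$1 *\<^sub>R qone + qv (mc t0 (qim h))) = 0"
      by (simp add: f_def y0 p'_eq[OF t0] qmult.add_right qmult.scaleR_right)
    then have e: "h$1 *\<^sub>R qone + qv (mc t0 (qim h)) = 0"
      using S3_cnj_assoc(2)[OF S3[OF t0]] by (metis qmult.zero_right)
    then have "h$1 = 0" "mc t0 (qim h) = 0"
      using arg_cong[OF e, of "\<lambda>x. x$1"] arg_cong[OF e, of qim] by (simp_all add: quat_simps)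
    then have "qim h = 0" using inj by (simp add: linear_injective_0[OF linear_mc[OF t0]])
    then show "h = 0" using quat_decomp[of h] \<open>h$1 = 0\<close> by simp
  qed
  then obtain L where L: "linear L" "L \<circ> f y0 = id" using linear_injective_left_inverse[OF lin] by blast
  then have blL: "bounded_linear L" by (simp add: linear_conv_bounded_linear)
  have inv: "Blinfun L o\<^sub>L f' y0 = id_blinfun"
    by (rule blinfun_eqI) (use L(2) in \<open>simp add: f' y0 bounded_linear_Blinfun_apply[OF blL] fun_eq_iff\<close>)
  obtain U' V g where U': "open U'" "U' \<subseteq> \<Omega>" "y0 \<in> U'" "open V" "homeomorphism U' V \<Psi> g"
    using inverse_function_theorem[OF open\<Omega> _ cont y0(1) inv, of \<Psi>] d\<Psi> f' by metis
  \<comment> \<open>On \<open>U'\<close> the norm of \<open>\<Psi> y\<close> is the absolute value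
    of \<open>y$1\<close>; positivity makes the slice \<open>y$1 = 1\<close> the exact preimage of
    the sphere.\<close>
  define U2 where "U2 = U' \<inter> {y. y$1 > 0}"
  have "open {y :: quat. y$1 > 0}" by (intro open_Collect_less continuous_intros)
  then have "open U2" unfolding U2_def using U'(1) by blast
  then have "openin (top_of_set U') U2" by (simp add: U2_def openin_open_eq[OF U'(1)])
  then have "openin (top_of_set V) (\<Psi> ` U2)" by (rule homeomorphism_imp_open_map[OF U'(5)])
  then have op: "open (\<Psi> ` U2)" using U'(4) by (simp add: openin_open_eq)
  have inj\<Psi>: "inj_on \<Psi> U'" using U'(5) by (metis homeomorphism_def inj_on_inverseI)
  define N where "N = (\<lambda>t. qone + qv t) -` U2"
  have p\<Psi>: "p t = \<Psi> (qone + qv t)" for t by (simp add: \<Psi>_def)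
  have NW: "N \<subseteq> W" using U'(2) by (auto simp: N_def U2_def \<Omega>_def subset_iff)
  show ?thesis
  proof
    have "continuous_on UNIV (\<lambda>t. qone + qv t)"
      by (intro continuous_intros linear_continuous_on bounded_linear_qv)
    then show "open N" unfolding N_def by (rule open_vimage[OF \<open>open U2\<close>])
    show "t0 \<in> N" using U'(3) y0(3) by (simp add: N_def U2_def y0_def)
    show "N \<subseteq> W" by (rule NW)
    show "inj_on p N"
    proof (rule inj_onI)
      fix s t assume "s \<in> N" "t \<in> N" "p s = p t"
      then have "\<Psi> (qone + qv s) = \<Psi> (qone + qv t)" "qone + qv s \<in> U'" "qone + qv t \<in> U'"
        by (simp_all only: p\<Psi>) (simp_all add: N_def U2_def)
      then have "qone + qv s = qone + qv t" by (rule inj_onD[OF inj\<Psi>])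
      then show "s = t" by simp
    qed
    have "p ` N = S3 \<inter> \<Psi> ` U2"
    proof (intro equalityI subsetI)
      fix z assume "z \<in> p ` N"
      then show "z \<in> S3 \<inter> \<Psi> ` U2" using NW W(2) S3 p\<Psi> by (auto simp: N_def)
    next
      fix z assume "z \<in> S3 \<inter> \<Psi> ` U2"
      then obtain y where y: "y \<in> U2" "z = \<Psi> y" "norm z = 1" by (auto simp: S3_iff)
      then have "norm (p (qim y)) = 1" using \<Omega>U S3 U'(2) by (auto simp: U2_def S3_iff subset_iff)
      then have "y$1 = 1" using y by (simp add: \<Psi>_def U2_def)
      then have "y = qone + qv (qim y)" using quat_decomp[of y] by simp
      then show "z \<in> p ` N" using y p\<Psi> by (intro image_eqI[of _ _ "qim y"]) (auto simp: N_def)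
    qed
    then show "openin (top_of_set S3) (p ` N)" using op by (auto simp: openin_open)
  qed
qed

text \<open>These maps turn \<open>p\<close> or \<open>q\<close> into the parameter of the model
  immersions.\<close>

lemma openin_S3_image:
  assumes "openin (top_of_set S3) A" and a: "a \<in> S3"
  shows "openin (top_of_set S3) ((\<lambda>x. x \<odot> a) ` A)" "openin (top_of_set S3) ((\<lambda>x. qcnj x \<odot> a) ` A)"
proof -
  have c: "continuous_on S (\<lambda>x. x \<odot> a)" "continuous_on S qcnj" for S a
    by (rule linear_continuous_on[OF qmult.bounded_linear_left], rule linear_continuous_on[OF bounded_linear_qcnj])
  have "homeomorphism S3 S3 (\<lambda>x. x \<odot> a) (\<lambda>x. x \<odot> qcnj a)"
    by (rule homeomorphismI) (use a c in \<open>auto simp: qmult_assoc S3_cnj\<close>)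
  from homeomorphism_imp_open_map[OF this assms(1)]
  show "openin (top_of_set S3) ((\<lambda>x. x \<odot> a) ` A)" .
  have "homeomorphism S3 S3 (\<lambda>x. qcnj x \<odot> a) (\<lambda>x. qcnj (x \<odot> qcnj a))"
    by (rule homeomorphismI) (use a c in \<open>auto simp: qmult_assoc S3_cnj intro!: continuous_on_compose2[OF c(1)] continuous_on_compose2[OF c(2)]\<close>)
  from homeomorphism_imp_open_map[OF this assms(1)]
  show "openin (top_of_set S3) ((\<lambda>x. qcnj x \<odot> a) ` A)" .
qed

lemma qroot_conj_q0:
  assumes "norm m = 1"
  obtains c where "c \<in> S3" "qroot m = c \<odot> q0 \<odot> qcnj c"
proof -
  obtain c where c: "c \<in> S3" "qv m = c \<odot> qv (vector [1,0,0]) \<odot> qcnj c"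
    using unit_imag_conj[OF assms] by blast
  have "qroot m = c \<odot> q0 \<odot> qcnj c"
    unfolding q0_eq qroot_conj[OF c(1)] c(2)[symmetric] by (simp add: qroot_def)
  then show ?thesis using that c(1) by blast
qed

text \<open>\<open>u\<close> expresses the parameter of the model immersion in chart coordinates;
  its image of \<open>N\<close> serves as the open set \<open>W\<close> of the sphere.\<close>

lemma (in param) congruent_nbhd:
  assumes N: "open N" "t0 \<in> N" "N \<subseteq> U" and inj: "inj_on F N"
    and f: "f \<in> \<F>" "a \<in> S3" "b \<in> S3" "c \<in> S3" "openin (top_of_set S3) (u ` N)"
    and eq: "\<And>t. t \<in> N \<Longrightarrow> F t = Fiso a b c (f (u t))"
  shows "\<exists>N. openin M N \<and> \<phi> t0 \<in> N \<and> inj_on \<iota> N \<and>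
     (\<exists>f\<in>\<F>. \<exists>a\<in>S3. \<exists>b\<in>S3. \<exists>c\<in>S3. \<exists>W. openin (top_of_set S3) W \<and> \<iota> ` N = Fiso a b c ` f ` W)"
proof -
  have "homeomorphic_map (top_of_set U) (subtopology M (\<phi> ` U)) \<phi>"
    using param by (simp add: local_param_def)
  then have "open_map (top_of_set U) (subtopology M (\<phi> ` U)) \<phi>" by (rule homeomorphic_imp_open_map)
  moreover have "openin (top_of_set U) N" using N by (simp add: openin_open_eq U)
  ultimately have "openin (subtopology M (\<phi> ` U)) (\<phi> ` N)" by (simp add: open_map_def)
  then have 1: "openin M (\<phi> ` N)" using U(2) openin_trans_full by blast
  have 2: "\<phi> t0 \<in> \<phi> ` N" using N by blast
  have 3: "inj_on \<iota> (\<phi> ` N)" using inj by (auto simp: inj_on_def)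
  have "\<iota> ` \<phi> ` N = F ` N" by (simp add: image_comp)
  also have "\<dots> = (\<lambda>t. Fiso a b c (f (u t))) ` N" by (rule image_cong[OF refl eq])
  finally have 4: "\<iota> ` \<phi> ` N = Fiso a b c ` f ` u ` N" by (simp add: image_image)
  show ?thesis
    by (rule exI[of _ "\<phi> ` N"], intro conjI 1 2 3, rule bexI[OF _ f(1)], rule bexI[OF _ f(2)],
        rule bexI[OF _ f(3)], rule bexI[OF _ f(4)], rule exI[of _ "u ` N"]) (simp only: f(5) 4 simp_thms)
qed

section \<open>The classification\<close>

lemma submanifold3_param:
  assumes "submanifold3 M \<iota>" "local_param M \<iota> U \<phi>"
  shows "param M \<iota> U \<phi>"
  using assms by (simp add: param_def submanifold3_def)

lemma tangentM_subspace_dim: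
  assumes M: "submanifold3 M \<iota>" and x: "x \<in> topspace M"
  shows "subspace (tangentM M \<iota> x)" "dim (tangentM M \<iota> x) = 3"
    "\<And>y. y \<in> tangentM M \<iota> x \<Longrightarrow> \<exists>u. y = linv u (\<iota> x)"
proof -
  obtain U \<phi> t where \<phi>: "local_param M \<iota> U \<phi>" "t \<in> U" "x = \<phi> t"
    using M x unfolding submanifold3_def by blast
  interpret param M \<iota> U \<phi> by (rule submanifold3_param[OF M \<phi>(1)])
  have eq: "tangentM M \<iota> x = (\<lambda>u. linv u (F t)) ` T0 t" using tangentM_eq[OF \<phi>(2)] \<phi>(3) by simp
  show "subspace (tangentM M \<iota> x)"
    unfolding eq by (rule linear_subspace_image[OF linv_linear subspace_T0[OF \<phi>(2)]])
  show "dim (tangentM M \<iota> x) = 3"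
    unfolding eq using dim_image_eq[OF linv_linear inj_on_subset[OF linv_inj[OF \<phi>(2)] subset_UNIV]] dim_T0[OF \<phi>(2)] by metis
  show "\<exists>u. y = linv u (\<iota> x)" if "y \<in> tangentM M \<iota> x" for y
    using that unfolding eq by (auto simp: \<phi>(3))
qed

text \<open>Rank 3 would make \<open>M\<close> almost complex, rank 0 totally real, and in rank 1
  the map \<open>J\<close> would have a real eigenvector.\<close>

lemma CR_distribution_rank:
  assumes M: "submanifold3 M \<iota>" and D: "smooth_distribution M \<iota> k D"
    and J: "\<And>x. x \<in> topspace M \<Longrightarrow> Jst (\<iota> x) ` D x = D x"
    and perp: "\<And>x. x \<in> topspace M \<Longrightarrow> Jst (\<iota> x) ` complM M \<iota> D x \<subseteq> normalM M \<iota> x"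
    and nac: "\<not> almost_complex M \<iota>" and ntr: "\<not> totally_real M \<iota>"
  shows "k = 2"
proof -
  obtain x where x: "x \<in> topspace M" using nac by (auto simp: almost_complex_def)
  have Dx: "subspace (D x)" "dim (D x) = k" "D x \<subseteq> tangentM M \<iota> x" if "x \<in> topspace M" for x
    using D that unfolding smooth_distribution_def by blast+
  have S: "\<iota> x \<in> S3S3" if "x \<in> topspace M" for x using M that by (auto simp: submanifold3_def)
  have "k \<le> 3" using dim_subset[OF Dx(3)[OF x]] Dx(2)[OF x] tangentM_subspace_dim(2)[OF M x] by simp
  moreover have "k \<noteq> 3"
  proof
    assume k: "k = 3"
    have "D x = tangentM M \<iota> x" if "x \<in> topspace M" for x
      by (rule subspace_dim_equal[OF Dx(1)[OF that] tangentM_subspace_dim(1)[OF M that] Dx(3)[OF that]])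
        (simp add: tangentM_subspace_dim(2)[OF M that] Dx(2)[OF that] k)
    then show False using nac J unfolding almost_complex_def by metis
  qed
  moreover have "k \<noteq> 0"
  proof
    assume k: "k = 0"
    have "tangentM M \<iota> x \<subseteq> complM M \<iota> D x" if xM: "x \<in> topspace M" for x
    proof
      fix y assume y: "y \<in> tangentM M \<iota> x"
      then obtain u where u: "y = linv u (\<iota> x)" using tangentM_subspace_dim(3)[OF M xM] by blast
      have "gNK (\<iota> x) y v = 0" if v: "v \<in> D x" for v
      proof -
        have "v = 0" using v Dx(2)[OF xM] k by (metis dim_eq_0 singletonD subsetD)
        then have "v = linv 0 (\<iota> x)" by (simp add: linv_simps)
        then show ?thesis using gNK_linv[OF S[OF xM], of u 0] u by (simp add: linv_g_def)
      qed
      then show "y \<in> complM M \<iota> D x" using y by (simp add: complM_def)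
    qed
    then show False using ntr perp unfolding totally_real_def by (meson image_mono order_trans)
  qed
  moreover have "k \<noteq> 1"
  proof
    assume k: "k = 1"
    obtain v where v: "v \<in> D x" "v \<noteq> 0" using Dx(2)[OF x] k
      by (metis dim_eq_0 subsetI singletonI zero_neq_one insertCI)
    obtain u where u: "v = linv u (\<iota> x)" using tangentM_subspace_dim(3)[OF M x] v Dx(3)[OF x] by blast
    have sub: "span {v} \<subseteq> D x" using v Dx(1)[OF x] by (simp add: span_minimal)
    have "dim (span {v}) = 1" using v(2) by (simp add: dim_singleton)
    then have "span {v} = D x"
      using subspace_dim_equal[OF subspace_span Dx(1)[OF x] sub] Dx(2)[OF x] k by simp
    then have "Jst (\<iota> x) v \<in> span {v}" using J[OF x] v by blast
    then obtain c where "linv (linv_J u) (\<iota> x) = linv (c *\<^sub>R u) (\<iota> x)"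
      by (auto simp: span_singleton u Jst_linv[OF S[OF x]] linv_simps)
    then have "linv_J u = c *\<^sub>R u" by (simp only: linv_eq_iff[OF S[OF x]])
    then have "linv_J u \<in> span {u}" by (metis rangeI span_singleton)
    moreover have "u \<noteq> 0" using u v(2) by (auto simp: linv_simps)
    ultimately show False using independent_J(3) by blast
  qed
  ultimately show ?thesis by linarith
qed

section \<open>A differentiable \<open>n\<close> computed from a section of
  \<open>D1\<close>\<close>

context param
begin

definition E_coords :: "(real^3 \<Rightarrow> quat \<times> quat) \<Rightarrow> real^3 \<Rightarrow> tang" where
  "E_coords E t = (qim (qcnj (fst (F t)) \<odot> fst (E t)), qim (qcnj (snd (F t)) \<odot> snd (E t)))"

lemma E_coords:
  assumes t: "t \<in> U" and E: "E t \<in> tangentM M \<iota> (\<phi> t)"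
  shows "linv (E_coords E t) (F t) = E t"
proof -
  obtain u where "E t = linv u (F t)" using E unfolding tangentM_eq[OF t] by blast
  moreover from this have "E_coords E t = u"
    using F_S3S3[OF t] by (simp add: E_coords_def linv_def S3S3_iff S3_cnj_assoc prod_eq_iff del: comp_apply)
  ultimately show ?thesis by simp
qed

definition E_normal :: "(real^3 \<Rightarrow> quat \<times> quat) \<Rightarrow> real^3 \<Rightarrow> real^3" where
  "E_normal E t = cross3 (snd (E_coords E t)) (fst (E_coords E t)) /\<^sub>R norm (cross3 (snd (E_coords E t)) (fst (E_coords E t)))"

lemma E_normal_differentiable:
  assumes t: "t \<in> U" and E: "smooth_on U E" and ne: "cross3 (snd (E_coords E t)) (fst (E_coords E t)) \<noteq> 0"
  shows "E_normal E differentiable (at t)"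
proof -
  have dF: "F differentiable (at t)" and dE: "E differentiable (at t)"
    using F_deriv(1)[OF t] smooth_on_open_twice_differentiable(1)[OF U(1) E t] by (auto intro: differentiableI)
  have lin: "(\<lambda>t. L (f t)) differentiable (at t)" if "bounded_linear L" "f differentiable (at t)"
    for L :: "'x::real_normed_vector \<Rightarrow> 'y::real_normed_vector" and f :: "real^3 \<Rightarrow> 'x"
    using that bounded_linear.has_derivative unfolding differentiable_def by blast
  have bil: "(\<lambda>t. B (f t) (g t)) differentiable (at t)"
    if "bounded_bilinear B" "f differentiable (at t)" "g differentiable (at t)"
    for B :: "'x::real_normed_vector \<Rightarrow> 'y::real_normed_vector \<Rightarrow> 'z::real_normed_vector" and f g
    using that bounded_bilinear.FDERIV unfolding differentiable_def by blast
  have d: "(\<lambda>t. cross3 (snd (E_coords E t)) (fst (E_coords E t))) differentiable (at t)"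
    unfolding E_coords_def fst_conv snd_conv
    by (intro bil[OF bounded_bilinear_cross3] bil[OF bounded_bilinear_qmult] lin[OF bounded_linear_qim] lin[OF bounded_linear_qcnj]
        lin[OF bounded_linear_fst] lin[OF bounded_linear_snd] dF dE)
  let ?c = "\<lambda>t. cross3 (snd (E_coords E t)) (fst (E_coords E t))"
  obtain d' where d': "(?c has_derivative d') (at t)" using d by (auto simp: differentiable_def)
  have "(\<lambda>t. norm (?c t)) differentiable (at t)"
    by (rule differentiableI, rule has_derivative_compose[OF d' has_derivative_norm[OF ne]])
  then have "(\<lambda>t. inverse (norm (?c t))) differentiable (at t)"
    using ne by (intro differentiable_inverse) auto
  then show ?thesis
    unfolding E_normal_def[abs_def] using d by (intro differentiable_scaleR)
qed

end

theorem corollary1: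
  fixes M :: "'m topology" and \<iota> :: "'m \<Rightarrow> quat \<times> quat" and cov :: connection
  assumes "levi_civita cov"
    and "proper_CR_submanifold3 M \<iota>"
    and "\<forall>x\<in>topspace M. Pst (\<iota> x) ` D1 M \<iota> x = D3 cov M \<iota> x"
  shows "locally_congruent_to_one_of M \<iota> {f1, f2, f3}"
  unfolding locally_congruent_to_one_of_def
proof
  fix x assume x: "x \<in> topspace M"
  have M: "submanifold3 M \<iota>" and nac: "\<not> almost_complex M \<iota>" and ntr: "\<not> totally_real M \<iota>"
    using assms(2) by (auto simp: proper_CR_submanifold3_def CR_submanifold3_def)
  obtain k D where kD: "smooth_distribution M \<iota> k D \<and>
      (\<forall>x\<in>topspace M. Jst (\<iota> x) ` D x = D x \<and> Jst (\<iota> x) ` complM M \<iota> D x \<subseteq> normalM M \<iota> x)"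
    using assms(2) unfolding proper_CR_submanifold3_def CR_submanifold3_def by (elim conjE exE) (rule that, intro conjI)
  then have D: "smooth_distribution M \<iota> k D"
    and JD: "\<And>x. x \<in> topspace M \<Longrightarrow> Jst (\<iota> x) ` D x = D x"
    and perp: "\<And>x. x \<in> topspace M \<Longrightarrow> Jst (\<iota> x) ` complM M \<iota> D x \<subseteq> normalM M \<iota> x"
    by simp_all
  have k: "k = 2" by (rule CR_distribution_rank[OF M D JD perp nac ntr])
  have Dx: "subspace (D x)" "dim (D x) = 2" "D x \<subseteq> tangentM M \<iota> x" if "x \<in> topspace M" for x
    by (insert bspec[OF D[unfolded smooth_distribution_def k] that]; elim conjE; assumption)+
  obtain U \<phi> E where \<phi>: "local_param M \<iota> U \<phi>" "x \<in> \<phi> ` U" and E: "\<forall>i<2. smooth_on U (E i)"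
    "\<forall>t\<in>U. D (\<phi> t) = span {E i t | i. i < (2::nat)}"
    using bspec[OF D[unfolded smooth_distribution_def k] x] by (elim conjE exE) (rule that; assumption)
  obtain t0 where t0: "t0 \<in> U" "x = \<phi> t0" using \<phi>(2) by blast
  interpret param M \<iota> U \<phi> by (rule submanifold3_param[OF M \<phi>(1)])
  have DD1: "D (\<phi> t) = D1 M \<iota> (\<phi> t)" if "t \<in> U" for t
    using D_eq_D1[of t D] that Dx[OF \<phi>_top[OF that]] JD[OF \<phi>_top[OF that]] perp[OF \<phi>_top[OF that]] by simp
  let ?E = "E 0"
  let ?n = "E_normal ?E"
  \<comment> \<open>\<open>E 0 t\<close> and \<open>E 1 t\<close> span a plane, so neither of them
    is 0.\<close>
  have E0: "?E t \<in> D1 M \<iota> (\<phi> t)" "?E t \<noteq> 0" if t: "t \<in> U" for t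
  proof -
    have D2: "D (\<phi> t) = span {E 0 t, E 1 t}"
    proof -
      have "{E i t | i. i < (2::nat)} = {E 0 t, E 1 t}" by (auto simp: less_2_cases_iff)
      then show ?thesis using E(2) t by simp
    qed
    then show "?E t \<in> D1 M \<iota> (\<phi> t)" using DD1[OF t] by (auto intro: span_base)
    show "?E t \<noteq> 0"
    proof
      assume "?E t = 0"
      then have "D (\<phi> t) = span {E 1 t}" using D2 by simp
      then have "dim (D (\<phi> t)) \<le> 1" using dim_le_card[of "D (\<phi> t)" "{E 1 t}"] by simp
      then show False using Dx(2)[OF \<phi>_top[OF t]] by simp
    qed
  qed
  have lE: "linv (E_coords ?E t) (F t) = ?E t" if "t \<in> U" for t
    using E_coords[OF that] E0[OF that] by (simp add: D1_def)
  have fr: "cross3 (snd (E_coords ?E t)) (fst (E_coords ?E t)) \<noteq> 0"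
    "\<exists>u1 u2 w a x y. adapted_frame (P.mc t) (Q.mc t) (?n t) u1 u2 w a x y" if t: "t \<in> U" for t
  proof -
    have 1: "subspace (D1 M \<iota> (\<phi> t))" "dim (D1 M \<iota> (\<phi> t)) = 2" "Jst (F t) ` D1 M \<iota> (\<phi> t) = D1 M \<iota> (\<phi> t)"
      using Dx[OF \<phi>_top[OF t]] JD[OF \<phi>_top[OF t]] unfolding DD1[OF t] by simp_all
    have 2: "Pst (F t) ` D1 M \<iota> (\<phi> t) = D3 cov M \<iota> (\<phi> t)" using assms(3) \<phi>_top[OF t] by simp
    have 3: "linv (E_coords ?E t) (F t) \<in> D1 M \<iota> (\<phi> t)" unfolding lE[OF t] by (rule E0(1)[OF t])
    have 4: "E_coords ?E t \<noteq> 0" using lE[OF t] E0(2)[OF t] by (metis linv_simps(4))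
    show "cross3 (snd (E_coords ?E t)) (fst (E_coords ?E t)) \<noteq> 0"
      "\<exists>u1 u2 w a x y. adapted_frame (P.mc t) (Q.mc t) (?n t) u1 u2 w a x y"
      unfolding E_normal_def by (rule adapted_frame_exists[OF t assms(1) 1 2 3 4])+
  qed
  interpret pair: S3_pair U "\<lambda>t. fst (F t)" "\<lambda>t X. fst (F' t X)" "\<lambda>t X Y. fst (F'' t X Y)"
    "\<lambda>t. snd (F t)" "\<lambda>t X. snd (F' t X)" "\<lambda>t X Y. snd (F'' t X Y)" ?n "\<lambda>t. frechet_derivative ?n (at t)"
  proof
    fix t assume t: "t \<in> U"
    show "(?n has_derivative frechet_derivative ?n (at t)) (at t)"
      using E_normal_differentiable[OF t _ fr(1)[OF t]] E(1) by (simp flip: frechet_derivative_works)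
    show "\<exists>u v w a x y. adapted_frame (P.mc t) (Q.mc t) (?n t) u v w a x y" by (rule fr(2)[OF t])
  qed
  obtain r m e where r: "r > 0" "ball t0 r \<subseteq> U" and m: "norm m = 1" and e: "e \<in> S3"
    and cases: "(\<forall>t\<in>ball t0 r. inj (P.mc t) \<and> snd (F t) = e \<odot> fst (F t) \<odot> qroot m) \<or>
     (\<forall>t\<in>ball t0 r. inj (P.mc t) \<and> snd (F t) = e \<odot> qcnj (fst (F t)) \<odot> qroot m \<odot> fst (F t)) \<or>
     (\<forall>t\<in>ball t0 r. inj (Q.mc t) \<and> fst (F t) = e \<odot> qcnj (snd (F t)) \<odot> qroot m \<odot> snd (F t))"
    by (rule pair.local_rigidity[OF t0(1)])
  obtain c where c: "c \<in> S3" "qroot m = c \<odot> q0 \<odot> qcnj c" using qroot_conj_q0[OF m] by blast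
  have one: "qone \<in> S3" by (simp add: S3_iff norm_eq_1 inner_qone)
  have t0r: "t0 \<in> ball t0 r" using r by simp
  have FS: "fst (F t) \<in> S3" "snd (F t) \<in> S3" if "t \<in> U" for t using F_S3S3[OF that] by (simp_all add: S3S3_iff)
  from cases show "\<exists>N. openin M N \<and> x \<in> N \<and> inj_on \<iota> N \<and>
     (\<exists>f\<in>{f1, f2, f3}. \<exists>a\<in>S3. \<exists>b\<in>S3. \<exists>c\<in>S3. \<exists>W. openin (top_of_set S3) W \<and> \<iota> ` N = Fiso a b c ` f ` W)"
    unfolding t0(2)
  proof (elim disjE)
    assume h: "\<forall>t\<in>ball t0 r. inj (P.mc t) \<and> snd (F t) = e \<odot> fst (F t) \<odot> qroot m"
    obtain N where N: "open N" "t0 \<in> N" "N \<subseteq> ball t0 r" "inj_on (\<lambda>t. fst (F t)) N" "openin (top_of_set S3) ((\<lambda>t. fst (F t)) ` N)"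
      using S3_immersion_open_image[OF S3_map_fst open_ball r(2) t0r] h t0r by blast
    show "\<exists>N. openin M N \<and> \<phi> t0 \<in> N \<and> inj_on \<iota> N \<and>
     (\<exists>f\<in>{f1, f2, f3}. \<exists>a\<in>S3. \<exists>b\<in>S3. \<exists>c\<in>S3. \<exists>W. openin (top_of_set S3) W \<and> \<iota> ` N = Fiso a b c ` f ` W)"
    \<comment> \<open>With \<open>u = p c\<close> and
      \<open>qroot m = c q0 c\<^sup>-\<^sup>1\<close>: \<open>p = u c\<^sup>-\<^sup>1\<close> and
      \<open>q = e u q0 c\<^sup>-\<^sup>1\<close>.\<close>
    proof (rule congruent_nbhd[OF N(1,2), of f3 _ qone e c "\<lambda>t. fst (F t) \<odot> c"])
      show "inj_on F N" using N(4) by (auto simp: inj_on_def)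
      show "openin (top_of_set S3) ((\<lambda>t. fst (F t) \<odot> c) ` N)"
        using openin_S3_image(1)[OF N(5) c(1)] by (simp add: image_image del: comp_apply)
      show "F t = Fiso qone e c (f3 (fst (F t) \<odot> c))" if "t \<in> N" for t
      proof (rule prod_eqI)
        have "snd (F t) = e \<odot> fst (F t) \<odot> qroot m" using h that N(3) by blast
        then show "snd (F t) = snd (Fiso qone e c (f3 (fst (F t) \<odot> c)))"
          by (simp add: Fiso_def f3_def c(2) qmult_assoc del: comp_apply)
      qed (simp add: Fiso_def f3_def qmult_assoc S3_cnj[OF c(1)])
    qed (use N r e c one in auto)
  next
    assume h: "\<forall>t\<in>ball t0 r. inj (P.mc t) \<and> snd (F t) = e \<odot> qcnj (fst (F t)) \<odot> qroot m \<odot> fst (F t)"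
    obtain N where N: "open N" "t0 \<in> N" "N \<subseteq> ball t0 r" "inj_on (\<lambda>t. fst (F t)) N" "openin (top_of_set S3) ((\<lambda>t. fst (F t)) ` N)"
      using S3_immersion_open_image[OF S3_map_fst open_ball r(2) t0r] h t0r by blast
    show "\<exists>N. openin M N \<and> \<phi> t0 \<in> N \<and> inj_on \<iota> N \<and>
     (\<exists>f\<in>{f1, f2, f3}. \<exists>a\<in>S3. \<exists>b\<in>S3. \<exists>c\<in>S3. \<exists>W. openin (top_of_set S3) W \<and> \<iota> ` N = Fiso a b c ` f ` W)"
    \<comment> \<open>With \<open>u = p\<^sup>-\<^sup>1 c\<close>:
      \<open>p = c u\<^sup>-\<^sup>1\<close> and
      \<open>q = e u q0 u\<^sup>-\<^sup>1\<close>.\<close>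
    proof (rule congruent_nbhd[OF N(1,2), of f2 _ c e qone "\<lambda>t. qcnj (fst (F t)) \<odot> c"])
      show "inj_on F N" using N(4) by (auto simp: inj_on_def)
      show "openin (top_of_set S3) ((\<lambda>t. qcnj (fst (F t)) \<odot> c) ` N)"
        using openin_S3_image(2)[OF N(5) c(1)] by (simp add: image_image del: comp_apply)
      show "F t = Fiso c e qone (f2 (qcnj (fst (F t)) \<odot> c))" if "t \<in> N" for t
      proof -
        have tU: "t \<in> U" using that N(3) r(2) by blast
        have inv: "qinv (qcnj (fst (F t)) \<odot> c) = qcnj c \<odot> fst (F t)"
          using S3_qmult[OF S3_qcnj[OF FS(1)[OF tU]] c(1)] by (simp add: qinv_S3 qcnj_qmult del: comp_apply)
        have "snd (F t) = e \<odot> qcnj (fst (F t)) \<odot> qroot m \<odot> fst (F t)" using h that N(3) by blast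
        then show ?thesis
          by (intro prod_eqI) (simp_all add: Fiso_def f2_def inv c(2) qmult_assoc S3_cnj_assoc[OF c(1)] del: comp_apply)
      qed
    qed (use N r e c one in auto)
  next
    assume h: "\<forall>t\<in>ball t0 r. inj (Q.mc t) \<and> fst (F t) = e \<odot> qcnj (snd (F t)) \<odot> qroot m \<odot> snd (F t)"
    obtain N where N: "open N" "t0 \<in> N" "N \<subseteq> ball t0 r" "inj_on (\<lambda>t. snd (F t)) N" "openin (top_of_set S3) ((\<lambda>t. snd (F t)) ` N)"
      using S3_immersion_open_image[OF S3_map_snd open_ball r(2) t0r] h t0r by blast
    show "\<exists>N. openin M N \<and> \<phi> t0 \<in> N \<and> inj_on \<iota> N \<and>
     (\<exists>f\<in>{f1, f2, f3}. \<exists>a\<in>S3. \<exists>b\<in>S3. \<exists>c\<in>S3. \<exists>W. openin (top_of_set S3) W \<and> \<iota> ` N = Fiso a b c ` f ` W)"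
    \<comment> \<open>The previous case with \<open>p\<close> and \<open>q\<close> exchanged, so
      \<open>u = q\<^sup>-\<^sup>1 c\<close>.\<close>
    proof (rule congruent_nbhd[OF N(1,2), of f1 _ e c qone "\<lambda>t. qcnj (snd (F t)) \<odot> c"])
      show "inj_on F N" using N(4) by (auto simp: inj_on_def)
      show "openin (top_of_set S3) ((\<lambda>t. qcnj (snd (F t)) \<odot> c) ` N)"
        using openin_S3_image(2)[OF N(5) c(1)] by (simp add: image_image del: comp_apply)
      show "F t = Fiso e c qone (f1 (qcnj (snd (F t)) \<odot> c))" if "t \<in> N" for t
      proof -
        have tU: "t \<in> U" using that N(3) r(2) by blast
        have inv: "qinv (qcnj (snd (F t)) \<odot> c) = qcnj c \<odot> snd (F t)"
          using S3_qmult[OF S3_qcnj[OF FS(2)[OF tU]] c(1)] by (simp add: qinv_S3 qcnj_qmult del: comp_apply)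
        have "fst (F t) = e \<odot> qcnj (snd (F t)) \<odot> qroot m \<odot> snd (F t)" using h that N(3) by blast
        then show ?thesis
          by (intro prod_eqI) (simp_all add: Fiso_def f1_def inv c(2) qmult_assoc S3_cnj_assoc[OF c(1)] del: comp_apply)
      qed
    qed (use N r e c one in auto)
  qed
qed

end
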